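(* Let $r>0$ and $n\ge2$, and consider the triangular delay system $$\dot x_i(t)=f_i(x_{1,t},\ldots,x_{i,t},u(t))+x_{i+1}(t)+d_i(t),\ i=1,\ldots,n-1;\qquad \dot x_n(t)=f_n(x_{1,t},\ldots,x_{n,t},u(t))+d_n(t);\qquad ( * )$$ with measured output $y(t)=x_1(t)$, where $x(t)\in\mathbb{R}^n$, $u(t)\in\mathbb{R}^m$, $d(t)\in\mathbb{R}^n$, and $f_i:C^0([-r,0];\mathbb{R}^i)\times\mathbb{R}^m\to\mathbb{R}$ ($i=1,\ldots,n$) are globally Lipschitz functionals that vanish at the origin. Suppose that there exists a constant $\tilde L\ge0$ such that for $i=1,\ldots,n$ $$|f_i(x_1,\ldots,x_i,u)-f_i(z_1,\ldots,z_i,u)|\le\tilde L\sum_{j=1}^i\|x_j-z_j\|\quad\text{for all }(x_1,\ldots,x_i),(z_1,\ldots,z_i)\in C^0([-r,0];\mathbb{R}^i),\ u\in\mathbb{R}^m.$$ Let $A=\{a_{i,j}\}\in\mathbb{R}^{n\times n}$ be defined by $a_{i,i+1}=1$ for $i=1,\ldots,n-1$ and $a_{i,j}=0$ otherwise, let $c=(1,0,\ldots,0)^T\in\mathbb{R}^n$, and let $K=(K_1,\ldots,K_n)^T\in\mathbb{R}^n$ be such that $A+Kc^T$ is Hurwitz. Then there exist constants $\delta,\omega>0$, $\theta,Q_1,Q_2,Q_3\ge1$ such that for every sampling sequence $\{\tau_i\}_{i=0}^\infty$ with $\tau_0=0$, $\lim(\tau_i)=+\infty$, $0<\tau_{i+1}-\tau_i\le\delta$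 for all $i=0,1,\ldots$, and for every $(x_0,z_0)\in C^0([-r,0];\mathbb{R}^n)\times C^0([-r,0];\mathbb{R}^n)$, $u\in L^\infty_{loc}(\mathbb{R}_+;\mathbb{R}^m)$, $d\in L^\infty_{loc}(\mathbb{R}_+;\mathbb{R}^n)$, $\xi\in L^\infty_{loc}(\mathbb{R}_+;\mathbb{R})$, the solution $(x(t),z(t),w(t))$ of $( * )$ together with $$\dot z_i(t)=f_i(z_{1,t},\ldots,z_{i,t},u(t))+z_{i+1}(t)+\theta^iK_i(c^Tz(t)-w(t)),\ i=1,\ldots,n-1,\ t\ge0,$$ $$\dot z_n(t)=f_n(z_{1,t},\ldots,z_{n,t},u(t))+\theta^nK_n(c^Tz(t)-w(t)),\ t\ge0,\qquad \hat x_t=z_t,\ t\ge0,$$ $$\dot w(t)=f_1(z_{1,t},u(t))+z_2(t),\ t\in[\tau_i,\tau_{i+1}),\qquad w(\tau_i)=x_1(\tau_i)+\xi(\tau_i),\quad i=0,1,\ldots$$ with initial condition $(x_0,z_0)$, corresponding to inputs $u,d,\xi$, exists for all $t\ge0$ and satisfies for all $t\ge 0$ $$\|\hat x_t-x_t\|\le\exp(-\omega t)Q_1(\|x_0\|+\|z_0\|)+Q_2\sup_{0\le s\le t}\left(|\xi(s)|\exp(-\omega(t-s))\right)+Q_3\sup_{0\le s\le t}(|d(s)|).$$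
   Context: $|\cdot|$ is the Euclidean norm; for $x\in C^0([-r,0];\mathbb{R}^n)$, $\|x\|:=\max_{\theta\in[-r,0]}|x(\theta)|$ (also used for scalar components, $n=1$). For a continuous function $x$, $x_t$ denotes the history $x_t(\theta)=x(t+\theta)$, $\theta\in[-r,0]$, and $x_{j,t}$ is the history of the $j$-th component. $L^\infty_{loc}(\mathbb{R}_+;D)$ is the class of Lebesgue measurable, locally bounded mappings into $D$; suprema are actual (not essential) suprema. Solutions are continuous mappings, absolutely continuous for $t\ge0$, satisfying the differential equations almost everywhere with the prescribed initial histories on $[-r,0]$. The scalar signal $w$ is reset at each sampling time $\tau_i$ and evolves by its differential equation on $[\tau_i,\tau_{i+1})$. *)

theory Defs
  imports "HOL-Analysis.Analysis" "Jordan_Normal_Form.Char_Poly"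
begin

text \<open>
  The dimension \<open>n\<close> is a natural number and the functional \<open>f i\<close> acts on \<open>i\<close>-tuples of histories, so
  vectors of \<open>\<real>\<^sup>k\<close> are functions \<open>nat \<Rightarrow> real\<close> that are read on the indices \<open>1, \<dots>, k\<close> only. A
  vector-valued signal \<open>x\<close> is written \<open>x j t\<close> (component \<open>j\<close>, time \<open>t\<close>).
\<close>

text \<open>
  \<open>C\<^sup>0([-r,0]; \<real>\<^sup>k)\<close>. Functions are \<open>undefined\<close> outside of \<open>{1..k}\<close> and \<open>[-r,0]\<close>, so that a functional on
  this set cannot see anything but the history.
\<close>

definition C0 :: "real \<Rightarrow> nat \<Rightarrow> (nat \<Rightarrow> real \<Rightarrow> real) set" where
  "C0 r k = (\<Pi>\<^sub>E j\<in>{1..k}. {\<phi> \<in> extensional {-r..0}. continuous_on {-r..0} \<phi>})"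

definition zero_hist :: "real \<Rightarrow> nat \<Rightarrow> nat \<Rightarrow> real \<Rightarrow> real" where
  "zero_hist r k = (\<lambda>j\<in>{1..k}. \<lambda>\<theta>\<in>{-r..0}. 0)"

text \<open>The history \<open>(x\<^bsub>1,t\<^esub>, \<dots>, x\<^bsub>k,t\<^esub>)\<close>.\<close>

definition hist :: "real \<Rightarrow> nat \<Rightarrow> (nat \<Rightarrow> real \<Rightarrow> real) \<Rightarrow> real \<Rightarrow> (nat \<Rightarrow> real \<Rightarrow> real)" where
  "hist r k x t = (\<lambda>j\<in>{1..k}. \<lambda>\<theta>\<in>{-r..0}. x j (t + \<theta>))"

definition eucl_norm :: "nat \<Rightarrow> (nat \<Rightarrow> real) \<Rightarrow> real" where
  "eucl_norm k v = L2_set v {1..k}"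

text \<open>
  The suprema are attained for continuous arguments. Differences of histories are formed with the
  pointwise subtraction of functions.
\<close>

definition hist_norm :: "real \<Rightarrow> nat \<Rightarrow> (nat \<Rightarrow> real \<Rightarrow> real) \<Rightarrow> real" where
  "hist_norm r k \<phi> = (SUP \<theta>\<in>{-r..0}. eucl_norm k (\<lambda>j. \<phi> j \<theta>))"

definition scalar_hist_norm :: "real \<Rightarrow> (real \<Rightarrow> real) \<Rightarrow> real" where
  "scalar_hist_norm r \<phi> = (SUP \<theta>\<in>{-r..0}. \<bar>\<phi> \<theta>\<bar>)"

definition globally_lipschitz ::
    "real \<Rightarrow> nat \<Rightarrow> ((nat \<Rightarrow> real \<Rightarrow> real) \<Rightarrow> 'u::real_normed_vector \<Rightarrow> real) \<Rightarrow> bool" where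
  "globally_lipschitz r k g \<longleftrightarrow>
     (\<exists>L\<ge>0. \<forall>\<phi>\<in>C0 r k. \<forall>\<psi>\<in>C0 r k. \<forall>u v.
        \<bar>g \<phi> u - g \<psi> v\<bar> \<le> L * (hist_norm r k (\<phi> - \<psi>) + norm (u - v)))"

text \<open>Signals on \<open>[0,\<infinity>)\<close>; values at negative times are irrelevant.\<close>

definition Linf_loc :: "(real \<Rightarrow> 'b::real_normed_vector) \<Rightarrow> bool" where
  "Linf_loc v \<longleftrightarrow> v \<in> borel_measurable (lebesgue_on {0..}) \<and> (\<forall>T. bounded (v ` {0..T}))"

definition abs_cont_on :: "real \<Rightarrow> real \<Rightarrow> (real \<Rightarrow> real) \<Rightarrow> bool" where
  "abs_cont_on p q g \<longleftrightarrow>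
     (\<forall>\<epsilon>>0. \<exists>\<eta>>0. \<forall>(N::nat) a b.
        (\<forall>k<N. p \<le> a k \<and> a k \<le> b k \<and> b k \<le> q) \<longrightarrow>
        disjoint_family_on (\<lambda>k. {a k<..<b k}) {..<N} \<longrightarrow>
        (\<Sum>k<N. b k - a k) < \<eta> \<longrightarrow>
        (\<Sum>k<N. \<bar>g (b k) - g (a k)\<bar>) < \<epsilon>)"

text \<open>
  Matrices of Jordan Normal Form have indices starting from \<open>0\<close>, which accounts for the shifts by one.
\<close>

definition A_mat :: "nat \<Rightarrow> real mat" where
  "A_mat n = Matrix.mat n n (\<lambda>(i, j). if j = i + 1 then 1 else 0)"

definition c_vec :: "nat \<Rightarrow> real" where
  "c_vec j = (if j = 1 then 1 else 0)"

definition outer :: "nat \<Rightarrow> (nat \<Rightarrow> real) \<Rightarrow> (nat \<Rightarrow> real) \<Rightarrow> real mat" where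
  "outer n v w = Matrix.mat n n (\<lambda>(i, j). v (i + 1) * w (j + 1))"

definition hurwitz :: "real mat \<Rightarrow> bool" where
  "hurwitz M \<longleftrightarrow> (\<forall>\<mu>. eigenvalue (map_mat complex_of_real M) \<mu> \<longrightarrow> Re \<mu> < 0)"

text \<open>
  Solutions on the whole half-line: continuous on \<open>[-r,\<infinity>)\<close>, (locally) absolutely continuous on
  \<open>[0,\<infinity>)\<close>, with initial history \<open>\<phi>\<close>.
\<close>

definition admissible :: "real \<Rightarrow> nat \<Rightarrow> (nat \<Rightarrow> real \<Rightarrow> real) \<Rightarrow> (nat \<Rightarrow> real \<Rightarrow> real) \<Rightarrow> bool" where
  "admissible r n \<phi> x \<longleftrightarrow>
     (\<forall>i\<in>{1..n}. continuous_on {-r..} (x i) \<and> (\<forall>T>0. abs_cont_on 0 T (x i))) \<and> hist r n x 0 = \<phi>"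

definition plant_solution ::
    "real \<Rightarrow> nat \<Rightarrow> (nat \<Rightarrow> (nat \<Rightarrow> real \<Rightarrow> real) \<Rightarrow> 'u \<Rightarrow> real) \<Rightarrow> (real \<Rightarrow> 'u) \<Rightarrow> (nat \<Rightarrow> real \<Rightarrow> real)
      \<Rightarrow> (nat \<Rightarrow> real \<Rightarrow> real) \<Rightarrow> (nat \<Rightarrow> real \<Rightarrow> real) \<Rightarrow> bool" where
  "plant_solution r n f u d x0 x \<longleftrightarrow>
     admissible r n x0 x \<and>
     (AE t in lebesgue_on {0..}. \<forall>i\<in>{1..n}.
        (x i has_real_derivative
           f i (hist r i x t) (u t) + (if i < n then x (i + 1) t else 0) + d i t) (at t))"

definition observer_solution ::
    "real \<Rightarrow> nat \<Rightarrow> (nat \<Rightarrow> (nat \<Rightarrow> real \<Rightarrow> real) \<Rightarrow> 'u \<Rightarrow> real) \<Rightarrow> (nat \<Rightarrow> real) \<Rightarrow> real \<Rightarrow> (real \<Rightarrow> 'u)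
      \<Rightarrow> (real \<Rightarrow> real) \<Rightarrow> (nat \<Rightarrow> real \<Rightarrow> real) \<Rightarrow> (nat \<Rightarrow> real \<Rightarrow> real) \<Rightarrow> bool" where
  "observer_solution r n f K \<theta> u w z0 z \<longleftrightarrow>
     admissible r n z0 z \<and>
     (AE t in lebesgue_on {0..}. \<forall>i\<in>{1..n}.
        (z i has_real_derivative
           f i (hist r i z t) (u t) + (if i < n then z (i + 1) t else 0)
           + \<theta> ^ i * K i * ((\<Sum>j=1..n. c_vec j * z j t) - w t)) (at t))"

text \<open>
  The inter-sample predictor \<open>w\<close> may jump at the sampling times, hence absolute continuity is required
  on the compact subintervals of each \<open>[\<tau>\<^sub>k, \<tau>\<^bsub>k+1\<^esub>)\<close>.
\<close>

definition predictor_solution ::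
    "real \<Rightarrow> (nat \<Rightarrow> (nat \<Rightarrow> real \<Rightarrow> real) \<Rightarrow> 'u \<Rightarrow> real) \<Rightarrow> (nat \<Rightarrow> real) \<Rightarrow> (real \<Rightarrow> 'u) \<Rightarrow> (real \<Rightarrow> real)
      \<Rightarrow> (nat \<Rightarrow> real \<Rightarrow> real) \<Rightarrow> (nat \<Rightarrow> real \<Rightarrow> real) \<Rightarrow> (real \<Rightarrow> real) \<Rightarrow> bool" where
  "predictor_solution r f \<tau> u \<xi> x z w \<longleftrightarrow>
     (\<forall>k. w (\<tau> k) = x 1 (\<tau> k) + \<xi> (\<tau> k) \<and>
          (\<forall>b\<in>{\<tau> k..<\<tau> (Suc k)}. abs_cont_on (\<tau> k) b w) \<and>
          (AE t in lebesgue_on {\<tau> k..<\<tau> (Suc k)}.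
             (w has_real_derivative f 1 (hist r 1 z t) (u t) + z 2 t) (at t)))"

definition system_solution ::
    "real \<Rightarrow> nat \<Rightarrow> (nat \<Rightarrow> (nat \<Rightarrow> real \<Rightarrow> real) \<Rightarrow> 'u \<Rightarrow> real) \<Rightarrow> (nat \<Rightarrow> real) \<Rightarrow> real \<Rightarrow> (nat \<Rightarrow> real)
      \<Rightarrow> (real \<Rightarrow> 'u) \<Rightarrow> (nat \<Rightarrow> real \<Rightarrow> real) \<Rightarrow> (real \<Rightarrow> real)
      \<Rightarrow> (nat \<Rightarrow> real \<Rightarrow> real) \<Rightarrow> (nat \<Rightarrow> real \<Rightarrow> real)
      \<Rightarrow> (nat \<Rightarrow> real \<Rightarrow> real) \<Rightarrow> (nat \<Rightarrow> real \<Rightarrow> real) \<Rightarrow> (real \<Rightarrow> real) \<Rightarrow> bool" where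
  "system_solution r n f K \<theta> \<tau> u d \<xi> x0 z0 x z w \<longleftrightarrow>
     plant_solution r n f u d x0 x \<and>
     observer_solution r n f K \<theta> u w z0 z \<and>
     predictor_solution r f \<tau> u \<xi> x z w"

definition sampling_sequence :: "real \<Rightarrow> (nat \<Rightarrow> real) \<Rightarrow> bool" where
  "sampling_sequence \<delta> \<tau> \<longleftrightarrow>
     \<tau> 0 = 0 \<and> filterlim \<tau> at_top sequentially \<and>
     (\<forall>k. 0 < \<tau> (Suc k) - \<tau> k \<and> \<tau> (Suc k) - \<tau> k \<le> \<delta>)"

end

theory Submission
  imports Defs "Jordan_Normal_Form.Schur_Decomposition"
begin

text \<open>
  Consider the estimation error \<open>e = z - x\<close> in the scaled coordinates \<open>E\<^sub>j = e\<^sub>j / \<theta>\<^sup>j\<close>. Because of the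
  triangular structure of the plant and the gains \<open>\<theta>\<^sup>j K\<^sub>j\<close>, the scaled error solves
  \<open>E' = \<theta> (A + K c\<^sup>T) E + g\<close>, where \<open>g\<close> collects three terms: the differences of the functionals
  \<open>f\<^sub>j\<close>, which are bounded by the histories of \<open>E\<close> with a constant independent of \<open>\<theta>\<close>; the
  disturbance \<open>d\<close>; and \<open>K v\<close>, where \<open>v = w - x\<^sub>1\<close> is the error of the inter-sample predictor. The
  predictor error equals \<open>\<xi>(\<tau>\<^sub>k)\<close> at a sampling time and then drifts at a rate bounded by the
  histories of \<open>E\<close> and by \<open>d\<close>, so that the drift is proportional to \<open>\<delta>\<close>.

  All signals are measured in norms weighted by \<open>exp t\<close>, so that the decay rate is \<open>\<omega> = 1\<close>.
  A Hurwitz matrix is diagonal up to an arbitrarily small strictly triangular part in suitable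
  complex coordinates (\<open>hurwitz_triangular_coordinates\<close>). In these coordinates every
  component of the error solves a scalar equation with decay rate at least \<open>\<theta> \<sigma>\<close>, and its weighted peak is at
  most its initial size plus \<open>1 / (\<theta> \<sigma> - 1)\<close> times the weighted peak of its right-hand side
  (\<open>linear_ode_bound\<close>). The right-hand side contains the peak of the error itself, and a small-gain
  argument (\<open>stable_system_peak_bound\<close>) removes it: the triangular part is small by the choice of
  coordinates, the contribution of the functionals \<open>f\<^sub>j\<close> becomes small when \<open>\<theta>\<close> is large, and then,
  with \<open>\<theta>\<close> fixed, that of the predictor becomes small when \<open>\<delta>\<close> is small.

  Solutions are absolutely continuous and satisfy their equations almost everywhere only. The bridge
  from derivatives to increments is \<open>abs_cont_on_nonincreasing\<close>, which is applied to products of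
  error components with exponentials.

  For existence, the integral \<open>V\<close> of the right-hand side of the predictor is added as a state that
  is never reset. Then \<open>w\<close> is a function of the present and the past of the state, namely
  \<open>x\<^sub>1(\<tau>\<^sub>k) + \<xi>(\<tau>\<^sub>k) + V(t) - V(\<tau>\<^sub>k)\<close>, and the whole hybrid system becomes one causal Lipschitz
  integral equation, solved by Picard iteration (\<open>volterra_existence\<close>). Lebesgue's differentiation
  theorem turns its solution into a solution of the differential equations.
\<close>

section \<open>Absolutely continuous functions\<close>

text \<open>
  The argument of the Henstock integral: cover the exceptional null set by an open set of small
  measure, and choose a gauge that confines intervals tagged in the null set to this open set and
  makes the derivative effective at all other tags. By Cousin's lemma there is a fine tagged
  division; the increments over its two kinds of intervals are small by absolute continuity and by
  the sign of the derivative, respectively.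
\<close>

lemma abs_cont_on_nonincreasing:
  fixes g :: "real \<Rightarrow> real"
  assumes ac: "abs_cont_on p q g" and "p \<le> q" and "negligible N"
    and deriv: "\<And>t. t \<in> {p<..<q} - N \<Longrightarrow> \<exists>D\<le>0. (g has_real_derivative D) (at t)"
  shows "g q \<le> g p"
proof -
  have main: "g q - g p \<le> e * (q - p) + e" if "e > 0" for e :: real
  proof -
    obtain \<eta> where "\<eta> > 0" and \<eta>: "\<And>(M::nat) a b. (\<forall>k<M. p \<le> a k \<and> a k \<le> b k \<and> b k \<le> q) \<Longrightarrow>
        disjoint_family_on (\<lambda>k. {a k<..<b k}) {..<M} \<Longrightarrow>
        (\<Sum>k<M. b k - a k) < \<eta> \<Longrightarrow> (\<Sum>k<M. \<bar>g (b k) - g (a k)\<bar>) < e"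
      using ac \<open>e > 0\<close> unfolding abs_cont_on_def by meson
    \<comment> \<open>The end points join the null set, since the derivative is known in the interior only.\<close>
    define N' where "N' = N \<union> {p, q}"
    have "negligible N'" using assms(3) unfolding N'_def by (simp add: negligible_Un)
    then have N'leb: "N' \<in> null_sets lebesgue" by (simp add: negligible_iff_null_sets)
    then obtain T where T: "open T" "N' \<subseteq> T" "T - N' \<in> lmeasurable" "emeasure lebesgue (T - N') < ennreal \<eta>"
      using sets_lebesgue_outer_open[of N' \<eta>] \<open>\<eta> > 0\<close> by (metis null_setsD2)
    have emT: "emeasure lebesgue T < ennreal \<eta>"
    proof -
      have "emeasure lebesgue (T - N') = emeasure lebesgue T"
        by (rule emeasure_Diff_null_set[OF N'leb]) (use T(1) in auto)
      with T(4) show ?thesis by simp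
    qed
    have "\<exists>d>0. \<forall>u v. u \<le> t \<and> t \<le> v \<and> \<bar>u - t\<bar> < d \<and> \<bar>v - t\<bar> < d \<longrightarrow> g v - g u \<le> e * (v - u)"
      if t: "t \<in> {p..q} - N'" for t
    proof -
      have "t \<in> {p<..<q} - N" using t unfolding N'_def by auto
      then obtain D where "D \<le> 0" "(g has_real_derivative D) (at t)" using deriv by blast
      then obtain d where "d > 0" and d: "\<And>y. norm (y - t) < d \<Longrightarrow> norm (g y - g t - D * (y - t)) \<le> e * norm (y - t)"
        using \<open>e > 0\<close> unfolding has_field_derivative_def has_derivative_at_alt by meson
      show ?thesis
      proof (intro exI conjI allI impI)
        fix u v assume uv: "u \<le> t \<and> t \<le> v \<and> \<bar>u - t\<bar> < d \<and> \<bar>v - t\<bar> < d"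
        have "\<bar>g u - g t - D * (u - t)\<bar> \<le> e * (t - u)" "\<bar>g v - g t - D * (v - t)\<bar> \<le> e * (v - t)"
          using d[of u] d[of v] uv by auto
        moreover have "D * (v - t) \<le> 0" "D * (u - t) \<ge> 0"
          using uv \<open>D \<le> 0\<close> by (auto simp: mult_nonpos_nonneg mult_nonpos_nonpos)
        ultimately have "g v - g u \<le> e * (t - u) + e * (v - t)" by linarith
        then show "g v - g u \<le> e * (v - u)" by (simp add: algebra_simps)
      qed (rule \<open>d > 0\<close>)
    qed
    then obtain d where d0: "\<And>t. t \<in> {p..q} - N' \<Longrightarrow> d t > 0"
      and d: "\<And>t u v. t \<in> {p..q} - N' \<Longrightarrow> u \<le> t \<Longrightarrow> t \<le> v \<Longrightarrow> \<bar>u - t\<bar> < d t \<Longrightarrow> \<bar>v - t\<bar> < d t \<Longrightarrow> g v - g u \<le> e * (v - u)"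
      by metis
    define \<gamma> where "\<gamma> t = (if t \<in> N' then T else ball t (if t \<in> {p..q} then d t else 1))" for t
    have "gauge \<gamma>"
      unfolding gauge_def \<gamma>_def using T(1,2) d0 by auto
    then obtain P where P: "P tagged_division_of {p..q}" "\<gamma> fine P"
      using fine_division_exists_real by blast
    have finP: "finite P" using P(1) by blast
    have PK: "\<exists>u v. K = {u..v} \<and> p \<le> u \<and> u \<le> t \<and> t \<le> v \<and> v \<le> q \<and> Inf K = u \<and> Sup K = v" if tK: "(t, K) \<in> P" for t K
    proof -
      obtain u v where uv: "K = cbox u v" using tagged_division_ofD(4)[OF P(1) tK] by blast
      have "t \<in> K" "K \<subseteq> {p..q}" using tagged_division_ofD(2,3)[OF P(1) tK] by auto
      then show ?thesis using uv by (intro exI[of _ u] exI[of _ v]) auto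
    qed
    define P1 where "P1 = {z \<in> P. fst z \<in> N'}"
    define P2 where "P2 = {z \<in> P. fst z \<notin> N'}"
    have P12: "P = P1 \<union> P2" "P1 \<inter> P2 = {}" "finite P1" "finite P2"
      using finP unfolding P1_def P2_def by auto
    let ?inc = "\<lambda>z. g (Sup (snd z)) - g (Inf (snd z))"
    have "g q - g p = sum ?inc P"
      using additive_tagged_division_1[OF \<open>p \<le> q\<close> P(1), of g] by (simp add: case_prod_unfold)
    also have "\<dots> = sum ?inc P1 + sum ?inc P2"
      using P12 by (simp add: sum.union_disjoint)
    finally have split: "g q - g p = sum ?inc P1 + sum ?inc P2" .
    have "sum ?inc P2 \<le> (\<Sum>z\<in>P2. e * (Sup (snd z) - Inf (snd z)))"
    proof (rule sum_mono)
      fix z assume "z \<in> P2"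
      then obtain t K where z: "z = (t, K)" "(t, K) \<in> P" "t \<notin> N'" unfolding P2_def by (cases z) auto
      obtain u v where uv: "K = {u..v}" "p \<le> u" "u \<le> t" "t \<le> v" "v \<le> q" "Inf K = u" "Sup K = v" using PK[OF z(2)] by blast
      have "K \<subseteq> \<gamma> t" using P(2) z(2) unfolding fine_def by auto
      then have "u \<in> ball t (d t)" "v \<in> ball t (d t)" using uv z(3) unfolding \<gamma>_def
        by (auto simp: subset_iff)
      then have "g v - g u \<le> e * (v - u)"
        using uv z(3) by (intro d[of t]) (auto simp: dist_real_def)
      then show "?inc z \<le> e * (Sup (snd z) - Inf (snd z))" using z uv by simp
    qed
    also have "\<dots> \<le> (\<Sum>z\<in>P. e * (Sup (snd z) - Inf (snd z)))"
    proof (rule sum_mono2[OF finP])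
      fix z assume "z \<in> P - P2"
      then obtain u v where "Inf (snd z) = u" "Sup (snd z) = v" "u \<le> v" using PK[of "fst z" "snd z"] by auto
      then show "0 \<le> e * (Sup (snd z) - Inf (snd z))" using \<open>e > 0\<close> by simp
    qed (use P12 in auto)
    also have "\<dots> = e * (q - p)"
      using additive_tagged_division_1[OF \<open>p \<le> q\<close> P(1), of "\<lambda>x. x"]
      by (simp add: case_prod_unfold sum_distrib_left[symmetric])
    finally have s2: "sum ?inc P2 \<le> e * (q - p)" .
    obtain h where h: "bij_betw h {..<card P1} P1"
      using ex_bij_betw_nat_finite[OF P12(3)] by (auto simp: atLeast0LessThan)
    define a where "a k = Inf (snd (h k))" for k
    define b where "b k = Sup (snd (h k))" for k
    have hP: "h k \<in> P1" if "k < card P1" for k using h that by (auto simp: bij_betw_def)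
    have ab: "p \<le> a k" "a k \<le> b k" "b k \<le> q" "snd (h k) = {a k..b k}" "{a k<..<b k} \<subseteq> T" if kP: "k < card P1" for k
    proof -
      obtain t K where z: "h k = (t, K)" "(t, K) \<in> P" "t \<in> N'" using hP[OF kP] unfolding P1_def by (cases "h k") auto
      obtain u v where uv: "K = {u..v}" "p \<le> u" "u \<le> t" "t \<le> v" "v \<le> q" "Inf K = u" "Sup K = v" using PK[OF z(2)] by blast
      have "K \<subseteq> \<gamma> t" using P(2) z(2) unfolding fine_def by auto
      with z(3) have "K \<subseteq> T" unfolding \<gamma>_def by auto
      then show "p \<le> a k" "a k \<le> b k" "b k \<le> q" "snd (h k) = {a k..b k}" "{a k<..<b k} \<subseteq> T"
        using uv z unfolding a_def b_def by auto
    qed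
    have disj: "disjoint_family_on (\<lambda>k. {a k<..<b k}) {..<card P1}"
      unfolding disjoint_family_on_def
    proof (intro ballI impI)
      fix m n assume mn: "m \<in> {..<card P1}" "n \<in> {..<card P1}" "m \<noteq> n"
      then have "h m \<noteq> h n" using h unfolding bij_betw_def inj_on_def by blast
      moreover have "h m \<in> P" "h n \<in> P" using hP mn unfolding P1_def by auto
      ultimately have "interior (snd (h m)) \<inter> interior (snd (h n)) = {}"
        using tagged_division_ofD(5)[OF P(1)] by (metis prod.collapse)
      then show "{a m<..<b m} \<inter> {a n<..<b n} = {}" using ab(4) mn by simp
    qed
    have "ennreal (\<Sum>k<card P1. b k - a k) = (\<Sum>k<card P1. emeasure lebesgue {a k<..<b k})"
      using ab by (subst sum_ennreal[symmetric]) auto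
    also have "\<dots> = emeasure lebesgue (\<Union>k<card P1. {a k<..<b k})"
      by (rule sum_emeasure) (use disj in auto)
    also have "\<dots> \<le> emeasure lebesgue T"
      by (rule emeasure_mono[OF UN_least[OF ab(5)]]) (use T(1) in auto)
    also have "\<dots> < ennreal \<eta>" by (rule emT)
    finally have "(\<Sum>k<card P1. b k - a k) < \<eta>"
      by (rule ennreal_less_iff[THEN iffD1, rotated]) (use ab in \<open>auto intro!: sum_nonneg\<close>)
    then have "(\<Sum>k<card P1. \<bar>g (b k) - g (a k)\<bar>) < e"
      using ab disj by (intro \<eta>) auto
    moreover have "sum ?inc P1 = (\<Sum>k<card P1. g (b k) - g (a k))"
      unfolding a_def b_def by (rule sum.reindex_bij_betw[OF h, symmetric])
    moreover have "(\<Sum>k<card P1. g (b k) - g (a k)) \<le> (\<Sum>k<card P1. \<bar>g (b k) - g (a k)\<bar>)"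
      by (intro sum_mono) auto
    ultimately show ?thesis using split s2 by linarith
  qed
  show ?thesis
  proof (rule ccontr)
    assume "\<not> ?thesis"
    then have pos: "g q - g p > 0" by simp
    define e where "e = (g q - g p) / (2 * (q - p + 1))"
    have "e > 0" "e * (q - p + 1) = (g q - g p) / 2" using pos \<open>p \<le> q\<close> unfolding e_def by (auto simp: field_simps)
    moreover have "e * (q - p + 1) = e * (q - p) + e" by (simp add: algebra_simps)
    ultimately have "g q - g p \<le> (g q - g p) / 2" using main[OF \<open>e > 0\<close>] by simp
    then show False using pos by simp
  qed
qed

lemma abs_cont_on_subset:
  assumes "abs_cont_on p q g" "p \<le> p'" "q' \<le> q"
  shows "abs_cont_on p' q' g"
  unfolding abs_cont_on_def
proof (intro allI impI)
  fix e :: real assume "e > 0"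
  then obtain \<eta> where \<eta>: "\<eta> > 0" "\<And>(M::nat) a b. (\<forall>k<M. p \<le> a k \<and> a k \<le> b k \<and> b k \<le> q) \<Longrightarrow>
        disjoint_family_on (\<lambda>k. {a k<..<b k}) {..<M} \<Longrightarrow>
        (\<Sum>k<M. b k - a k) < \<eta> \<Longrightarrow> (\<Sum>k<M. \<bar>g (b k) - g (a k)\<bar>) < e"
    using assms(1) unfolding abs_cont_on_def by meson
  show "\<exists>\<eta>>0. \<forall>(N::nat) a b. (\<forall>k<N. p' \<le> a k \<and> a k \<le> b k \<and> b k \<le> q') \<longrightarrow>
        disjoint_family_on (\<lambda>k. {a k<..<b k}) {..<N} \<longrightarrow>
        (\<Sum>k<N. b k - a k) < \<eta> \<longrightarrow> (\<Sum>k<N. \<bar>g (b k) - g (a k)\<bar>) < e"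
    by (rule exI[of _ \<eta>]) (use \<eta> assms in \<open>force intro!: \<eta>(2)\<close>)
qed

lemma abs_cont_on_lipschitz:
  assumes "\<And>s t. s \<in> {p..q} \<Longrightarrow> t \<in> {p..q} \<Longrightarrow> \<bar>g t - g s\<bar> \<le> C * \<bar>t - s\<bar>"
  shows "abs_cont_on p q g"
  unfolding abs_cont_on_def
proof (intro allI impI)
  fix e :: real assume "e > 0"
  define C' where "C' = \<bar>C\<bar> + 1"
  have C': "C' > 0" "C \<le> C'" unfolding C'_def by auto
  show "\<exists>\<eta>>0. \<forall>(N::nat) a b. (\<forall>k<N. p \<le> a k \<and> a k \<le> b k \<and> b k \<le> q) \<longrightarrow>
        disjoint_family_on (\<lambda>k. {a k<..<b k}) {..<N} \<longrightarrow>
        (\<Sum>k<N. b k - a k) < \<eta> \<longrightarrow> (\<Sum>k<N. \<bar>g (b k) - g (a k)\<bar>) < e"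
  proof (intro exI[of _ "e / C'"] conjI allI impI)
    fix N :: nat and a b :: "nat \<Rightarrow> real"
    assume ab: "\<forall>k<N. p \<le> a k \<and> a k \<le> b k \<and> b k \<le> q" and s: "(\<Sum>k<N. b k - a k) < e / C'"
    have "(\<Sum>k<N. \<bar>g (b k) - g (a k)\<bar>) \<le> (\<Sum>k<N. C' * (b k - a k))"
    proof (rule sum_mono)
      fix k assume "k \<in> {..<N}"
      then have k: "p \<le> a k" "a k \<le> b k" "b k \<le> q" using ab by auto
      then have "\<bar>g (b k) - g (a k)\<bar> \<le> C * (b k - a k)" using assms[of "a k" "b k"] by auto
      also have "\<dots> \<le> C' * (b k - a k)" using k C' by (intro mult_right_mono) auto
      finally show "\<bar>g (b k) - g (a k)\<bar> \<le> C' * (b k - a k)" .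
    qed
    also have "\<dots> = C' * (\<Sum>k<N. b k - a k)" by (simp add: sum_distrib_left)
    also have "\<dots> < e" using s C' by (simp add: field_simps)
    finally show "(\<Sum>k<N. \<bar>g (b k) - g (a k)\<bar>) < e" .
  qed (use \<open>e > 0\<close> C' in auto)
qed

text \<open>
  All closure properties follow from this one: increments controlled by those of two absolutely
  continuous functions.
\<close>

lemma abs_cont_on_dominated:
  assumes "abs_cont_on p q g" "abs_cont_on p q h" "C \<ge> 0"
    and dom: "\<And>s t. p \<le> s \<Longrightarrow> s \<le> t \<Longrightarrow> t \<le> q \<Longrightarrow> \<bar>k t - k s\<bar> \<le> C * (\<bar>g t - g s\<bar> + \<bar>h t - h s\<bar>)"
  shows "abs_cont_on p q k"
  unfolding abs_cont_on_def
proof (intro allI impI)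
  fix e :: real assume "e > 0"
  define e' where "e' = e / (2 * (C + 1))"
  have e': "e' > 0" "C * (e' + e') < e"
  proof -
    show "e' > 0" using \<open>e > 0\<close> \<open>C \<ge> 0\<close> unfolding e'_def by auto
    have "e' + e' = e / (C + 1)" unfolding e'_def using \<open>C \<ge> 0\<close> by (simp add: divide_simps)
    then have "C * (e' + e') = e * (C / (C + 1))" by simp
    also have "\<dots> < e * 1" using \<open>e > 0\<close> \<open>C \<ge> 0\<close> by (intro mult_strict_left_mono) (auto simp: field_simps)
    finally show "C * (e' + e') < e" by simp
  qed
  obtain \<eta>1 where \<eta>1: "\<eta>1 > 0" "\<And>(M::nat) a b. (\<forall>k<M. p \<le> a k \<and> a k \<le> b k \<and> b k \<le> q) \<Longrightarrow>
        disjoint_family_on (\<lambda>k. {a k<..<b k}) {..<M} \<Longrightarrow>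
        (\<Sum>k<M. b k - a k) < \<eta>1 \<Longrightarrow> (\<Sum>k<M. \<bar>g (b k) - g (a k)\<bar>) < e'"
    using assms(1) e'(1) unfolding abs_cont_on_def by meson
  obtain \<eta>2 where \<eta>2: "\<eta>2 > 0" "\<And>(M::nat) a b. (\<forall>k<M. p \<le> a k \<and> a k \<le> b k \<and> b k \<le> q) \<Longrightarrow>
        disjoint_family_on (\<lambda>k. {a k<..<b k}) {..<M} \<Longrightarrow>
        (\<Sum>k<M. b k - a k) < \<eta>2 \<Longrightarrow> (\<Sum>k<M. \<bar>h (b k) - h (a k)\<bar>) < e'"
    using assms(2) e'(1) unfolding abs_cont_on_def by meson
  show "\<exists>\<eta>>0. \<forall>(N::nat) a b. (\<forall>k<N. p \<le> a k \<and> a k \<le> b k \<and> b k \<le> q) \<longrightarrow>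
        disjoint_family_on (\<lambda>k. {a k<..<b k}) {..<N} \<longrightarrow>
        (\<Sum>k<N. b k - a k) < \<eta> \<longrightarrow> (\<Sum>i<N. \<bar>k (b i) - k (a i)\<bar>) < e"
  proof (intro exI[of _ "min \<eta>1 \<eta>2"] conjI allI impI)
    fix N :: nat and a b :: "nat \<Rightarrow> real"
    assume ab: "\<forall>k<N. p \<le> a k \<and> a k \<le> b k \<and> b k \<le> q"
      and disj: "disjoint_family_on (\<lambda>k. {a k<..<b k}) {..<N}"
      and s: "(\<Sum>k<N. b k - a k) < min \<eta>1 \<eta>2"
    have "(\<Sum>i<N. \<bar>k (b i) - k (a i)\<bar>) \<le> (\<Sum>i<N. C * (\<bar>g (b i) - g (a i)\<bar> + \<bar>h (b i) - h (a i)\<bar>))"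
      using ab by (intro sum_mono dom) auto
    also have "\<dots> = C * ((\<Sum>i<N. \<bar>g (b i) - g (a i)\<bar>) + (\<Sum>i<N. \<bar>h (b i) - h (a i)\<bar>))"
      by (simp add: sum_distrib_left[symmetric] sum.distrib)
    also have "\<dots> \<le> C * (e' + e')"
      using \<eta>1(2)[OF ab disj] \<eta>2(2)[OF ab disj] s \<open>C \<ge> 0\<close> by (intro mult_left_mono add_mono) auto
    also have "\<dots> < e" by (rule e')
    finally show "(\<Sum>i<N. \<bar>k (b i) - k (a i)\<bar>) < e" .
  qed (use \<eta>1 \<eta>2 in auto)
qed

lemma abs_cont_on_add:
  assumes "abs_cont_on p q g" "abs_cont_on p q h"
  shows "abs_cont_on p q (\<lambda>t. g t + h t)"
  by (rule abs_cont_on_dominated[OF assms, of 1]) auto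

lemma abs_cont_on_diff:
  assumes "abs_cont_on p q g" "abs_cont_on p q h"
  shows "abs_cont_on p q (\<lambda>t. g t - h t)"
  by (rule abs_cont_on_dominated[OF assms, of 1]) auto

lemma abs_cont_on_mult:
  assumes "abs_cont_on p q g" "abs_cont_on p q h"
    and "continuous_on {p..q} g" "continuous_on {p..q} h"
  shows "abs_cont_on p q (\<lambda>t. g t * h t)"
proof -
  obtain C where C: "C \<ge> 0" "\<And>t. t \<in> {p..q} \<Longrightarrow> \<bar>g t\<bar> \<le> C" "\<And>t. t \<in> {p..q} \<Longrightarrow> \<bar>h t\<bar> \<le> C"
  proof -
    have "bounded (g ` {p..q})" "bounded (h ` {p..q})"
      using assms by (auto intro!: compact_imp_bounded compact_continuous_image)
    then obtain A B where "A > 0" "\<forall>t\<in>{p..q}. \<bar>g t\<bar> \<le> A" "B > 0" "\<forall>t\<in>{p..q}. \<bar>h t\<bar> \<le> B"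
      unfolding bounded_pos by auto
    then show ?thesis by (intro that[of "A + B"]) force+
  qed
  show ?thesis
  proof (rule abs_cont_on_dominated[OF assms(1,2) C(1)])
    fix s t assume st: "p \<le> s" "s \<le> t" "t \<le> q"
    have "g t * h t - g s * h s = (g t - g s) * h t + g s * (h t - h s)" by (simp add: algebra_simps)
    also have "\<bar>\<dots>\<bar> \<le> \<bar>g t - g s\<bar> * \<bar>h t\<bar> + \<bar>g s\<bar> * \<bar>h t - h s\<bar>"
      by (simp add: abs_triangle_ineq[THEN order_trans] abs_mult)
    also have "\<dots> \<le> \<bar>g t - g s\<bar> * C + C * \<bar>h t - h s\<bar>"
      using C st by (intro add_mono mult_left_mono mult_right_mono) auto
    finally show "\<bar>g t * h t - g s * h s\<bar> \<le> C * (\<bar>g t - g s\<bar> + \<bar>h t - h s\<bar>)" by (simp add: algebra_simps)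
  qed
qed

lemma abs_cont_on_sum:
  assumes "finite I" "\<And>i. i \<in> I \<Longrightarrow> abs_cont_on p q (g i)"
  shows "abs_cont_on p q (\<lambda>t. \<Sum>i\<in>I. g i t)"
  using assms
proof (induction I rule: finite_induct)
  case empty
  then show ?case by (auto intro!: abs_cont_on_lipschitz[where C=0])
next
  case (insert x F)
  then show ?case by (simp add: abs_cont_on_add)
qed

section \<open>Derivatives and integrals almost everywhere\<close>

text \<open>
  The one-sided version of Lebesgue's differentiation theorem is \<open>integrable_ccontinuous_explicit\<close>.
  Applied to \<open>h\<close> and to its reflection it yields the derivatives from the right and from the left.
\<close>

lemma integral_has_real_derivative_ae:
  fixes h :: "real \<Rightarrow> real"
  assumes int: "\<And>T. h integrable_on {0..T}"
  obtains N where "negligible N"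
    "\<And>t. t > 0 \<Longrightarrow> t \<notin> N \<Longrightarrow> ((\<lambda>t. integral {0..t} h) has_real_derivative h t) (at t)"
proof -
  define H where "H x = (if x \<in> {0..} then h x else 0)" for x
  have intH: "H integrable_on cbox a b" for a b
  proof -
    have "{0..} \<inter> {a..b} \<subseteq> {0..\<bar>b\<bar>}" "{0..} \<inter> {a..b} = {max 0 a..b}" by auto
    then have "h integrable_on ({0..} \<inter> {a..b})"
      using integrable_on_subinterval[OF int] by metis
    then show ?thesis unfolding H_def box_real(2) using integrable_restrict_Int by blast
  qed
  have intH': "(\<lambda>x. H (- x)) integrable_on cbox a b" for a b
    using intH[of "-b" "-a"] integrable_reflect[of H "-a" "-b"] by simp
  obtain N1 where N1: "negligible N1" "\<And>x e. \<lbrakk>x \<notin> N1; 0 < e\<rbrakk> \<Longrightarrow>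
       \<exists>d>0. \<forall>k. 0 < k \<and> k < d \<longrightarrow> norm (integral (cbox x (x + k *\<^sub>R One)) H /\<^sub>R k ^ DIM(real) - H x) < e"
    using integrable_ccontinuous_explicit[of H] intH by blast
  obtain N2 where N2: "negligible N2" "\<And>x e. \<lbrakk>x \<notin> N2; 0 < e\<rbrakk> \<Longrightarrow>
       \<exists>d>0. \<forall>k. 0 < k \<and> k < d \<longrightarrow> norm (integral (cbox x (x + k *\<^sub>R One)) (\<lambda>x. H (- x)) /\<^sub>R k ^ DIM(real) - H (- x)) < e"
    using integrable_ccontinuous_explicit[of "\<lambda>x. H (- x)"] intH' by blast
  define N where "N = N1 \<union> uminus ` N2"
  have "negligible (uminus ` N2)"
    by (rule negligible_differentiable_image_negligible[OF _ N2(1)]) (auto intro!: derivative_intros differentiable_on_minus differentiable_on_id[unfolded id_def])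
  then have "negligible N" unfolding N_def using N1 by (simp add: negligible_Un)
  moreover have "((\<lambda>t. integral {0..t} h) has_real_derivative h t) (at t)" if t: "t > 0" "t \<notin> N" for t
    unfolding has_field_derivative_iff
  proof (rule tendstoI)
    fix e :: real assume "e > 0"
    have "t \<notin> N1" "- t \<notin> N2" using t unfolding N_def by force+
    obtain d1 where d1: "d1 > 0" "\<And>k. 0 < k \<Longrightarrow> k < d1 \<Longrightarrow> \<bar>integral {t..t + k} H / k - H t\<bar> < e"
      using N1(2)[OF \<open>t \<notin> N1\<close> \<open>e > 0\<close>] by (auto simp: divide_inverse mult.commute)
    obtain d2 where d2: "d2 > 0" "\<And>k. 0 < k \<Longrightarrow> k < d2 \<Longrightarrow> \<bar>integral {- t..- t + k} (\<lambda>x. H (- x)) / k - H t\<bar> < e"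
      using N2(2)[OF \<open>- t \<notin> N2\<close> \<open>e > 0\<close>] by (auto simp: divide_inverse mult.commute)
    have comb: "integral {0..v} h - integral {0..u} h = integral {u..v} H" if "0 \<le> u" "u \<le> v" for u v
    proof -
      have "integral {0..u} h + integral {u..v} h = integral {0..v} h"
        by (rule Henstock_Kurzweil_Integration.integral_combine[OF that int])
      moreover have "integral {u..v} h = integral {u..v} H"
        by (rule integral_cong) (use that in \<open>auto simp: H_def\<close>)
      ultimately show ?thesis by simp
    qed
    have Ht: "H t = h t" using t unfolding H_def by simp
    have close: "dist ((integral {0..y} h - integral {0..t} h) / (y - t)) (h t) < e"
      if y: "y \<noteq> t" "dist y t < min t (min d1 d2)" for y
    proof (cases "y > t")
      case True
      then have "\<bar>integral {t..t + (y - t)} H / (y - t) - H t\<bar> < e"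
        using y by (intro d1) (auto simp: dist_real_def)
      then show ?thesis using comb[of t y] True t Ht by (simp add: dist_real_def)
    next
      case False
      then have "y < t" "y \<ge> 0" using y by (auto simp: dist_real_def)
      have "\<bar>integral {- t..- t + (t - y)} (\<lambda>x. H (- x)) / (t - y) - H t\<bar> < e"
        using y \<open>y < t\<close> by (intro d2) (auto simp: dist_real_def)
      moreover have "integral {- t..- t + (t - y)} (\<lambda>x. H (- x)) = integral {y..t} H"
        using Henstock_Kurzweil_Integration.integral_reflect_real[of t y H] by simp
      moreover have "integral {0..t} h - integral {0..y} h = integral {y..t} H" using comb[of y t] \<open>y < t\<close> \<open>y \<ge> 0\<close> by simp
      moreover have "(integral {0..y} h - integral {0..t} h) / (y - t) = (integral {0..t} h - integral {0..y} h) / (t - y)"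
        using \<open>y < t\<close> by (simp add: divide_simps) (simp add: algebra_simps)
      ultimately show ?thesis using Ht by (simp add: dist_real_def)
    qed
    show "\<forall>\<^sub>F y in at t. dist ((integral {0..y} h - integral {0..t} h) / (y - t)) (h t) < e"
      unfolding eventually_at using close d1(1) d2(1) t(1)
      by (intro exI[of _ "min t (min d1 d2)"]) auto
  qed
  ultimately show ?thesis using that by blast
qed

lemma measurable_bounded_integrable:
  fixes h :: "real \<Rightarrow> real"
  assumes "h \<in> borel_measurable (lebesgue_on {0..})" and "bounded (h ` {0..T})" "0 \<le> a" "b \<le> T"
  shows "h integrable_on {a..b}"
proof -
  obtain C where C: "\<And>t. t \<in> {0..T} \<Longrightarrow> norm (h t) \<le> C"
    using assms(2) unfolding bounded_iff by (meson imageI)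
  have "h \<in> borel_measurable (lebesgue_on {a..b})"
    by (rule measurable_restrict_mono[OF assms(1)]) (use assms in auto)
  then have "h absolutely_integrable_on {a..b}"
    using C assms(3,4)
    by (intro measurable_bounded_by_integrable_imp_absolutely_integrable[where g = "\<lambda>_. C"]) auto
  then show ?thesis by (rule set_lebesgue_integral_eq_integral(1))
qed

lemma integral_lipschitz:
  fixes h :: "real \<Rightarrow> real"
  assumes int: "h integrable_on {0..T}" and C: "\<And>t. t \<in> {0..T} \<Longrightarrow> \<bar>h t\<bar> \<le> C"
    and st: "s \<in> {0..T}" "t \<in> {0..T}"
  shows "\<bar>integral {0..t} h - integral {0..s} h\<bar> \<le> C * \<bar>t - s\<bar>"
proof -
  have *: "\<bar>integral {0..v} h - integral {0..u} h\<bar> \<le> C * \<bar>v - u\<bar>" if "0 \<le> u" "u \<le> v" "v \<le> T" for u v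
  proof -
    have iv: "h integrable_on {0..v}" "h integrable_on {u..v}"
      using int that by (auto intro: integrable_on_subinterval)
    have "integral {0..u} h + integral {u..v} h = integral {0..v} h"
      by (rule Henstock_Kurzweil_Integration.integral_combine[OF that(1,2) iv(1)])
    moreover have "norm (integral {u..v} h) \<le> C * (v - u)"
    proof -
      have "0 \<le> C" using C[of 0] that by (simp add: order_trans[OF abs_ge_zero])
      then have "norm (integral {u..v} h) \<le> C * measure lborel (cbox u v)"
        using C that integrable_integral[OF iv(2)] by (intro has_integral_bound[of C h]) auto
      then show ?thesis using that by simp
    qed
    ultimately show ?thesis using that by simp
  qed
  show ?thesis using *[of s t] *[of t s] st by (cases "s \<le> t") (auto simp: abs_minus_commute)
qed

lemma ae_imp_negligible:
  assumes "AE t in lebesgue_on S. P t" "S \<in> sets lebesgue"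
  obtains N where "negligible N" "\<And>t. t \<in> S \<Longrightarrow> t \<notin> N \<Longrightarrow> P t"
proof -
  have "AE t in lebesgue. t \<in> S \<longrightarrow> P t"
    using assms by (subst (asm) AE_restrict_space_iff) auto
  then obtain N where "{t \<in> space lebesgue. \<not> (t \<in> S \<longrightarrow> P t)} \<subseteq> N" "emeasure lebesgue N = 0" "N \<in> sets lebesgue"
    by (rule AE_E)
  then show ?thesis
    using that[of N] by (auto simp: negligible_iff_null_sets null_sets_def)
qed

lemma negligible_imp_ae:
  assumes "negligible N" "\<And>t. t \<in> S \<Longrightarrow> t \<notin> N \<Longrightarrow> P t" "S \<in> sets lebesgue"
  shows "AE t in lebesgue_on S. P t"
proof -
  have "AE t in lebesgue. t \<in> S \<longrightarrow> P t"
    by (rule AE_I'[of N]) (use assms in \<open>auto simp: negligible_iff_null_sets\<close>)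
  then show ?thesis using assms(3) by (subst AE_restrict_space_iff) auto
qed

section \<open>Functionals of histories\<close>

lemma hist_apply [simp]:
  "j \<in> {1..k} \<Longrightarrow> \<theta> \<in> {-r..0} \<Longrightarrow> hist r k x t j \<theta> = x j (t + \<theta>)"
  unfolding hist_def by simp

lemma hist_in_C0:
  assumes "\<And>j. j \<in> {1..k} \<Longrightarrow> continuous_on {-r..} (x j)" "t \<ge> 0"
  shows "hist r k x t \<in> C0 r k"
proof -
  have "continuous_on {-r..0} (\<lambda>\<theta>\<in>{-r..0}. x j (t + \<theta>))" if "j \<in> {1..k}" for j
  proof -
    have "continuous_on {-r..0} (\<lambda>\<theta>. x j (t + \<theta>))"
      by (rule continuous_on_compose2[OF assms(1)[OF that]]) (use assms(2) in \<open>auto intro!: continuous_intros\<close>)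
    then show ?thesis by (rule continuous_on_eq) auto
  qed
  then show ?thesis unfolding C0_def hist_def by auto
qed

lemma zero_hist_in_C0: "zero_hist r k \<in> C0 r k"
proof -
  have "continuous_on {-r..0} (\<lambda>\<theta>\<in>{-r..0}. 0::real)"
    by (rule continuous_on_eq[of _ "\<lambda>_. 0"]) auto
  then show ?thesis unfolding C0_def zero_hist_def by auto
qed

lemma scalar_hist_norm_le:
  assumes "r \<ge> 0" "\<And>\<theta>. \<theta> \<in> {-r..0} \<Longrightarrow> \<bar>\<phi> \<theta>\<bar> \<le> D"
  shows "scalar_hist_norm r \<phi> \<le> D"
  unfolding scalar_hist_norm_def by (rule cSUP_least) (use assms in auto)

lemma hist_norm_le:
  assumes "r \<ge> 0" "\<And>j \<theta>. j \<in> {1..k} \<Longrightarrow> \<theta> \<in> {-r..0} \<Longrightarrow> \<bar>\<phi> j \<theta>\<bar> \<le> D"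
  shows "hist_norm r k \<phi> \<le> k * D"
  unfolding hist_norm_def
proof (rule cSUP_least)
  fix \<theta> assume "\<theta> \<in> {-r..0}"
  have "eucl_norm k (\<lambda>j. \<phi> j \<theta>) \<le> (\<Sum>j=1..k. \<bar>\<phi> j \<theta>\<bar>)"
    unfolding eucl_norm_def by (rule L2_set_le_sum_abs)
  also have "\<dots> \<le> (\<Sum>j=1..k. D)" using assms(2) \<open>\<theta> \<in> {-r..0}\<close> by (intro sum_mono) auto
  finally show "eucl_norm k (\<lambda>j. \<phi> j \<theta>) \<le> k * D" by simp
qed (use assms(1) in auto)

lemma eucl_norm_nonneg: "0 \<le> eucl_norm k v"
  unfolding eucl_norm_def by (rule L2_set_nonneg)

lemma abs_le_eucl_norm: "j \<in> {1..k} \<Longrightarrow> \<bar>v j\<bar> \<le> eucl_norm k v"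
  unfolding eucl_norm_def using member_le_L2_set[of "{1..k}" j "\<lambda>j. \<bar>v j\<bar>"] by (simp add: L2_set_def)

lemma C0_le_hist_norm:
  assumes "\<phi> \<in> C0 r k" "j \<in> {1..k}" "\<theta> \<in> {-r..0}"
  shows "\<bar>\<phi> j \<theta>\<bar> \<le> hist_norm r k \<phi>"
proof -
  have "continuous_on {-r..0} (\<lambda>\<theta>. eucl_norm k (\<lambda>j. \<phi> j \<theta>))"
    unfolding eucl_norm_def L2_set_def using assms(1)
    by (intro continuous_intros) (auto simp: C0_def)
  then have "bdd_above ((\<lambda>\<theta>. eucl_norm k (\<lambda>j. \<phi> j \<theta>)) ` {-r..0})"
    by (intro bounded_imp_bdd_above compact_imp_bounded compact_continuous_image) auto
  then have "eucl_norm k (\<lambda>j. \<phi> j \<theta>) \<le> hist_norm r k \<phi>"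
    unfolding hist_norm_def by (rule cSUP_upper2[OF _ assms(3)]) simp
  with abs_le_eucl_norm[OF assms(2), of "\<lambda>j. \<phi> j \<theta>"] show ?thesis by simp
qed

lemma hist_norm_diff_tendsto:
  assumes cont: "\<And>j. j \<in> {1..k} \<Longrightarrow> continuous_on {-r..} (x j)" and "r \<ge> 0"
    and s: "s \<longlonglongrightarrow> t" "\<And>N. 0 \<le> s N"
  shows "(\<lambda>N. hist_norm r k (hist r k x (s N) - hist r k x t)) \<longlonglongrightarrow> 0"
proof -
  have "t \<ge> 0" using s by (meson LIMSEQ_le_const)
  have ev: "\<forall>\<^sub>F N in sequentially. hist_norm r k (hist r k x (s N) - hist r k x t) \<le> real k * e" if "e > 0" for e :: real
  proof -
    have "\<forall>j\<in>{1..k}. \<forall>\<^sub>F N in sequentially. \<forall>\<theta>\<in>{-r..0}. \<bar>x j (s N + \<theta>) - x j (t + \<theta>)\<bar> \<le> e"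
    proof
      fix j assume j: "j \<in> {1..k}"
      have "uniformly_continuous_on {-r..t+1} (x j)"
        by (intro compact_uniformly_continuous continuous_on_subset[OF cont[OF j]]) auto
      then obtain d where d: "d > 0" "\<And>p q. p \<in> {-r..t+1} \<Longrightarrow> q \<in> {-r..t+1} \<Longrightarrow> dist q p < d \<Longrightarrow> dist (x j q) (x j p) < e"
        using \<open>e > 0\<close> unfolding uniformly_continuous_on_def by meson
      have "\<forall>\<^sub>F N in sequentially. dist (s N) t < min d 1"
        using s(1) d(1) by (intro tendstoD) auto
      then show "\<forall>\<^sub>F N in sequentially. \<forall>\<theta>\<in>{-r..0}. \<bar>x j (s N + \<theta>) - x j (t + \<theta>)\<bar> \<le> e"
      proof eventually_elim
        case (elim N)
        show ?case
        proof
          fix \<theta> assume "\<theta> \<in> {-r..0}"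
          then have "dist (x j (s N + \<theta>)) (x j (t + \<theta>)) < e"
            using elim s(2)[of N] \<open>t \<ge> 0\<close> by (intro d) (auto simp: dist_real_def)
          then show "\<bar>x j (s N + \<theta>) - x j (t + \<theta>)\<bar> \<le> e" by (simp add: dist_real_def)
        qed
      qed
    qed
    then have "\<forall>\<^sub>F N in sequentially. \<forall>j\<in>{1..k}. \<forall>\<theta>\<in>{-r..0}. \<bar>x j (s N + \<theta>) - x j (t + \<theta>)\<bar> \<le> e"
      by (intro eventually_ball_finite) auto
    then show ?thesis
    proof eventually_elim
      case (elim N)
      then show ?case by (intro hist_norm_le[OF \<open>r \<ge> 0\<close>]) auto
    qed
  qed
  show ?thesis
  proof (rule tendstoI)
    fix e :: real assume "e > 0"
    have nn: "0 \<le> hist_norm r k (hist r k x (s N) - hist r k x t)" for N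
    proof -
      have "bdd_above ((\<lambda>\<theta>. eucl_norm k (\<lambda>j. (hist r k x (s N) - hist r k x t) j \<theta>)) ` {-r..0})"
      proof (intro bounded_imp_bdd_above compact_imp_bounded compact_continuous_image)
        show "continuous_on {-r..0} (\<lambda>\<theta>. eucl_norm k (\<lambda>j. (hist r k x (s N) - hist r k x t) j \<theta>))"
          unfolding eucl_norm_def L2_set_def
          using hist_in_C0[of k r x "s N"] hist_in_C0[of k r x t] cont s(2) \<open>t \<ge> 0\<close>
          by (intro continuous_intros) (auto simp: C0_def PiE_iff intro!: continuous_intros)
      qed auto
      then show ?thesis unfolding hist_norm_def
        by (rule cSUP_upper2[of _ _ 0]) (use \<open>r \<ge> 0\<close> eucl_norm_nonneg in auto)
    qed
    have "e / (k + 1) > 0" using \<open>e > 0\<close> by simp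
    from ev[OF this] show "\<forall>\<^sub>F N in sequentially. dist (hist_norm r k (hist r k x (s N) - hist r k x t)) 0 < e"
    proof eventually_elim
      case (elim N)
      also have "k * (e / (k + 1)) < e" using \<open>e > 0\<close> by (simp add: field_simps)
      finally show ?case using nn[of N] by simp
    qed
  qed
qed

text \<open>
  The time of the history is first rounded down to a grid, which leaves countably many functions
  of \<open>u\<close>, each of them continuous. Refining the grid gives the claim as a pointwise limit, because the history depends
  continuously on time.
\<close>

lemma functional_measurable:
  fixes f :: "(nat \<Rightarrow> real \<Rightarrow> real) \<Rightarrow> 'u::euclidean_space \<Rightarrow> real"
  assumes lip: "globally_lipschitz r k f" and "r \<ge> 0"
    and cont: "\<And>j. j \<in> {1..k} \<Longrightarrow> continuous_on {-r..} (x j)"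
    and u: "u \<in> borel_measurable (lebesgue_on {0..})"
  shows "(\<lambda>t. f (hist r k x t) (u t)) \<in> borel_measurable (lebesgue_on {0..})"
proof -
  obtain L where L: "L \<ge> 0" "\<And>\<phi> \<psi> u v. \<phi> \<in> C0 r k \<Longrightarrow> \<psi> \<in> C0 r k \<Longrightarrow>
      \<bar>f \<phi> u - f \<psi> v\<bar> \<le> L * (hist_norm r k (\<phi> - \<psi>) + norm (u - v))"
    using lip unfolding globally_lipschitz_def by blast
  have C0: "hist r k x t \<in> C0 r k" if "t \<ge> 0" for t by (intro hist_in_C0 cont that)
  define p where "p N t = real (nat \<lfloor>real (Suc N) * t\<rfloor>) / real (Suc N)" for N t
  have p: "p N t \<ge> 0" for N t unfolding p_def by simp
  have plim: "(\<lambda>N. p N t) \<longlonglongrightarrow> t" if "t \<ge> 0" for t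
  proof -
    have "\<bar>p N t - t\<bar> \<le> inverse (real (Suc N))" for N
    proof -
      define c where "c = real (Suc N)"
      define m where "m = real (nat \<lfloor>c * t\<rfloor>)"
      have "c > 0" unfolding c_def by simp
      have "m = of_int \<lfloor>c * t\<rfloor>" using that \<open>c > 0\<close> unfolding m_def by simp
      then have "\<bar>m - c * t\<bar> \<le> 1" by linarith
      moreover have "p N t - t = (m - c * t) / c"
        using \<open>c > 0\<close> unfolding p_def m_def c_def by (simp add: diff_divide_distrib)
      ultimately show ?thesis
        using \<open>c > 0\<close> divide_right_mono[of "\<bar>m - c * t\<bar>" 1 c] unfolding c_def[symmetric]
        by (simp add: abs_divide inverse_eq_divide)
    qed
    then have "(\<lambda>N. p N t - t) \<longlonglongrightarrow> 0"
      by (intro Lim_null_comparison[OF _ LIMSEQ_inverse_real_of_nat]) auto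
    then show ?thesis by (rule LIM_zero_cancel)
  qed
  have hn0: "hist_norm r k (\<phi> - \<phi>) = 0" for \<phi>
    unfolding hist_norm_def eucl_norm_def L2_set_def using \<open>r \<ge> 0\<close> by simp
  have m: "(\<lambda>t. f (hist r k x (p N t)) (u t)) \<in> borel_measurable (lebesgue_on {0..})" for N
    unfolding p_def
  proof (rule measurable_compose_countable[where f = "\<lambda>i t. f (hist r k x (real i / real (Suc N))) (u t)"])
    fix i :: nat
    have "continuous_on UNIV (f (hist r k x (real i / real (Suc N))))"
    proof (rule lipschitz_on_continuous_on[OF lipschitz_onI[OF _ L(1)]])
      fix v w :: 'u
      show "dist (f (hist r k x (real i / real (Suc N))) v) (f (hist r k x (real i / real (Suc N))) w) \<le> L * dist v w"
        using L(2)[OF C0[of "real i / real (Suc N)"] C0[of "real i / real (Suc N)"], of v w] hn0 by (simp add: dist_norm)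
    qed
    then show "(\<lambda>t. f (hist r k x (real i / real (Suc N))) (u t)) \<in> borel_measurable (lebesgue_on {0..})"
      using u by (rule borel_measurable_continuous_on)
  next
    have "(\<lambda>t::real. nat \<lfloor>real (Suc N) * t\<rfloor>) \<in> borel \<rightarrow>\<^sub>M count_space UNIV" by measurable
    then show "(\<lambda>t. nat \<lfloor>real (Suc N) * t\<rfloor>) \<in> lebesgue_on {0..} \<rightarrow>\<^sub>M count_space UNIV"
      by (intro measurable_restrict_space1 measurable_completion) simp
  qed
  show ?thesis
  proof (rule borel_measurable_LIMSEQ_metric[OF m])
    fix t :: real assume "t \<in> space (lebesgue_on {0..})"
    then have "t \<ge> 0" by simp
    have lim: "(\<lambda>N. L * hist_norm r k (hist r k x (p N t) - hist r k x t)) \<longlonglongrightarrow> 0"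
      by (intro tendsto_mult_right_zero hist_norm_diff_tendsto cont plim p \<open>t \<ge> 0\<close> \<open>r \<ge> 0\<close>)
    have "norm (f (hist r k x (p N t)) (u t) - f (hist r k x t) (u t))
        \<le> L * hist_norm r k (hist r k x (p N t) - hist r k x t)" for N
      using L(2)[OF C0[of "p N t"] C0[of t], of "u t" "u t"] p \<open>t \<ge> 0\<close> by simp
    then have "(\<lambda>N. f (hist r k x (p N t)) (u t) - f (hist r k x t) (u t)) \<longlonglongrightarrow> 0"
      by (intro Lim_null_comparison[OF always_eventually lim] allI)
    then show "(\<lambda>N. f (hist r k x (p N t)) (u t)) \<longlonglongrightarrow> f (hist r k x t) (u t)"
      by (rule LIM_zero_cancel)
  qed
qed

lemma functional_bounded:
  fixes f :: "(nat \<Rightarrow> real \<Rightarrow> real) \<Rightarrow> 'u::real_normed_vector \<Rightarrow> real"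
  assumes lip: "globally_lipschitz r k f" and "r \<ge> 0"
    and cont: "\<And>j. j \<in> {1..k} \<Longrightarrow> continuous_on {-r..} (x j)"
    and u: "bounded (u ` {0..T})"
  shows "bounded ((\<lambda>t. f (hist r k x t) (u t)) ` {0..T})"
proof -
  obtain L where L: "L \<ge> 0" "\<And>\<phi> \<psi> u v. \<phi> \<in> C0 r k \<Longrightarrow> \<psi> \<in> C0 r k \<Longrightarrow>
      \<bar>f \<phi> u - f \<psi> v\<bar> \<le> L * (hist_norm r k (\<phi> - \<psi>) + norm (u - v))"
    using lip unfolding globally_lipschitz_def by blast
  obtain U where U: "\<And>t. t \<in> {0..T} \<Longrightarrow> norm (u t) \<le> U"
    using u unfolding bounded_iff by (meson imageI)
  have "\<exists>C. \<forall>q\<in>{-r..T}. \<bar>x j q\<bar> \<le> C" if "j \<in> {1..k}" for j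
  proof -
    have "bounded (x j ` {-r..T})"
      by (intro compact_imp_bounded compact_continuous_image continuous_on_subset[OF cont[OF that]]) auto
    then show ?thesis unfolding bounded_iff by auto
  qed
  then obtain C where C: "\<And>j q. j \<in> {1..k} \<Longrightarrow> q \<in> {-r..T} \<Longrightarrow> \<bar>x j q\<bar> \<le> C j" by metis
  define D where "D = (\<Sum>j=1..k. \<bar>C j\<bar>)"
  have D: "\<bar>x j q\<bar> \<le> D" if "j \<in> {1..k}" "q \<in> {-r..T}" for j q
  proof -
    have "\<bar>C j\<bar> \<le> D" unfolding D_def using that by (intro member_le_sum[of j "{1..k}" "\<lambda>j. \<bar>C j\<bar>"]) auto
    then show ?thesis using C[OF that] by simp
  qed
  have "norm (f (hist r k x t) (u t)) \<le> \<bar>f (zero_hist r k) 0\<bar> + L * (k * D + U)" if t: "t \<in> {0..T}" for t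
  proof -
    have "\<bar>f (hist r k x t) (u t) - f (zero_hist r k) 0\<bar> \<le> L * (hist_norm r k (hist r k x t - zero_hist r k) + norm (u t - 0))"
      by (intro L(2) hist_in_C0 cont zero_hist_in_C0) (use t in auto)
    also have "\<dots> \<le> L * (k * D + U)"
    proof (intro mult_left_mono add_mono L(1) hist_norm_le \<open>r \<ge> 0\<close>)
      fix j \<theta> assume "j \<in> {1..k}" "\<theta> \<in> {-r..0}"
      then show "\<bar>(hist r k x t - zero_hist r k) j \<theta>\<bar> \<le> D"
        using D[of j "t + \<theta>"] t by (simp add: zero_hist_def)
    qed (use U t in simp)
    finally show ?thesis by simp
  qed
  then show ?thesis unfolding bounded_iff by blast
qed

lemma functional_diff_le:
  assumes L: "\<forall>\<phi>\<in>C0 r i. \<forall>\<psi>\<in>C0 r i. \<forall>u.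
           \<bar>f \<phi> u - f \<psi> u\<bar> \<le> L * (\<Sum>j=1..i. scalar_hist_norm r (\<phi> j - \<psi> j))"
    and "L \<ge> 0" "r \<ge> 0" "t \<ge> 0"
    and cont: "\<And>j. j \<in> {1..i} \<Longrightarrow> continuous_on {-r..} (z j)" "\<And>j. j \<in> {1..i} \<Longrightarrow> continuous_on {-r..} (x j)"
    and D: "\<And>j q. j \<in> {1..i} \<Longrightarrow> q \<in> {t-r..t} \<Longrightarrow> \<bar>z j q - x j q\<bar> \<le> D j"
  shows "\<bar>f (hist r i z t) u - f (hist r i x t) u\<bar> \<le> L * (\<Sum>j=1..i. D j)"
proof -
  have "\<bar>f (hist r i z t) u - f (hist r i x t) u\<bar>
      \<le> L * (\<Sum>j=1..i. scalar_hist_norm r (hist r i z t j - hist r i x t j))"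
    using L hist_in_C0[of i r z t] hist_in_C0[of i r x t] cont \<open>t \<ge> 0\<close> by blast
  also have "\<dots> \<le> L * (\<Sum>j=1..i. D j)"
  proof (intro mult_left_mono sum_mono \<open>L \<ge> 0\<close> scalar_hist_norm_le \<open>r \<ge> 0\<close>)
    fix j \<theta> assume "j \<in> {1..i}" "\<theta> \<in> {-r..0}"
    then show "\<bar>(hist r i z t j - hist r i x t j) \<theta>\<bar> \<le> D j" using D[of j "t + \<theta>"] by simp
  qed
  finally show ?thesis .
qed

section \<open>Causal Lipschitz integral equations\<close>

text \<open>
  The equation has memory, so that the Lipschitz condition bounds the right-hand side at time \<open>t\<close> by
  the peak of the difference on all of \<open>[-r,t]\<close>. Picard iteration still contracts by the factor
  \<open>1/2\<close> in the norm weighted by \<open>exp (- \<beta> t)\<close>, since increasing weights turn the peak over the past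
  into the value at the present.
\<close>

lemma volterra_existence:
  fixes G :: "(nat \<Rightarrow> real \<Rightarrow> real) \<Rightarrow> nat \<Rightarrow> real \<Rightarrow> real" and I :: "nat set"
  assumes "finite I" "r \<ge> 0" "\<Lambda> \<ge> 0"
    and lip: "\<And>X Y i t D. (\<And>j. j \<in> I \<Longrightarrow> continuous_on {-r..} (X j)) \<Longrightarrow> (\<And>j. j \<in> I \<Longrightarrow> continuous_on {-r..} (Y j)) \<Longrightarrow>
          (\<And>j q. j \<in> I \<Longrightarrow> q \<in> {-r..t} \<Longrightarrow> \<bar>X j q - Y j q\<bar> \<le> D) \<Longrightarrow> i \<in> I \<Longrightarrow> t \<ge> 0 \<Longrightarrow>
          \<bar>G X i t - G Y i t\<bar> \<le> \<Lambda> * D"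
    and int: "\<And>X i a b. (\<And>j. j \<in> I \<Longrightarrow> continuous_on {-r..} (X j)) \<Longrightarrow> i \<in> I \<Longrightarrow> 0 \<le> a \<Longrightarrow> G X i integrable_on {a..b}"
    and \<phi>: "\<And>i. i \<in> I \<Longrightarrow> continuous_on {-r..0} (\<phi> i)"
  obtains X where "\<And>i. i \<in> I \<Longrightarrow> continuous_on {-r..} (X i)"
    "\<And>i q. i \<in> I \<Longrightarrow> q \<in> {-r..0} \<Longrightarrow> X i q = \<phi> i q"
    "\<And>i t. i \<in> I \<Longrightarrow> t \<ge> 0 \<Longrightarrow> X i t = \<phi> i 0 + integral {0..t} (G X i)"
proof -
  define cont where "cont X \<longleftrightarrow> (\<forall>j\<in>I. continuous_on {-r..} (X j))" for X :: "nat \<Rightarrow> real \<Rightarrow> real"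
  define \<Phi> where "\<Phi> X i t = (if t \<le> 0 then \<phi> i t else \<phi> i 0 + integral {0..t} (G X i))" for X i t
  define Pic where "Pic k = (\<Phi> ^^ k) (\<lambda>i t. \<phi> i (min t 0))" for k
  have Pic_Suc: "Pic (Suc k) = \<Phi> (Pic k)" for k unfolding Pic_def by simp
  have int': "G X i integrable_on {0..b}" if "cont X" "i \<in> I" for X i b
    using that int unfolding cont_def by blast
  have cont_from: "continuous_on {-r..} g" if g: "\<And>T. T \<ge> 0 \<Longrightarrow> continuous_on {-r..T} g" for g :: "real \<Rightarrow> real"
    unfolding continuous_on_eq_continuous_within
  proof
    fix t assume "t \<in> {-r..}"
    define T where "T = \<bar>t\<bar> + 1"
    have "continuous (at t within {-r..T}) g"
      using g[of T] \<open>t \<in> {-r..}\<close> unfolding T_def continuous_on_eq_continuous_within by auto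
    moreover have "at t within {-r..T} = at t within {-r..}"
      by (rule at_within_nhd[of _ "{..<T}"]) (auto simp: T_def)
    ultimately show "continuous (at t within {-r..}) g" by simp
  qed
  have cont\<Phi>: "cont (\<Phi> X)" if "cont X" for X
    unfolding cont_def
  proof (intro ballI cont_from)
    fix i and T :: real assume i: "i \<in> I" and "T \<ge> 0"
    have "continuous_on ({-r..0} \<union> {0..T}) (\<lambda>t. if t \<le> 0 then \<phi> i t else \<phi> i 0 + integral {0..t} (G X i))"
    proof (rule continuous_on_cases)
      show "continuous_on {0..T} (\<lambda>t. \<phi> i 0 + integral {0..t} (G X i))"
        by (intro continuous_intros indefinite_integral_continuous_1 int'[OF that i])
    qed (use \<phi>[OF i] in auto)
    moreover have "{-r..T} = {-r..0} \<union> {0..T}" using \<open>r \<ge> 0\<close> \<open>T \<ge> 0\<close> by auto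
    ultimately show "continuous_on {-r..T} (\<Phi> X i)" unfolding \<Phi>_def by simp
  qed
  have contP: "cont (Pic k)" for k
  proof (induction k)
    case 0
    have "continuous_on {-r..} (\<lambda>t. \<phi> i (min t 0))" if "i \<in> I" for i
      by (rule continuous_on_compose2[OF \<phi>[OF that]]) (use \<open>r \<ge> 0\<close> in \<open>auto intro!: continuous_intros\<close>)
    then show ?case unfolding cont_def Pic_def by simp
  next
    case (Suc k)
    then show ?case unfolding Pic_Suc by (rule cont\<Phi>)
  qed
  have P_init: "Pic k i q = \<phi> i q" if "q \<le> 0" for k i q
    using that by (cases k) (auto simp: Pic_Suc \<Phi>_def Pic_def min_def)
  have P_step: "Pic (Suc k) i t = \<phi> i 0 + integral {0..t} (G (Pic k) i)" if "t \<ge> 0" for k i t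
    using that unfolding Pic_Suc \<Phi>_def by auto
  \<comment> \<open>Any \<open>\<beta> > 0\<close> with \<open>\<Lambda> / \<beta> \<le> 1 / 2\<close> will do.\<close>
  define \<beta> where "\<beta> = 2 * \<Lambda> + 1"
  have \<beta>: "\<beta> > 0" "\<Lambda> / \<beta> \<le> 1 / 2" using \<open>\<Lambda> \<ge> 0\<close> unfolding \<beta>_def by (auto simp: field_simps)
  have geom: "\<exists>C\<ge>0. \<forall>k. \<forall>i\<in>I. \<forall>t\<in>{-r..T}. \<bar>Pic (Suc k) i t - Pic k i t\<bar> \<le> C * (1/2) ^ k" for T
  proof -
    have "\<exists>C. \<forall>t\<in>{0..T}. \<bar>Pic 1 i t - Pic 0 i t\<bar> \<le> C" if "i \<in> I" for i
    proof -
      have "continuous_on {0..T} (\<lambda>t. Pic 1 i t - Pic 0 i t)"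
        using contP[of 0] contP[of 1] that \<open>r \<ge> 0\<close> unfolding cont_def
        by (intro continuous_on_diff) (auto elim!: continuous_on_subset)
      then have "bounded ((\<lambda>t. Pic 1 i t - Pic 0 i t) ` {0..T})"
        by (intro compact_imp_bounded compact_continuous_image) auto
      then show ?thesis unfolding bounded_iff by auto
    qed
    then obtain c where c: "\<And>i t. i \<in> I \<Longrightarrow> t \<in> {0..T} \<Longrightarrow> \<bar>Pic 1 i t - Pic 0 i t\<bar> \<le> c i" by metis
    define C where "C = (\<Sum>i\<in>I. \<bar>c i\<bar>)"
    have "C \<ge> 0" unfolding C_def by (intro sum_nonneg) auto
    have C: "\<bar>Pic 1 i t - Pic 0 i t\<bar> \<le> C" if "i \<in> I" "t \<in> {0..T}" for i t
    proof -
      have "\<bar>c i\<bar> \<le> C" unfolding C_def using that \<open>finite I\<close> by (intro member_le_sum[of i I "\<lambda>i. \<bar>c i\<bar>"]) auto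
      then show ?thesis using c[OF that] by simp
    qed
    have *: "\<bar>Pic (Suc k) i t - Pic k i t\<bar> \<le> C * (1/2) ^ k * exp (\<beta> * t)" if "i \<in> I" "t \<in> {0..T}" for k i t
      using that
    proof (induction k arbitrary: i t)
      case 0
      have "C * 1 \<le> C * exp (\<beta> * t)"
        using \<open>C \<ge> 0\<close> 0 \<beta> by (intro mult_left_mono) auto
      then show ?case using C[OF 0] by simp
    next
      case (Suc k)
      let ?c = "\<Lambda> * (C * (1/2) ^ k)"
      have d: "\<bar>G (Pic (Suc k)) i s - G (Pic k) i s\<bar> \<le> ?c * exp (\<beta> * s)" if s: "s \<in> {0..t}" for s
      proof -
        have "\<bar>G (Pic (Suc k)) i s - G (Pic k) i s\<bar> \<le> \<Lambda> * (C * (1/2) ^ k * exp (\<beta> * s))"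
        proof (rule lip)
          fix j q assume jq: "j \<in> I" "q \<in> {-r..s}"
          show "\<bar>Pic (Suc k) j q - Pic k j q\<bar> \<le> C * (1/2) ^ k * exp (\<beta> * s)"
          proof (cases "q \<le> 0")
            case True
            then show ?thesis using P_init \<open>C \<ge> 0\<close> by simp
          next
            case False
            have "\<bar>Pic (Suc k) j q - Pic k j q\<bar> \<le> C * (1/2) ^ k * exp (\<beta> * q)"
              using jq False s Suc.prems by (intro Suc.IH) auto
            also have "\<dots> \<le> C * (1/2) ^ k * exp (\<beta> * s)"
              using jq \<beta> \<open>C \<ge> 0\<close> by (intro mult_left_mono) auto
            finally show ?thesis .
          qed
        qed (use contP Suc.prems s in \<open>auto simp: cont_def\<close>)
        then show ?thesis by (simp add: mult.assoc)
      qed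
      have ex: "((\<lambda>s. ?c * exp (\<beta> * s)) has_integral (?c * exp (\<beta> * t) / \<beta> - ?c * exp (\<beta> * 0) / \<beta>)) {0..t}"
        using Suc.prems \<beta>
        by (intro fundamental_theorem_of_calculus)
           (auto intro!: derivative_eq_intros simp: has_real_derivative_iff_has_vector_derivative[symmetric])
      have "\<bar>Pic (Suc (Suc k)) i t - Pic (Suc k) i t\<bar> = norm (integral {0..t} (\<lambda>s. G (Pic (Suc k)) i s - G (Pic k) i s))"
        using Suc.prems P_step[of t "Suc k" i] P_step[of t k i]
        by (simp add: Henstock_Kurzweil_Integration.integral_diff int' contP)
      also have "\<dots> \<le> integral {0..t} (\<lambda>s. ?c * exp (\<beta> * s))"
        using d Suc.prems
        by (intro integral_norm_bound_integral integrable_diff int' contP) (use ex in \<open>auto simp: has_integral_integrable\<close>)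
      also have "\<dots> = ?c * exp (\<beta> * t) / \<beta> - ?c * exp (\<beta> * 0) / \<beta>" using ex by (rule integral_unique)
      also have "\<dots> \<le> ?c * exp (\<beta> * t) / \<beta>" using \<open>\<Lambda> \<ge> 0\<close> \<open>C \<ge> 0\<close> \<beta> by simp
      also have "\<dots> = (\<Lambda> / \<beta>) * (C * (1/2) ^ k * exp (\<beta> * t))" by simp
      also have "\<dots> \<le> (1/2) * (C * (1/2) ^ k * exp (\<beta> * t))"
        using \<beta> \<open>C \<ge> 0\<close> by (intro mult_right_mono) auto
      finally show ?case by simp
    qed
    have "\<bar>Pic (Suc k) i t - Pic k i t\<bar> \<le> (C * exp (\<beta> * \<bar>T\<bar>)) * (1/2) ^ k" if "i \<in> I" "t \<in> {-r..T}" for k i t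
    proof (cases "t \<le> 0")
      case True
      then show ?thesis using P_init \<open>C \<ge> 0\<close> by simp
    next
      case False
      then have "\<bar>Pic (Suc k) i t - Pic k i t\<bar> \<le> C * (1/2) ^ k * exp (\<beta> * t)" using that by (intro *) auto
      also have "\<dots> \<le> C * (1/2) ^ k * exp (\<beta> * \<bar>T\<bar>)" using that \<beta> \<open>C \<ge> 0\<close> by (intro mult_left_mono) auto
      finally show ?thesis by (simp add: mult_ac)
    qed
    then show ?thesis using \<open>C \<ge> 0\<close> by (intro exI[of _ "C * exp (\<beta> * \<bar>T\<bar>)"]) auto
  qed
  define X where "X i t = Pic 0 i t + (\<Sum>k. Pic (Suc k) i t - Pic k i t)" for i t
  have unif: "uniform_limit {-r..T} (\<lambda>k. Pic k i) (X i) sequentially" if iI: "i \<in> I" for i T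
  proof -
    obtain C where "C \<ge> 0" and C: "\<And>k t. t \<in> {-r..T} \<Longrightarrow> \<bar>Pic (Suc k) i t - Pic k i t\<bar> \<le> C * (1/2) ^ k"
      using geom[of T] iI by blast
    have "uniform_limit {-r..T} (\<lambda>n t. \<Sum>k<n. Pic (Suc k) i t - Pic k i t) (\<lambda>t. \<Sum>k. Pic (Suc k) i t - Pic k i t) sequentially"
      by (rule Weierstrass_m_test[where M = "\<lambda>k. C * (1/2) ^ k"])
         (use C in \<open>auto intro!: summable_mult summable_geometric\<close>)
    then have "uniform_limit {-r..T} (\<lambda>n t. Pic 0 i t + (\<Sum>k<n. Pic (Suc k) i t - Pic k i t)) (X i) sequentially"
      unfolding X_def by (intro uniform_limit_add uniform_limit_const)
    moreover have "Pic 0 i t + (\<Sum>k<n. Pic (Suc k) i t - Pic k i t) = Pic n i t" for n t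
      using sum_lessThan_telescope[of "\<lambda>k. Pic k i t" n] by simp
    ultimately show ?thesis by simp
  qed
  have contX: "cont X"
    unfolding cont_def
  proof (intro ballI cont_from)
    fix i and T :: real assume i: "i \<in> I"
    show "continuous_on {-r..T} (X i)"
    proof (rule uniform_limit_theorem[OF _ unif[OF i]])
      have "continuous_on {-r..T} (Pic k i)" for k
        by (rule continuous_on_subset[of "{-r..}"]) (use contP[of k] i in \<open>auto simp: cont_def\<close>)
      then show "\<forall>\<^sub>F k in sequentially. continuous_on {-r..T} (Pic k i)" by simp
    qed simp
  qed
  have lim: "(\<lambda>k. Pic k i t) \<longlonglongrightarrow> X i t" if "i \<in> I" "t \<ge> -r" for i t
    by (rule tendsto_uniform_limitI[OF unif[OF that(1)]]) (use that in auto)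
  have init: "X i q = \<phi> i q" if "i \<in> I" "q \<in> {-r..0}" for i q
  proof -
    have "(\<lambda>k. Pic k i q) = (\<lambda>k. \<phi> i q)" using P_init that(2) by auto
    then have "(\<lambda>k. \<phi> i q) \<longlonglongrightarrow> X i q" using lim[of i q] that by auto
    then show ?thesis by (simp add: LIMSEQ_const_iff)
  qed
  have fix_eq: "X i t = \<phi> i 0 + integral {0..t} (G X i)" if i: "i \<in> I" and t: "t \<ge> 0" for i t
  proof -
    have "(\<lambda>k. Pic (Suc k) i t) \<longlonglongrightarrow> \<phi> i 0 + integral {0..t} (G X i)"
    proof (rule tendstoI)
      fix e :: real assume "e > 0"
      define e' where "e' = e / (\<Lambda> * t + 1)"
      have den: "\<Lambda> * t + 1 > 0" using t \<open>\<Lambda> \<ge> 0\<close> by (simp add: add_nonneg_pos)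
      have e': "e' > 0" "\<Lambda> * e' * t < e"
      proof -
        show "e' > 0" unfolding e'_def using den \<open>e > 0\<close> by simp
        have "e' * (\<Lambda> * t + 1) = e" unfolding e'_def using den by simp
        then show "\<Lambda> * e' * t < e" using \<open>e' > 0\<close> by (simp add: algebra_simps)
      qed
      have "\<forall>j\<in>I. \<forall>\<^sub>F k in sequentially. \<forall>q\<in>{-r..t}. dist (Pic k j q) (X j q) < e'"
        using unif e'(1) unfolding uniform_limit_iff by blast
      then have "\<forall>\<^sub>F k in sequentially. \<forall>j\<in>I. \<forall>q\<in>{-r..t}. dist (Pic k j q) (X j q) < e'"
        using \<open>finite I\<close> by (intro eventually_ball_finite) auto
      then show "\<forall>\<^sub>F k in sequentially. dist (Pic (Suc k) i t) (\<phi> i 0 + integral {0..t} (G X i)) < e"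
      proof eventually_elim
        case (elim k)
        have "\<bar>G (Pic k) i s - G X i s\<bar> \<le> \<Lambda> * e'" if s: "s \<in> {0..t}" for s
        proof (rule lip)
          fix j q assume "j \<in> I" "q \<in> {-r..s}"
          then have "dist (Pic k j q) (X j q) < e'" using elim s by auto
          then show "\<bar>Pic k j q - X j q\<bar> \<le> e'" by (simp add: dist_real_def)
        qed (use contP contX i s in \<open>auto simp: cont_def\<close>)
        then have "norm (integral {0..t} (\<lambda>s. G (Pic k) i s - G X i s)) \<le> integral {0..t} (\<lambda>s. \<Lambda> * e')"
          by (intro integral_norm_bound_integral integrable_diff int' contP contX i) auto
        also have "\<dots> = \<Lambda> * e' * t" using t by simp
        also have "\<dots> < e" by (rule e')
        finally have "norm (integral {0..t} (\<lambda>s. G (Pic k) i s - G X i s)) < e" .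
        then show ?case
          using P_step[OF t, of k i] by (simp add: dist_real_def Henstock_Kurzweil_Integration.integral_diff int' contP contX i)
      qed
    qed
    moreover have "(\<lambda>k. Pic (Suc k) i t) \<longlonglongrightarrow> X i t" using lim[of i t] i t \<open>r \<ge> 0\<close> by (intro LIMSEQ_Suc) auto
    ultimately show ?thesis by (rule LIMSEQ_unique[rotated])
  qed
  show ?thesis by (rule that[of X]) (use contX init fix_eq in \<open>auto simp: cont_def\<close>)
qed

section \<open>Existence of solutions of the sampled system\<close>

lemma Linf_loc_add:
  fixes g h :: "real \<Rightarrow> real"
  assumes "Linf_loc g" "Linf_loc h"
  shows "Linf_loc (\<lambda>t. g t + h t)"
  using assms unfolding Linf_loc_def by (auto intro!: bounded_plus_comp)

lemma Linf_loc_diff: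
  fixes g h :: "real \<Rightarrow> real"
  assumes "Linf_loc g" "Linf_loc h"
  shows "Linf_loc (\<lambda>t. g t - h t)"
  using assms unfolding Linf_loc_def by (auto intro!: bounded_minus_comp)

lemma Linf_loc_cmult:
  fixes g :: "real \<Rightarrow> real"
  assumes "Linf_loc g"
  shows "Linf_loc (\<lambda>t. c * g t)"
proof -
  have "bounded ((\<lambda>t. c * g t) ` {0..T})" for T
    using bounded_scaling[of "g ` {0..T}" c] assms unfolding Linf_loc_def by (simp add: image_image)
  then show ?thesis using assms unfolding Linf_loc_def by auto
qed

lemma Linf_loc_continuous:
  fixes g :: "real \<Rightarrow> real"
  assumes "continuous_on {0..} g"
  shows "Linf_loc g"
  unfolding Linf_loc_def
proof (intro conjI allI)
  show "g \<in> borel_measurable (lebesgue_on {0..})"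
    using assms by (rule continuous_imp_measurable_on_sets_lebesgue) auto
  fix T :: real
  have "continuous_on {0..T} g" using assms by (rule continuous_on_subset) auto
  then show "bounded (g ` {0..T})" by (intro compact_imp_bounded compact_continuous_image) auto
qed

lemma Linf_loc_integrable:
  fixes h :: "real \<Rightarrow> real"
  assumes "Linf_loc h" "0 \<le> a"
  shows "h integrable_on {a..b}"
  using assms measurable_bounded_integrable[of h b a b] unfolding Linf_loc_def by auto

lemma sampling_sequence_mono:
  assumes "sampling_sequence \<delta> \<tau>" "j \<le> k"
  shows "\<tau> j \<le> \<tau> k"
proof -
  have "\<tau> k \<le> \<tau> (Suc k)" for k using assms(1) unfolding sampling_sequence_def by (auto simp: less_imp_le)
  then show ?thesis using assms(2) by (rule lift_Suc_mono_le)
qed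

text \<open>
  For \<open>t \<ge> 0\<close> this is the index of the last sampling time that is not after \<open>t\<close>. The form as a
  least element makes its monotonicity, and with it measurability, immediate.
\<close>

definition sample_index :: "(nat \<Rightarrow> real) \<Rightarrow> real \<Rightarrow> nat" where
  "sample_index \<tau> t = (LEAST k. t < \<tau> (Suc k))"

lemma sample_index_less:
  assumes "sampling_sequence \<delta> \<tau>"
  shows "t < \<tau> (Suc (sample_index \<tau> t))"
proof -
  have "filterlim \<tau> at_top sequentially" using assms unfolding sampling_sequence_def by simp
  then have "\<forall>\<^sub>F k in sequentially. t < \<tau> k" by (rule filterlim_at_top_dense[THEN iffD1, rule_format])
  then obtain k where "\<forall>j\<ge>k. t < \<tau> j" unfolding eventually_sequentially by blast
  then have "t < \<tau> (Suc k)" by auto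
  then show ?thesis unfolding sample_index_def by (rule LeastI)
qed

lemma sample_index_le:
  assumes "sampling_sequence \<delta> \<tau>" "t \<ge> 0"
  shows "\<tau> (sample_index \<tau> t) \<le> t"
proof (cases "sample_index \<tau> t")
  case 0
  then show ?thesis using assms unfolding sampling_sequence_def by simp
next
  case (Suc k)
  then have "\<not> t < \<tau> (Suc k)" unfolding sample_index_def by (intro not_less_Least) simp
  then show ?thesis using Suc by simp
qed

lemma sample_index_eq:
  assumes "sampling_sequence \<delta> \<tau>" "\<tau> k \<le> t" "t < \<tau> (Suc k)"
  shows "sample_index \<tau> t = k"
  unfolding sample_index_def
proof (rule Least_equality)
  show "t < \<tau> (Suc k)" by (rule assms(3))
next
  fix j assume "t < \<tau> (Suc j)"
  show "k \<le> j"
  proof (rule ccontr)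
    assume "\<not> k \<le> j"
    then have "\<tau> (Suc j) \<le> \<tau> k" by (intro sampling_sequence_mono[OF assms(1)]) simp
    then show False using \<open>t < \<tau> (Suc j)\<close> assms(2) by simp
  qed
qed

lemma sampling_nonneg: "sampling_sequence \<delta> \<tau> \<Longrightarrow> 0 \<le> \<tau> k"
  using sampling_sequence_mono[of \<delta> \<tau> 0 k] unfolding sampling_sequence_def by simp

lemma Linf_loc_sampled:
  fixes g :: "real \<Rightarrow> real"
  assumes \<tau>: "sampling_sequence \<delta> \<tau>" and "\<And>T. bounded (g ` {0..T})"
  shows "Linf_loc (\<lambda>t. g (\<tau> (sample_index \<tau> t)))"
  unfolding Linf_loc_def
proof (intro conjI allI)
  have "mono (\<lambda>t. real (sample_index \<tau> t))"
  proof (rule monoI)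
    fix s t :: real assume "s \<le> t"
    then have "s < \<tau> (Suc (sample_index \<tau> t))" using sample_index_less[OF \<tau>, of t] by simp
    then have "sample_index \<tau> s \<le> sample_index \<tau> t" unfolding sample_index_def[of \<tau> s] by (rule Least_le)
    then show "real (sample_index \<tau> s) \<le> real (sample_index \<tau> t)" by simp
  qed
  then have "(\<lambda>t. real (sample_index \<tau> t)) \<in> borel_measurable borel" by (rule borel_measurable_mono)
  moreover have "(\<lambda>s::real. g (\<tau> (nat \<lfloor>s\<rfloor>))) \<in> borel_measurable borel" by measurable
  ultimately have "(\<lambda>t. g (\<tau> (nat \<lfloor>real (sample_index \<tau> t)\<rfloor>))) \<in> borel_measurable borel"
    by (rule measurable_compose)
  then have "(\<lambda>t. g (\<tau> (sample_index \<tau> t))) \<in> borel_measurable borel" by simp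
  then show "(\<lambda>t. g (\<tau> (sample_index \<tau> t))) \<in> borel_measurable (lebesgue_on {0..})"
    by (intro measurable_restrict_space1 measurable_completion) simp
next
  fix T :: real
  have "(\<lambda>t. g (\<tau> (sample_index \<tau> t))) ` {0..T} \<subseteq> g ` {0..T}"
    using sample_index_le[OF \<tau>] sampling_nonneg[OF \<tau>] by (force intro!: imageI)
  then show "bounded ((\<lambda>t. g (\<tau> (sample_index \<tau> t))) ` {0..T})" using assms(2) by (rule bounded_subset[rotated])
qed

lemma output_sum: "n \<ge> 1 \<Longrightarrow> (\<Sum>j=1..n. c_vec j * v j) = v 1"
  unfolding c_vec_def by (simp add: if_distrib[of "\<lambda>a. a * _"] cong: if_cong)

text \<open>
  The states with index \<open>1, \<dots>, n\<close> form \<open>x\<close>, those with index \<open>n + 1, \<dots>, 2 n\<close> form \<open>z\<close>, and the state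
  with index \<open>0\<close> is the integral of the right-hand side of the predictor, which is continuous across
  sampling times. The value of \<open>w\<close> at time \<open>t\<close> depends on three values of the state on \<open>[0,t]\<close> and on
  \<open>\<xi>\<close>, which makes the combined equation causal and Lipschitz in spite of the resets.
\<close>

lemma system_solution_exists:
  fixes f :: "nat \<Rightarrow> (nat \<Rightarrow> real \<Rightarrow> real) \<Rightarrow> 'u::euclidean_space \<Rightarrow> real"
  assumes "r > 0" "n \<ge> 2"
    and lip: "\<And>i. i \<in> {1..n} \<Longrightarrow> globally_lipschitz r i (f i)"
    and L: "L \<ge> 0" "\<forall>i\<in>{1..n}. \<forall>\<phi>\<in>C0 r i. \<forall>\<psi>\<in>C0 r i. \<forall>u.
           \<bar>f i \<phi> u - f i \<psi> u\<bar> \<le> L * (\<Sum>j=1..i. scalar_hist_norm r (\<phi> j - \<psi> j))"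
    and \<tau>: "sampling_sequence \<delta> \<tau>"
    and x0: "x0 \<in> C0 r n" and z0: "z0 \<in> C0 r n"
    and u: "Linf_loc u" and d: "\<forall>i\<in>{1..n}. Linf_loc (d i)" and \<xi>: "Linf_loc \<xi>"
  shows "\<exists>x z w. system_solution r n f K \<theta> \<tau> u d \<xi> x0 z0 x z w"
proof -
  define w where "w X t = X 1 (\<tau> (sample_index \<tau> t)) + \<xi> (\<tau> (sample_index \<tau> t))
      + (X 0 t - X 0 (\<tau> (sample_index \<tau> t)))" for X :: "nat \<Rightarrow> real \<Rightarrow> real" and t
  define Gx where "Gx X i t = f i (hist r i X t) (u t) + (if i < n then X (i + 1) t else 0) + d i t"
    for X :: "nat \<Rightarrow> real \<Rightarrow> real" and i t
  define Gz where "Gz X i t = f i (hist r i (\<lambda>j. X (n + j)) t) (u t) + (if i < n then X (n + (i + 1)) t else 0)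
      + \<theta> ^ i * K i * (X (n + 1) t - w X t)" for X :: "nat \<Rightarrow> real \<Rightarrow> real" and i t
  define Gw where "Gw X t = f 1 (hist r 1 (\<lambda>j. X (n + j)) t) (u t) + X (n + 2) t"
    for X :: "nat \<Rightarrow> real \<Rightarrow> real" and t
  define G where "G X i = (if i = 0 then Gw X else if i \<le> n then Gx X i else Gz X (i - n))" for X i
  define \<phi> where "\<phi> i = (if i = 0 then (\<lambda>_. 0) else if i \<le> n then x0 i else z0 (i - n))" for i
  define I where "I = {0..2 * n}"
  define \<kappa> where "\<kappa> = (\<Sum>i=1..n. \<bar>\<theta> ^ i * K i\<bar>)"
  have "\<kappa> \<ge> 0" unfolding \<kappa>_def by (intro sum_nonneg) auto
  have cases_I: "i = 0 \<or> i \<in> {1..n} \<or> (\<exists>k\<in>{1..n}. i = n + k)" if "i \<in> I" for i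
  proof -
    have "i = 0 \<or> i \<in> {1..n} \<or> (i - n \<in> {1..n} \<and> i = n + (i - n))" using that unfolding I_def by auto
    then show ?thesis by blast
  qed
  have in_I: "0 \<in> I" "j \<in> {1..n} \<Longrightarrow> j \<in> I" "j \<in> {1..n} \<Longrightarrow> n + j \<in> I" for j unfolding I_def by auto
  have G_simps: "G X 0 = Gw X" "k \<in> {1..n} \<Longrightarrow> G X k = Gx X k" "k \<in> {1..n} \<Longrightarrow> G X (n + k) = Gz X k" for X k
    unfolding G_def by auto
  have \<phi>_simps: "\<phi> 0 = (\<lambda>_. 0)" "k \<in> {1..n} \<Longrightarrow> \<phi> k = x0 k" "k \<in> {1..n} \<Longrightarrow> \<phi> (n + k) = z0 k" for k
    unfolding \<phi>_def by auto
  have LG: "Linf_loc (G X i)" if X: "\<And>j. j \<in> I \<Longrightarrow> continuous_on {-r..} (X j)" and i: "i \<in> I" for X i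
  proof -
    have cX: "Linf_loc (X j)" if "j \<in> I" for j
      by (intro Linf_loc_continuous continuous_on_subset[OF X[OF that]]) (use \<open>r > 0\<close> in auto)
    have F0: "Linf_loc (\<lambda>t. f k (hist r k x t) (u t))"
      if "k \<in> {1..n}" "\<And>j. j \<in> {1..k} \<Longrightarrow> continuous_on {-r..} (x j)" for x k
      using functional_measurable[OF lip[OF that(1)], of x u] functional_bounded[OF lip[OF that(1)], of x u] u \<open>r > 0\<close> that
      unfolding Linf_loc_def by auto
    have F: "Linf_loc (\<lambda>t. f k (hist r k X t) (u t))" "Linf_loc (\<lambda>t. f k (hist r k (\<lambda>j. X (n + j)) t) (u t))"
      if "k \<in> {1..n}" for k
      using that by (intro F0 X in_I; simp)+
    have samp: "Linf_loc (\<lambda>t. X j (\<tau> (sample_index \<tau> t)))" if "j \<in> I" for j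
      using cX[OF that] by (intro Linf_loc_sampled[OF \<tau>]) (auto simp: Linf_loc_def)
    have samp\<xi>: "Linf_loc (\<lambda>t. \<xi> (\<tau> (sample_index \<tau> t)))"
      using \<xi> by (intro Linf_loc_sampled[OF \<tau>]) (auto simp: Linf_loc_def)
    have z: "Linf_loc (\<lambda>t. 0::real)" by (intro Linf_loc_continuous continuous_intros)
    have W: "Linf_loc (w X)" unfolding w_def
      using \<open>n \<ge> 2\<close> by (intro Linf_loc_add Linf_loc_diff samp samp\<xi> cX) (auto simp: I_def)
    consider "i = 0" | "i \<in> {1..n}" | k where "k \<in> {1..n}" "i = n + k" using cases_I[OF i] by blast
    then show ?thesis
    proof cases
      case 1
      have "Linf_loc (Gw X)" unfolding Gw_def
        using \<open>n \<ge> 2\<close> by (intro Linf_loc_add F cX) (auto simp: I_def)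
      then show ?thesis using 1 G_simps by simp
    next
      case 2
      have "Linf_loc (\<lambda>t. if i < n then X (i + 1) t else 0)"
        using cX[of "i + 1"] z by (cases "i < n") (auto simp: I_def)
      then have "Linf_loc (Gx X i)" unfolding Gx_def
        using 2 d by (intro Linf_loc_add F) auto
      then show ?thesis using 2 G_simps by simp
    next
      case 3
      have "Linf_loc (\<lambda>t. if k < n then X (n + (k + 1)) t else 0)"
        using cX[of "n + (k + 1)"] z by (cases "k < n") (auto simp: I_def)
      then have "Linf_loc (Gz X k)" unfolding Gz_def
        using 3 \<open>n \<ge> 2\<close> by (intro Linf_loc_add Linf_loc_cmult Linf_loc_diff F W cX) (auto simp: I_def)
      then show ?thesis using 3 G_simps by simp
    qed
  qed
  have lipG: "\<bar>G X i t - G Y i t\<bar> \<le> (L * n + 1 + \<kappa> * 4) * D"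
    if X: "\<And>j. j \<in> I \<Longrightarrow> continuous_on {-r..} (X j)" and Y: "\<And>j. j \<in> I \<Longrightarrow> continuous_on {-r..} (Y j)"
      and D: "\<And>j q. j \<in> I \<Longrightarrow> q \<in> {-r..t} \<Longrightarrow> \<bar>X j q - Y j q\<bar> \<le> D"
      and i: "i \<in> I" and t: "t \<ge> 0" for X Y i t D
  proof -
    have "D \<ge> 0" using D[OF in_I(1), of t] t \<open>r > 0\<close> by auto
    have F: "\<bar>f k (hist r k X t) (u t) - f k (hist r k Y t) (u t)\<bar> \<le> L * n * D"
      "\<bar>f k (hist r k (\<lambda>j. X (n + j)) t) (u t) - f k (hist r k (\<lambda>j. Y (n + j)) t) (u t)\<bar> \<le> L * n * D"
      if k: "k \<in> {1..n}" for k
    proof -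
      have Lk: "\<forall>\<phi>\<in>C0 r k. \<forall>\<psi>\<in>C0 r k. \<forall>u.
           \<bar>f k \<phi> u - f k \<psi> u\<bar> \<le> L * (\<Sum>j=1..k. scalar_hist_norm r (\<phi> j - \<psi> j))"
        using L(2) k by blast
      have "L * (\<Sum>j=1..k. D) \<le> L * n * D"
        using k L(1) \<open>D \<ge> 0\<close> by (simp add: mult_left_mono mult_right_mono mult.assoc)
      moreover have "\<bar>f k (hist r k X t) (u t) - f k (hist r k Y t) (u t)\<bar> \<le> L * (\<Sum>j=1..k. D)"
        by (rule functional_diff_le[OF Lk L(1)]) (use k t \<open>r > 0\<close> in \<open>auto intro!: X Y D in_I\<close>)
      moreover have "\<bar>f k (hist r k (\<lambda>j. X (n + j)) t) (u t) - f k (hist r k (\<lambda>j. Y (n + j)) t) (u t)\<bar> \<le> L * (\<Sum>j=1..k. D)"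
        by (rule functional_diff_le[OF Lk L(1)]) (use k t \<open>r > 0\<close> in \<open>auto intro!: X Y D in_I\<close>)
      ultimately show "\<bar>f k (hist r k X t) (u t) - f k (hist r k Y t) (u t)\<bar> \<le> L * n * D"
        "\<bar>f k (hist r k (\<lambda>j. X (n + j)) t) (u t) - f k (hist r k (\<lambda>j. Y (n + j)) t) (u t)\<bar> \<le> L * n * D"
        by linarith+
    qed
    have split: "(L * n + 1 + \<kappa> * 4) * D = L * n * D + D + \<kappa> * (4 * D)" by (simp add: algebra_simps)
    have now: "\<bar>X j t - Y j t\<bar> \<le> D" if "j \<in> I" for j using D[OF that, of t] t \<open>r > 0\<close> by auto
    have past: "\<bar>X j (\<tau> (sample_index \<tau> t)) - Y j (\<tau> (sample_index \<tau> t))\<bar> \<le> D" if "j \<in> I" for j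
      using sampling_nonneg[OF \<tau>, of "sample_index \<tau> t"] sample_index_le[OF \<tau> t] \<open>r > 0\<close> by (intro D that) auto
    have \<kappa>D: "0 \<le> \<kappa> * (4 * D)" using \<open>\<kappa> \<ge> 0\<close> \<open>D \<ge> 0\<close> by simp
    consider "i = 0" | "i \<in> {1..n}" | k where "k \<in> {1..n}" "i = n + k" using cases_I[OF i] by blast
    then show ?thesis
    proof cases
      case 1
      have "\<bar>Gw X t - Gw Y t\<bar> \<le> L * n * D + D"
        unfolding Gw_def using F(2)[of 1] now[of "n + 2"] \<open>n \<ge> 2\<close> by (auto simp: I_def)
      then show ?thesis using split \<kappa>D unfolding 1 G_simps(1) by linarith
    next
      case 2
      have "\<bar>(if i < n then X (i + 1) t else 0) - (if i < n then Y (i + 1) t else 0)\<bar> \<le> D"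
        using now[of "i + 1"] \<open>D \<ge> 0\<close> by (auto simp: I_def)
      then have "\<bar>Gx X i t - Gx Y i t\<bar> \<le> L * n * D + D"
        unfolding Gx_def using F(1)[OF 2] by linarith
      then show ?thesis using split \<kappa>D unfolding G_simps(2)[OF 2] by linarith
    next
      case 3
      have a: "\<bar>(if k < n then X (n + (k + 1)) t else 0) - (if k < n then Y (n + (k + 1)) t else 0)\<bar> \<le> D"
        using now[of "n + (k + 1)"] \<open>D \<ge> 0\<close> by (auto simp: I_def)
      have "1 \<in> I" "n + 1 \<in> I" using \<open>n \<ge> 2\<close> unfolding I_def by auto
      then have "\<bar>(X (n + 1) t - w X t) - (Y (n + 1) t - w Y t)\<bar> \<le> 4 * D"
        unfolding w_def using now[of "n + 1"] now[OF in_I(1)] past[of 1] past[OF in_I(1)] by linarith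
      then have "\<bar>\<theta> ^ k * K k\<bar> * \<bar>(X (n + 1) t - w X t) - (Y (n + 1) t - w Y t)\<bar> \<le> \<kappa> * (4 * D)"
        unfolding \<kappa>_def using 3(1) \<open>D \<ge> 0\<close>
        by (intro mult_mono member_le_sum[of k "{1..n}" "\<lambda>i. \<bar>\<theta> ^ i * K i\<bar>"]) (auto intro: sum_nonneg)
      then have "\<bar>\<theta> ^ k * K k * (X (n + 1) t - w X t) - \<theta> ^ k * K k * (Y (n + 1) t - w Y t)\<bar> \<le> \<kappa> * (4 * D)"
        by (simp add: abs_mult[symmetric] right_diff_distrib)
      then have "\<bar>Gz X k t - Gz Y k t\<bar> \<le> L * n * D + D + \<kappa> * (4 * D)"
        unfolding Gz_def using F(2)[OF 3(1)] a by linarith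
      then show ?thesis using split unfolding 3(2) G_simps(3)[OF 3(1)] by linarith
    qed
  qed
  have \<phi>c: "continuous_on {-r..0} (\<phi> i)" if "i \<in> I" for i
    using cases_I[OF that] x0 z0 unfolding C0_def by (auto simp: \<phi>_simps intro!: continuous_intros)
  obtain X where cont: "\<And>i. i \<in> I \<Longrightarrow> continuous_on {-r..} (X i)"
    and init: "\<And>i q. i \<in> I \<Longrightarrow> q \<in> {-r..0} \<Longrightarrow> X i q = \<phi> i q"
    and eq: "\<And>i t. i \<in> I \<Longrightarrow> t \<ge> 0 \<Longrightarrow> X i t = \<phi> i 0 + integral {0..t} (G X i)"
  proof (rule volterra_existence[of I r "L * n + 1 + \<kappa> * 4" G \<phi>])
    show "finite I" unfolding I_def by simp
    show "0 \<le> L * n + 1 + \<kappa> * 4" using L(1) \<open>\<kappa> \<ge> 0\<close> by simp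
  qed (use \<open>r > 0\<close> lipG LG \<phi>c in \<open>auto intro: Linf_loc_integrable\<close>)
  have ac: "abs_cont_on 0 T (X i)" if "i \<in> I" for i T
  proof -
    have Li: "Linf_loc (G X i)" by (rule LG[OF cont that])
    then obtain C where C: "\<And>t. t \<in> {0..T} \<Longrightarrow> \<bar>G X i t\<bar> \<le> C"
      unfolding Linf_loc_def bounded_iff by (metis imageI real_norm_def)
    show ?thesis
    proof (rule abs_cont_on_lipschitz)
      fix s t assume st: "s \<in> {0..T}" "t \<in> {0..T}"
      have "\<bar>integral {0..t} (G X i) - integral {0..s} (G X i)\<bar> \<le> C * \<bar>t - s\<bar>"
        by (rule integral_lipschitz[OF Linf_loc_integrable[OF Li] C st]) auto
      then show "\<bar>X i t - X i s\<bar> \<le> C * \<bar>t - s\<bar>" using eq[OF that] st by simp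
    qed
  qed
  have "\<exists>N. negligible N \<and> (\<forall>t>0. t \<notin> N \<longrightarrow> (X i has_real_derivative G X i t) (at t))" if "i \<in> I" for i
  proof -
    have "Linf_loc (G X i)" by (rule LG[OF cont that])
    then have Gint: "G X i integrable_on {0..T}" for T by (rule Linf_loc_integrable) simp
    obtain N where N: "negligible N"
      "\<And>t. t > 0 \<Longrightarrow> t \<notin> N \<Longrightarrow> ((\<lambda>t. integral {0..t} (G X i)) has_real_derivative G X i t) (at t)"
      by (rule integral_has_real_derivative_ae[OF Gint], rule that)
    have "(X i has_real_derivative G X i t) (at t)" if t: "t > 0" "t \<notin> N" for t
    proof (rule has_field_derivative_transform_within_open[OF _ open_greaterThan[of 0]])
      show "((\<lambda>t. \<phi> i 0 + integral {0..t} (G X i)) has_real_derivative G X i t) (at t)"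
        using DERIV_add[OF DERIV_const N(2)[OF t]] by simp
    qed (use t eq \<open>i \<in> I\<close> in auto)
    then show ?thesis using N(1) by blast
  qed
  then obtain N where N: "\<And>i. i \<in> I \<Longrightarrow> negligible (N i)"
    "\<And>i t. i \<in> I \<Longrightarrow> t > 0 \<Longrightarrow> t \<notin> N i \<Longrightarrow> (X i has_real_derivative G X i t) (at t)" by metis
  define NN where "NN = {0} \<union> (\<Union>i\<in>I. N i)"
  have NN: "negligible NN" unfolding NN_def I_def using N(1) by (auto intro!: negligible_Un negligible_Union simp: I_def)
  have der: "(X i has_real_derivative G X i t) (at t)" if "i \<in> I" "t \<in> {0..}" "t \<notin> NN" for i t
    using that by (intro N(2)) (auto simp: NN_def)
  have hist0: "hist r n y 0 = y0" if y0: "y0 \<in> C0 r n" and y: "\<And>j q. j \<in> {1..n} \<Longrightarrow> q \<in> {-r..0} \<Longrightarrow> y j q = y0 j q" for y y0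
  proof (rule ext)
    fix j
    show "hist r n y 0 j = y0 j"
    proof (cases "j \<in> {1..n}")
      case True
      have "(\<lambda>\<theta>\<in>{-r..0}. y j (0 + \<theta>)) = y0 j"
        by (rule extensionalityI[of _ "{-r..0}"]) (use True y0 y in \<open>auto simp: C0_def\<close>)
      then show ?thesis using True unfolding hist_def by simp
    next
      case False
      then have "y0 j = undefined" using y0 unfolding C0_def by (meson PiE_arb)
      then show ?thesis using False unfolding hist_def by (simp only: restrict_apply if_False)
    qed
  qed
  have plant: "plant_solution r n f u d x0 X"
    unfolding plant_solution_def admissible_def
  proof (intro conjI ballI allI impI)
    show "hist r n X 0 = x0" using init in_I \<phi>_simps by (intro hist0 x0) auto
    show "AE t in lebesgue_on {0..}. \<forall>i\<in>{1..n}. (X i has_real_derivative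
           f i (hist r i X t) (u t) + (if i < n then X (i + 1) t else 0) + d i t) (at t)"
    proof (rule negligible_imp_ae[OF NN])
      fix t :: real assume t: "t \<in> {0..}" "t \<notin> NN"
      show "\<forall>i\<in>{1..n}. (X i has_real_derivative
           f i (hist r i X t) (u t) + (if i < n then X (i + 1) t else 0) + d i t) (at t)"
      proof
        fix i assume i: "i \<in> {1..n}"
        have "(X i has_real_derivative G X i t) (at t)" by (rule der[OF in_I(2)[OF i] t])
        then show "(X i has_real_derivative
           f i (hist r i X t) (u t) + (if i < n then X (i + 1) t else 0) + d i t) (at t)"
          unfolding G_simps(2)[OF i] Gx_def .
      qed
    qed simp
  qed (auto intro!: cont ac in_I)
  have observer: "observer_solution r n f K \<theta> u (w X) z0 (\<lambda>j. X (n + j))"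
    unfolding observer_solution_def admissible_def
  proof (intro conjI ballI allI impI)
    show "hist r n (\<lambda>j. X (n + j)) 0 = z0" using init in_I \<phi>_simps by (intro hist0 z0) auto
    show "AE t in lebesgue_on {0..}. \<forall>i\<in>{1..n}. (X (n + i) has_real_derivative
           f i (hist r i (\<lambda>j. X (n + j)) t) (u t) + (if i < n then X (n + (i + 1)) t else 0)
           + \<theta> ^ i * K i * ((\<Sum>j=1..n. c_vec j * X (n + j) t) - w X t)) (at t)"
    proof (rule negligible_imp_ae[OF NN])
      fix t :: real assume t: "t \<in> {0..}" "t \<notin> NN"
      have o: "(\<Sum>j=1..n. c_vec j * X (n + j) t) = X (n + 1) t"
        using output_sum[of n "\<lambda>j. X (n + j) t"] \<open>n \<ge> 2\<close> by simp
      show "\<forall>i\<in>{1..n}. (X (n + i) has_real_derivative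
           f i (hist r i (\<lambda>j. X (n + j)) t) (u t) + (if i < n then X (n + (i + 1)) t else 0)
           + \<theta> ^ i * K i * ((\<Sum>j=1..n. c_vec j * X (n + j) t) - w X t)) (at t)"
        unfolding o
      proof
        fix i assume i: "i \<in> {1..n}"
        have "(X (n + i) has_real_derivative G X (n + i) t) (at t)" by (rule der[OF in_I(3)[OF i] t])
        then show "(X (n + i) has_real_derivative
           f i (hist r i (\<lambda>j. X (n + j)) t) (u t) + (if i < n then X (n + (i + 1)) t else 0)
           + \<theta> ^ i * K i * (X (n + 1) t - w X t)) (at t)"
          unfolding G_simps(3)[OF i] Gz_def .
      qed
    qed simp
  qed (auto intro!: cont ac in_I)
  have weq: "w X t = X 1 (\<tau> k) + \<xi> (\<tau> k) - X 0 (\<tau> k) + X 0 t" if "t \<in> {\<tau> k..<\<tau> (Suc k)}" for k t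
    using sample_index_eq[OF \<tau>, of k t] that unfolding w_def by simp
  have predictor: "predictor_solution r f \<tau> u \<xi> X (\<lambda>j. X (n + j)) (w X)"
    unfolding predictor_solution_def
  proof (intro allI conjI ballI)
    fix k
    have step: "\<tau> k < \<tau> (Suc k)" using \<tau> unfolding sampling_sequence_def by (metis diff_gt_0_iff_gt)
    then show "w X (\<tau> k) = X 1 (\<tau> k) + \<xi> (\<tau> k)" using weq[of "\<tau> k" k] by simp
    show "abs_cont_on (\<tau> k) b (w X)" if b: "b \<in> {\<tau> k..<\<tau> (Suc k)}" for b
    proof -
      have "abs_cont_on (\<tau> k) b (X 0)"
        by (rule abs_cont_on_subset[OF ac[OF in_I(1)] sampling_nonneg[OF \<tau>]]) (rule order_refl)
      from this this zero_le_one show ?thesis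
      proof (rule abs_cont_on_dominated)
        fix s t assume "\<tau> k \<le> s" "s \<le> t" "t \<le> b"
        then show "\<bar>w X t - w X s\<bar> \<le> 1 * (\<bar>X 0 t - X 0 s\<bar> + \<bar>X 0 t - X 0 s\<bar>)"
          using b weq[of s k] weq[of t k] by simp
      qed
    qed
    have "negligible (insert (\<tau> k) NN)" using NN by simp
    then show "AE t in lebesgue_on {\<tau> k..<\<tau> (Suc k)}.
         (w X has_real_derivative f 1 (hist r 1 (\<lambda>j. X (n + j)) t) (u t) + X (n + 2) t) (at t)"
    proof (rule negligible_imp_ae)
      fix t assume t: "t \<in> {\<tau> k..<\<tau> (Suc k)}" "t \<notin> insert (\<tau> k) NN"
      then have "t \<ge> 0" using sampling_nonneg[OF \<tau>, of k] by auto
      show "(w X has_real_derivative f 1 (hist r 1 (\<lambda>j. X (n + j)) t) (u t) + X (n + 2) t) (at t)"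
      proof (rule has_field_derivative_transform_within_open[of "\<lambda>t. X 1 (\<tau> k) + \<xi> (\<tau> k) - X 0 (\<tau> k) + X 0 t" _ t "{\<tau> k<..<\<tau> (Suc k)}"])
        have "(X 0 has_real_derivative G X 0 t) (at t)" using t \<open>t \<ge> 0\<close> by (intro der in_I) auto
        then show "((\<lambda>t. X 1 (\<tau> k) + \<xi> (\<tau> k) - X 0 (\<tau> k) + X 0 t) has_real_derivative
             f 1 (hist r 1 (\<lambda>j. X (n + j)) t) (u t) + X (n + 2) t) (at t)"
          using G_simps(1) unfolding Gw_def by (auto intro!: derivative_eq_intros)
      qed (use t weq[of _ k] in auto)
    qed simp
  qed
  show ?thesis using plant observer predictor unfolding system_solution_def by blast
qed

section \<open>Coordinates for Hurwitz matrices\<close>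

lemma mat_mult_entry:
  assumes "X \<in> carrier_mat n n" "Y \<in> carrier_mat n n" "i < n" "k < n"
  shows "(X * Y) $$ (i, k) = (\<Sum>j<n. X $$ (i, j) * Y $$ (j, k))"
  using assms by (auto simp: scalar_prod_def lessThan_atLeast0 intro!: sum.cong)

text \<open>
  Schur's triangular form \<open>B\<close> of \<open>M\<close> carries the eigenvalues on its diagonal. Rescaling the \<open>i\<close>-th
  coordinate by \<open>N\<^sup>i\<close> divides every entry above the diagonal by \<open>N\<close> at least, without changing
  the diagonal. The rows of \<open>P\<close> are the rescaled coordinates, \<open>T\<close> is the strictly upper triangular
  part, and \<open>R\<close> recovers the original vector.
\<close>

lemma hurwitz_triangular_coordinates:
  fixes M :: "real mat"
  assumes "hurwitz M" and M: "M \<in> carrier_mat n n"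
  obtains \<sigma> :: real and l :: "nat \<Rightarrow> complex" and P R T :: "nat \<Rightarrow> nat \<Rightarrow> complex" where
    "\<sigma> > 0" "\<And>i. i \<in> {1..n} \<Longrightarrow> Re (l i) \<le> - \<sigma>"
    "\<And>i k. i \<in> {1..n} \<Longrightarrow> k \<in> {1..n} \<Longrightarrow>
       (\<Sum>j=1..n. P i j * complex_of_real (M $$ (j - 1, k - 1))) = l i * P i k + (\<Sum>m=1..n. T i m * P m k)"
    "\<And>i. i \<in> {1..n} \<Longrightarrow> (\<Sum>m=1..n. cmod (T i m)) \<le> \<sigma> / 4"
    "\<And>i k. i \<in> {1..n} \<Longrightarrow> k \<in> {1..n} \<Longrightarrow> (\<Sum>j=1..n. R i j * P j k) = (if i = k then 1 else 0)"
proof -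
  define A where "A = map_mat complex_of_real M"
  have A: "A \<in> carrier_mat n n" using M unfolding A_def by auto
  obtain es where es: "char_poly A = (\<Prod>a\<leftarrow>es. [:- a, 1:])" using char_poly_factorized[OF A] by blast
  obtain B S Q where dec: "schur_decomposition A es = (B, S, Q)" by (cases "schur_decomposition A es") auto
  have sim: "similar_mat_wit A B S Q" and up: "upper_triangular B" and diag: "diag_mat B = es"
    using schur_decomposition[OF A es dec] by auto
  note w = similar_mat_witD2[OF A sim]
  have B: "B \<in> carrier_mat n n" and S: "S \<in> carrier_mat n n" and Q: "Q \<in> carrier_mat n n" using w by auto
  have "Q * A = Q * (S * B * Q)" using w(3) by simp
  also have "\<dots> = (Q * S) * (B * Q)" using B S Q by (simp add: assoc_mult_mat[of _ n n _ n _ n])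
  also have "\<dots> = B * Q" using w(2) B Q by (simp add: left_mult_one_mat[of _ n n])
  finally have QA: "Q * A = B * Q" .
  have re: "Re (B $$ (i, i)) < 0" if "i < n" for i
  proof -
    have "B $$ (i, i) \<in> set es" unfolding diag[symmetric] diag_mat_def using that B by auto
    then have "poly (char_poly A) (B $$ (i, i)) = 0" unfolding es by (auto simp: poly_prod_list prod_list_zero_iff)
    then have "eigenvalue A (B $$ (i, i))" using eigenvalue_root_char_poly[OF A] by simp
    then show ?thesis using assms(1) unfolding hurwitz_def A_def by blast
  qed
  define \<sigma> where "\<sigma> = Min (insert 1 ((\<lambda>i. - Re (B $$ (i, i))) ` {..<n}))"
  have \<sigma>: "\<sigma> > 0" unfolding \<sigma>_def using re by (subst Min_gr_iff) auto
  have \<sigma>le: "Re (B $$ (i, i)) \<le> - \<sigma>" if "i < n" for i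
  proof -
    have "\<sigma> \<le> - Re (B $$ (i, i))" unfolding \<sigma>_def using that by (intro Min_le) auto
    then show ?thesis by simp
  qed
  define b where "b = (\<Sum>i<n. \<Sum>m<n. cmod (B $$ (i, m)))"
  have b0: "b \<ge> 0" unfolding b_def by (intro sum_nonneg) auto
  \<comment> \<open>\<open>N\<close> is chosen to satisfy \<open>b / N \<le> \<sigma> / 4\<close>.\<close>
  define N where "N = 1 + 4 * b / \<sigma>"
  have N: "N \<ge> 1" "b / N \<le> \<sigma> / 4"
  proof -
    show "N \<ge> 1" unfolding N_def using b0 \<sigma> by simp
    have "4 * b \<le> \<sigma> * N" unfolding N_def using \<sigma> by (simp add: field_simps)
    then show "b / N \<le> \<sigma> / 4" using \<open>N \<ge> 1\<close> by (simp add: field_simps)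
  qed
  define Nc where "Nc = complex_of_real N"
  have Nc: "Nc \<noteq> 0" "cmod Nc = N" using N unfolding Nc_def by auto
  define P where "P i j = Nc ^ (i - 1) * Q $$ (i - 1, j - 1)" for i j
  define R where "R i j = S $$ (i - 1, j - 1) / Nc ^ (j - 1)" for i j
  define l where "l i = B $$ (i - 1, i - 1)" for i
  define T where "T i m = (if m > i then B $$ (i - 1, m - 1) * (Nc ^ (i - 1) / Nc ^ (m - 1)) else 0)" for i m
  note shift = sum.atLeast1_atMost_eq One_nat_def
  show ?thesis
  proof (rule that[OF \<sigma>, of l P T R])
    fix i assume i: "i \<in> {1..n}"
    then have i1: "i - 1 < n" by auto
    show "Re (l i) \<le> - \<sigma>" unfolding l_def by (rule \<sigma>le[OF i1])
    have "cmod (T i (Suc m)) \<le> cmod (B $$ (i - 1, m)) / N" if "m < n" for m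
    proof (cases "Suc m > i")
      case True
      then have "i - 1 < m" using i by auto
      then obtain d where d: "m = (i - 1) + Suc d" using less_natE by (metis add_Suc_right)
      have "cmod (Nc ^ (i - 1) / Nc ^ m) = 1 / N ^ Suc d"
        unfolding d using N Nc by (simp add: norm_divide norm_mult norm_power power_add)
      also have "\<dots> \<le> 1 / N"
      proof -
        have "N \<le> N ^ Suc d" using N(1) by (intro self_le_power) auto
        then show ?thesis using N(1) by (intro divide_left_mono) auto
      qed
      finally have "cmod (B $$ (i - 1, m)) * cmod (Nc ^ (i - 1) / Nc ^ m) \<le> cmod (B $$ (i - 1, m)) * (1 / N)"
        by (intro mult_left_mono) auto
      then have "cmod (B $$ (i - 1, m) * (Nc ^ (i - 1) / Nc ^ m)) \<le> cmod (B $$ (i - 1, m)) * (1 / N)"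
        by (simp only: norm_mult)
      then show ?thesis using True unfolding T_def by simp
    next
      case False
      then show ?thesis using N unfolding T_def by simp
    qed
    then have "(\<Sum>m=1..n. cmod (T i m)) \<le> (\<Sum>m<n. cmod (B $$ (i - 1, m)) / N)"
      unfolding shift by (intro sum_mono) auto
    also have "\<dots> = (\<Sum>m<n. cmod (B $$ (i - 1, m))) / N" by (simp add: sum_divide_distrib)
    also have "\<dots> \<le> b / N"
      unfolding b_def using N(1) i1
      by (intro divide_right_mono member_le_sum[of "i - 1" "{..<n}" "\<lambda>i. \<Sum>m<n. cmod (B $$ (i, m))"])
         (auto intro: sum_nonneg)
    also have "\<dots> \<le> \<sigma> / 4" by (rule N)
    finally show "(\<Sum>m=1..n. cmod (T i m)) \<le> \<sigma> / 4" .
  next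
    fix i k assume i: "i \<in> {1..n}" and k: "k \<in> {1..n}"
    then have ik: "i - 1 < n" "k - 1 < n" "Suc (i - 1) = i" by auto
    have "(\<Sum>j=1..n. P i j * complex_of_real (M $$ (j - 1, k - 1)))
        = (\<Sum>j<n. Nc ^ (i - 1) * (Q $$ (i - 1, j) * A $$ (j, k - 1)))"
      unfolding shift P_def A_def using ik M by (intro sum.cong) auto
    also have "\<dots> = Nc ^ (i - 1) * (Q * A) $$ (i - 1, k - 1)"
      using mat_mult_entry[OF Q A ik(1,2)] by (simp add: sum_distrib_left)
    also have "\<dots> = (\<Sum>m<n. Nc ^ (i - 1) * (B $$ (i - 1, m) * Q $$ (m, k - 1)))"
      unfolding QA using mat_mult_entry[OF B Q ik(1,2)] by (simp add: sum_distrib_left)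
    also have "\<dots> = (\<Sum>m<n. (if m = i - 1 then l i * P i k else 0) + T i (Suc m) * P (Suc m) k)"
    proof (rule sum.cong[OF refl])
      fix m assume "m \<in> {..<n}"
      then have m: "m < n" by simp
      consider "m < i - 1" | "m = i - 1" | "m > i - 1" by linarith
      then show "Nc ^ (i - 1) * (B $$ (i - 1, m) * Q $$ (m, k - 1))
          = (if m = i - 1 then l i * P i k else 0) + T i (Suc m) * P (Suc m) k"
      proof cases
        case 1
        then have "B $$ (i - 1, m) = 0" using up B ik by (auto intro: upper_triangularD)
        then show ?thesis using 1 unfolding T_def by auto
      next
        case 2
        then show ?thesis using i unfolding T_def l_def P_def by auto
      next
        case 3
        then show ?thesis using i Nc unfolding T_def P_def by (auto simp: field_simps)
      qed
    qed
    also have "\<dots> = l i * P i k + (\<Sum>m=1..n. T i m * P m k)"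
      unfolding shift sum.distrib using ik by (simp add: sum.delta)
    finally show "(\<Sum>j=1..n. P i j * complex_of_real (M $$ (j - 1, k - 1))) = l i * P i k + (\<Sum>m=1..n. T i m * P m k)" .
    have "(\<Sum>j=1..n. R i j * P j k) = (\<Sum>j<n. S $$ (i - 1, j) * Q $$ (j, k - 1))"
      unfolding shift R_def P_def using Nc by (intro sum.cong) auto
    also have "\<dots> = (S * Q) $$ (i - 1, k - 1)" using mat_mult_entry[OF S Q ik(1,2)] by simp
    also have "\<dots> = (if i = k then 1 else 0)" unfolding w(1) using ik i k by auto
    finally show "(\<Sum>j=1..n. R i j * P j k) = (if i = k then 1 else 0)" .
  qed
qed

section \<open>Perturbed exponentially stable systems\<close>

lemma abs_cont_on_C1:
  assumes "\<And>t. t \<in> {p..q} \<Longrightarrow> (g has_real_derivative g' t) (at t)" "continuous_on {p..q} g'"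
  shows "abs_cont_on p q g"
proof -
  have "bounded (g' ` {p..q})" using assms(2) by (intro compact_imp_bounded compact_continuous_image) auto
  then obtain C where C: "\<And>t. t \<in> {p..q} \<Longrightarrow> norm (g' t) \<le> C" unfolding bounded_iff by (meson imageI)
  show ?thesis
  proof (rule abs_cont_on_lipschitz)
    fix s t assume "s \<in> {p..q}" "t \<in> {p..q}"
    then have "norm (g t - g s) \<le> C * norm (t - s)"
      using assms(1) C by (intro field_differentiable_bound[of "{p..q}" g g' C t s]) (auto intro: has_field_derivative_at_within)
    then show "\<bar>g t - g s\<bar> \<le> C * \<bar>t - s\<bar>" by simp
  qed
qed

lemma abs_cont_on_increment_bound:
  assumes ac: "abs_cont_on p q g" and "p \<le> q" "negligible N"
    and deriv: "\<And>t. t \<in> {p<..<q} - N \<Longrightarrow> \<exists>D. \<bar>D\<bar> \<le> C \<and> (g has_real_derivative D) (at t)"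
  shows "\<bar>g q - g p\<bar> \<le> C * (q - p)"
proof -
  have lin: "abs_cont_on p q (\<lambda>t. C * t)" by (rule abs_cont_on_C1[where g' = "\<lambda>_. C"]) (auto intro!: derivative_eq_intros)
  have zero: "abs_cont_on p q (\<lambda>t. 0)" by (rule abs_cont_on_lipschitz[where C = 0]) simp
  have "g q - C * q \<le> g p - C * p"
  proof (rule abs_cont_on_nonincreasing[OF abs_cont_on_diff[OF ac lin] \<open>p \<le> q\<close> \<open>negligible N\<close>])
    fix t assume "t \<in> {p<..<q} - N"
    then obtain D where "\<bar>D\<bar> \<le> C" "(g has_real_derivative D) (at t)" using deriv by blast
    then show "\<exists>D\<le>0. ((\<lambda>t. g t - C * t) has_real_derivative D) (at t)"
      by (intro exI[of _ "D - C"]) (auto intro!: derivative_eq_intros)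
  qed
  moreover have "0 - g q - C * q \<le> 0 - g p - C * p"
  proof (rule abs_cont_on_nonincreasing[OF abs_cont_on_diff[OF abs_cont_on_diff[OF zero ac] lin] \<open>p \<le> q\<close> \<open>negligible N\<close>])
    fix t assume "t \<in> {p<..<q} - N"
    then obtain D where "\<bar>D\<bar> \<le> C" "(g has_real_derivative D) (at t)" using deriv by blast
    then show "\<exists>D\<le>0. ((\<lambda>t. 0 - g t - C * t) has_real_derivative D) (at t)"
      by (intro exI[of _ "- D - C"]) (auto intro!: derivative_eq_intros)
  qed
  ultimately show ?thesis by (simp add: algebra_simps abs_le_iff)
qed

text \<open>
  The function \<open>exp (- \<mu> t) y t\<close> has a derivative of modulus at most \<open>B exp ((a - 1) t)\<close>. Its
  increment \<open>\<Delta>\<close> is estimated through the real part in the direction of \<open>\<Delta>\<close>, after subtraction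
  of the integral of that bound. The complex function \<open>y\<close> is given as a combination of real functions,
  so that absolute continuity of real functions suffices.
\<close>

lemma linear_ode_bound:
  fixes g :: "'i \<Rightarrow> real \<Rightarrow> real" and c :: "'i \<Rightarrow> complex" and \<mu> :: complex and J :: "'i set"
  defines "y \<equiv> \<lambda>t. \<Sum>j\<in>J. c j * complex_of_real (g j t)"
  assumes "finite J" "T \<ge> 0"
    and ac: "\<And>j. j \<in> J \<Longrightarrow> abs_cont_on 0 T (g j)" and cont: "\<And>j. j \<in> J \<Longrightarrow> continuous_on {0..T} (g j)"
    and "negligible N"
    and deriv: "\<And>j t. j \<in> J \<Longrightarrow> t \<in> {0<..<T} - N \<Longrightarrow> (g j has_real_derivative g' j t) (at t)"
    and rest: "\<And>t. t \<in> {0<..<T} - N \<Longrightarrow> cmod ((\<Sum>j\<in>J. c j * complex_of_real (g' j t)) - \<mu> * y t) \<le> B * exp (- t)"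
    and "B \<ge> 0" and a: "Re \<mu> = - a" "a > 1"
  shows "cmod (y T) \<le> exp (- a * T) * cmod (y 0) + B * exp (- T) / (a - 1)"
proof -
  define \<Delta> where "\<Delta> = exp (- \<mu> * of_real T) * y T - y 0"
  \<comment> \<open>The rotation that turns \<open>\<Delta>\<close> into its modulus; \<open>k = 0\<close> if \<open>\<Delta> = 0\<close>.\<close>
  define k where "k = complex_of_real (cmod \<Delta>) / \<Delta>"
  have k: "Re (k * \<Delta>) = cmod \<Delta>" "cmod k \<le> 1"
    unfolding k_def by (cases "\<Delta> = 0"; simp add: norm_divide)+
  define E where "E t = k * exp (- \<mu> * complex_of_real t)" for t
  have E_deriv: "(E has_vector_derivative (- \<mu> * E t)) (at t)" for t
  proof -
    have "((\<lambda>z. k * exp (- \<mu> * z)) has_field_derivative (- \<mu> * E t)) (at (of_real t))"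
      unfolding E_def by (auto intro!: derivative_eq_intros)
    then show ?thesis unfolding E_def using has_vector_derivative_real_field by (simp add: o_def)
  qed
  have contE: "continuous_on S E" for S unfolding E_def by (intro continuous_intros)
  define h where "h t = (\<Sum>j\<in>J. Re (E t * c j) * g j t) - B / (a - 1) * exp ((a - 1) * t)" for t
  have h_eq: "h t = Re (E t * y t) - B / (a - 1) * exp ((a - 1) * t)" for t
    unfolding h_def y_def by (simp add: sum_distrib_left mult.assoc[symmetric])
  have exp_deriv: "((\<lambda>t. B / (a - 1) * exp ((a - 1) * t)) has_real_derivative
      B / (a - 1) * (exp ((a - 1) * t) * (a - 1))) (at t)" for t
    by (auto intro!: derivative_eq_intros)
  have "abs_cont_on 0 T h"
    unfolding h_def
  proof (intro abs_cont_on_diff abs_cont_on_sum \<open>finite J\<close>)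
    fix j assume j: "j \<in> J"
    have "((\<lambda>t. Re (E t * c j)) has_real_derivative Re (- \<mu> * E t * c j)) (at t)" for t
      using has_vector_derivative_mult_left[OF E_deriv, of "c j" t]
      by (metis has_field_derivative_Re)
    then have "abs_cont_on 0 T (\<lambda>t. Re (E t * c j))"
      by (rule abs_cont_on_C1) (intro continuous_intros contE)
    then show "abs_cont_on 0 T (\<lambda>t. Re (E t * c j) * g j t)"
      by (rule abs_cont_on_mult[OF _ ac[OF j] _ cont[OF j]]) (intro continuous_intros contE)
  next
    show "abs_cont_on 0 T (\<lambda>t. B / (a - 1) * exp ((a - 1) * t))"
      by (rule abs_cont_on_C1[OF exp_deriv]) (intro continuous_intros)
  qed
  then have "h T \<le> h 0"
  proof (rule abs_cont_on_nonincreasing[OF _ \<open>T \<ge> 0\<close> \<open>negligible N\<close>])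
    fix t assume t: "t \<in> {0<..<T} - N"
    define y' where "y' = (\<Sum>j\<in>J. c j * complex_of_real (g' j t))"
    have "(y has_vector_derivative y') (at t)"
      unfolding y_def y'_def
      by (intro has_vector_derivative_sum has_vector_derivative_mult_right has_vector_derivative_of_real)
         (use deriv t in \<open>auto simp: has_real_derivative_iff_has_vector_derivative\<close>)
    then have "((\<lambda>t. E t * y t) has_vector_derivative (E t * y' + - \<mu> * E t * y t)) (at t)"
      by (rule has_vector_derivative_mult[OF E_deriv])
    then have "((\<lambda>t. Re (E t * y t)) has_real_derivative Re (E t * y' + - \<mu> * E t * y t)) (at t)"
      by (rule has_field_derivative_Re)
    then have "(h has_real_derivative Re (E t * y' + - \<mu> * E t * y t) - B / (a - 1) * (exp ((a - 1) * t) * (a - 1))) (at t)"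
      unfolding h_eq[abs_def] by (rule DERIV_diff[OF _ exp_deriv])
    moreover have "Re (E t * y' + - \<mu> * E t * y t) \<le> B / (a - 1) * (exp ((a - 1) * t) * (a - 1))"
    proof -
      have "Re (E t * y' + - \<mu> * E t * y t) \<le> cmod (E t * (y' - \<mu> * y t))"
        using complex_Re_le_cmod[of "E t * (y' - \<mu> * y t)"] by (simp add: algebra_simps)
      also have "\<dots> = cmod k * exp (a * t) * cmod (y' - \<mu> * y t)"
        unfolding E_def using a(1) by (simp add: norm_mult)
      also have "\<dots> \<le> 1 * exp (a * t) * (B * exp (- t))"
        using rest[OF t] k(2) unfolding y'_def by (intro mult_mono) auto
      also have "\<dots> = B * exp ((a - 1) * t)" by (simp add: exp_diff left_diff_distrib exp_minus field_simps)
      finally show ?thesis using a(2) by simp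
    qed
    ultimately show "\<exists>D\<le>0. (h has_real_derivative D) (at t)" by (meson diff_le_0_iff_le)
  qed
  moreover have "Re (E T * y T) - Re (E 0 * y 0) = cmod \<Delta>"
  proof -
    have "k * \<Delta> = E T * y T - E 0 * y 0" unfolding \<Delta>_def E_def by (simp add: algebra_simps)
    then show ?thesis using k(1) by (metis minus_complex.sel(1))
  qed
  ultimately have \<Delta>: "cmod \<Delta> \<le> B / (a - 1) * exp ((a - 1) * T) - B / (a - 1)"
    unfolding h_eq by simp
  moreover have "B / (a - 1) \<ge> 0" using a(2) \<open>B \<ge> 0\<close> by simp
  ultimately have \<Delta>: "cmod \<Delta> \<le> B / (a - 1) * exp ((a - 1) * T)" by linarith
  have "y T = exp (\<mu> * of_real T) * (y 0 + \<Delta>)"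
    unfolding \<Delta>_def by (simp add: exp_minus)
  then have "cmod (y T) = exp (- a * T) * cmod (y 0 + \<Delta>)" using a(1) by (simp add: norm_mult)
  also have "\<dots> \<le> exp (- a * T) * (cmod (y 0) + B / (a - 1) * exp ((a - 1) * T))"
    using norm_triangle_ineq[of "y 0" \<Delta>] \<Delta> by (intro mult_left_mono) auto
  also have "\<dots> = exp (- a * T) * cmod (y 0) + B * exp (- T) / (a - 1)"
    by (simp add: distrib_left exp_add[symmetric] algebra_simps)
  finally show ?thesis .
qed



text \<open>
  The number \<open>S\<close> is the weighted peak of \<open>P E\<close>, attained by some component at some time. If that
  time is not positive, then \<open>S\<close> is bounded by the initial data. Otherwise the scalar estimate bounds
  \<open>S\<close> by initial data and forcing plus \<open>S / 2\<close> from the off-diagonal part \<open>T\<close> and \<open>S / 4\<close> from the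
  part of \<open>g\<close> that depends on \<open>E\<close>, and \<open>S\<close> can be absorbed. The perturbation \<open>g\<close> may depend on
  the past of \<open>E\<close>, hence its bound is assumed in terms of \<open>S\<close>.
\<close>

lemma stable_system_peak_bound:
  fixes m :: "nat \<Rightarrow> nat \<Rightarrow> real" and E :: "nat \<Rightarrow> real \<Rightarrow> real"
    and P R T :: "nat \<Rightarrow> nat \<Rightarrow> complex" and l :: "nat \<Rightarrow> complex" and n :: nat
  defines "\<pi> \<equiv> \<Sum>i=1..n. \<Sum>j=1..n. cmod (P i j)" and "\<rho> \<equiv> \<Sum>i=1..n. \<Sum>j=1..n. cmod (R i j)"
  assumes "n \<ge> 1"
    and l: "\<And>i. i \<in> {1..n} \<Longrightarrow> Re (l i) \<le> - \<sigma>"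
    and PM: "\<And>i k. i \<in> {1..n} \<Longrightarrow> k \<in> {1..n} \<Longrightarrow>
       (\<Sum>j=1..n. P i j * complex_of_real (m j k)) = l i * P i k + (\<Sum>j=1..n. T i j * P j k)"
    and T: "\<And>i. i \<in> {1..n} \<Longrightarrow> (\<Sum>j=1..n. cmod (T i j)) \<le> \<sigma> / 4"
    and RP: "\<And>i k. i \<in> {1..n} \<Longrightarrow> k \<in> {1..n} \<Longrightarrow> (\<Sum>j=1..n. R i j * P j k) = (if i = k then 1 else 0)"
    and \<theta>: "\<theta> > 0" "\<theta> * \<sigma> \<ge> 2" and "r \<ge> 0" "t\<^sub>1 \<ge> 0"
    and cont: "\<And>j. j \<in> {1..n} \<Longrightarrow> continuous_on {-r..t\<^sub>1} (E j)"
    and ac: "\<And>j. j \<in> {1..n} \<Longrightarrow> abs_cont_on 0 t\<^sub>1 (E j)"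
    and "negligible N"
    and deriv: "\<And>j t. j \<in> {1..n} \<Longrightarrow> t \<in> {0<..<t\<^sub>1} - N \<Longrightarrow>
       (E j has_real_derivative \<theta> * (\<Sum>k=1..n. m j k * E k t) + g j t) (at t)"
    and init: "\<And>j q. j \<in> {1..n} \<Longrightarrow> q \<in> {-r..0} \<Longrightarrow> \<bar>E j q\<bar> \<le> E\<^sub>0"
    and pert: "\<And>S j t. S \<ge> 0 \<Longrightarrow> (\<And>k q. k \<in> {1..n} \<Longrightarrow> q \<in> {-r..t\<^sub>1} \<Longrightarrow> \<bar>E k q\<bar> \<le> \<rho> * S * exp (- q)) \<Longrightarrow>
       j \<in> {1..n} \<Longrightarrow> t \<in> {0<..<t\<^sub>1} - N \<Longrightarrow> \<bar>g j t\<bar> \<le> (A * S + F) * exp (- t)"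
    and "A \<ge> 0" "F \<ge> 0" and gain: "2 * \<pi> * A \<le> \<theta> * \<sigma> / 4"
  obtains S where "0 \<le> S" "S \<le> 4 * \<pi> * (E\<^sub>0 + F)"
    "\<And>j q. j \<in> {1..n} \<Longrightarrow> q \<in> {-r..t\<^sub>1} \<Longrightarrow> \<bar>E j q\<bar> \<le> \<rho> * S * exp (- q)"
proof -
  define y where "y i t = (\<Sum>j\<in>{1..n}. P i j * complex_of_real (E j t))" for i t
  have \<pi>: "0 \<le> \<pi>" unfolding \<pi>_def by (intro sum_nonneg) auto
  have rowP: "(\<Sum>j=1..n. cmod (P i j)) \<le> \<pi>" if "i \<in> {1..n}" for i
    unfolding \<pi>_def using that
    by (intro member_le_sum[of i "{1..n}" "\<lambda>i. \<Sum>j=1..n. cmod (P i j)"]) (auto intro: sum_nonneg)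
  have rowR: "(\<Sum>j=1..n. cmod (R i j)) \<le> \<rho>" if "i \<in> {1..n}" for i
    unfolding \<rho>_def using that
    by (intro member_le_sum[of i "{1..n}" "\<lambda>i. \<Sum>j=1..n. cmod (R i j)"]) (auto intro: sum_nonneg)
  have P_le: "cmod (\<Sum>j=1..n. P i j * complex_of_real (v j)) \<le> \<pi> * b"
    if i: "i \<in> {1..n}" and v: "\<And>j. j \<in> {1..n} \<Longrightarrow> \<bar>v j\<bar> \<le> b" for i v b
  proof -
    have "b \<ge> 0" using v[of 1] \<open>n \<ge> 1\<close> by auto
    have "cmod (\<Sum>j=1..n. P i j * complex_of_real (v j)) \<le> (\<Sum>j=1..n. cmod (P i j) * b)"
      using v by (intro sum_norm_le) (auto simp: norm_mult intro!: mult_left_mono)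
    also have "\<dots> \<le> \<pi> * b"
      unfolding sum_distrib_right[symmetric] using rowP[OF i] \<open>b \<ge> 0\<close> by (rule mult_right_mono)
    finally show ?thesis .
  qed
  have contY: "continuous_on {-r..t\<^sub>1} (\<lambda>q. exp q * cmod (y i q))" for i
    unfolding y_def by (intro continuous_intros cont) auto
  have "\<exists>q\<in>{-r..t\<^sub>1}. \<forall>p\<in>{-r..t\<^sub>1}. exp p * cmod (y i p) \<le> exp q * cmod (y i q)" for i
    using \<open>r \<ge> 0\<close> \<open>t\<^sub>1 \<ge> 0\<close> by (intro continuous_attains_sup contY) auto
  then obtain qm where qm: "\<And>i. qm i \<in> {-r..t\<^sub>1}"
    "\<And>i p. p \<in> {-r..t\<^sub>1} \<Longrightarrow> exp p * cmod (y i p) \<le> exp (qm i) * cmod (y i (qm i))" by metis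
  define S where "S = Max ((\<lambda>i. exp (qm i) * cmod (y i (qm i))) ` {1..n})"
  have S_ge: "exp q * cmod (y i q) \<le> S" if "i \<in> {1..n}" "q \<in> {-r..t\<^sub>1}" for i q
  proof -
    have "exp (qm i) * cmod (y i (qm i)) \<le> S" unfolding S_def using that by (intro Max_ge) auto
    then show ?thesis using qm(2)[OF that(2), of i] by simp
  qed
  have "S \<in> (\<lambda>i. exp (qm i) * cmod (y i (qm i))) ` {1..n}"
    unfolding S_def using \<open>n \<ge> 1\<close> by (intro Max_in) auto
  then obtain i where i: "i \<in> {1..n}" and Si: "S = exp (qm i) * cmod (y i (qm i))" by blast
  define q where "q = qm i"
  have q: "q \<in> {-r..t\<^sub>1}" "S = exp q * cmod (y i q)" using qm(1) Si unfolding q_def by auto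
  have "S \<ge> 0" unfolding q(2) by simp
  have y_le: "cmod (y k s) \<le> S * exp (- s)" if "k \<in> {1..n}" "s \<in> {-r..t\<^sub>1}" for k s
    using S_ge[OF that] by (simp add: exp_minus field_simps)
  have E_le: "\<bar>E j s\<bar> \<le> \<rho> * S * exp (- s)" if j: "j \<in> {1..n}" and s: "s \<in> {-r..t\<^sub>1}" for j s
  proof -
    have "(\<Sum>k=1..n. R j k * y k s) = (\<Sum>k=1..n. \<Sum>p=1..n. R j k * P k p * complex_of_real (E p s))"
      unfolding y_def by (simp add: sum_distrib_left mult.assoc)
    also have "\<dots> = (\<Sum>p=1..n. \<Sum>k=1..n. R j k * P k p * complex_of_real (E p s))" by (rule sum.swap)
    also have "\<dots> = (\<Sum>p=1..n. (if j = p then 1 else 0) * complex_of_real (E p s))"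
      unfolding sum_distrib_right[symmetric] using RP[OF j] by (intro sum.cong) auto
    also have "\<dots> = (\<Sum>p=1..n. if j = p then complex_of_real (E p s) else 0)" by (intro sum.cong) auto
    also have "\<dots> = complex_of_real (E j s)" using j by simp
    finally have "\<bar>E j s\<bar> = cmod (\<Sum>k=1..n. R j k * y k s)" by simp
    also have "\<dots> \<le> (\<Sum>k=1..n. cmod (R j k) * (S * exp (- s)))"
      using y_le s by (intro sum_norm_le) (auto simp: norm_mult intro!: mult_left_mono)
    also have "\<dots> \<le> \<rho> * (S * exp (- s))"
      unfolding sum_distrib_right[symmetric] using rowR[OF j] \<open>S \<ge> 0\<close> by (intro mult_right_mono) auto
    finally show ?thesis by (simp add: mult.assoc)
  qed
  have "E\<^sub>0 \<ge> 0" using init[of 1 0] \<open>n \<ge> 1\<close> \<open>r \<ge> 0\<close> by auto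
  have y_init: "cmod (y k s) \<le> \<pi> * E\<^sub>0" if "k \<in> {1..n}" "s \<in> {-r..0}" for k s
    unfolding y_def using that by (intro P_le init)
  have "S \<le> 4 * \<pi> * (E\<^sub>0 + F)"
  proof (cases "q \<le> 0")
    case True
    have "S \<le> 1 * (\<pi> * E\<^sub>0)"
      unfolding q(2) using True q(1) i by (intro mult_mono y_init) auto
    moreover have "0 \<le> \<pi> * E\<^sub>0" "0 \<le> \<pi> * F" using \<pi> \<open>E\<^sub>0 \<ge> 0\<close> \<open>F \<ge> 0\<close> by auto
    ultimately show ?thesis by (simp add: distrib_left)
  next
    case False
    then have q0: "0 \<le> q" "q \<le> t\<^sub>1" using q(1) by auto
    \<comment> \<open>The decay rate; it exceeds the rate \<open>1\<close> of the weight by \<open>\<theta> \<sigma> / 2\<close> at least.\<close>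
    define a where "a = - \<theta> * Re (l i)"
    have "\<theta> * \<sigma> \<le> a" unfolding a_def using l[OF i] \<theta>(1) mult_left_mono[of \<sigma> "- Re (l i)" \<theta>] by simp
    then have a: "a > 1" "a - 1 \<ge> \<theta> * \<sigma> / 2" using \<theta>(2) by linarith+
    define B where "B = (\<theta> * \<sigma> / 4 + \<pi> * A) * S + \<pi> * F"
    have "B \<ge> 0" unfolding B_def using \<theta>(2) \<pi> \<open>A \<ge> 0\<close> \<open>F \<ge> 0\<close> \<open>S \<ge> 0\<close> by simp
    have "cmod (y i q) \<le> exp (- a * q) * cmod (y i 0) + B * exp (- q) / (a - 1)"
      unfolding y_def
    proof (rule linear_ode_bound[where N = N and \<mu> = "\<theta> * l i" and g' = "\<lambda>j t. \<theta> * (\<Sum>k=1..n. m j k * E k t) + g j t"])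
      fix t assume t: "t \<in> {0<..<q} - N"
      then have t': "t \<in> {0<..<t\<^sub>1} - N" "t \<in> {-r..t\<^sub>1}" using q0 \<open>r \<ge> 0\<close> by auto
      have "(\<Sum>j=1..n. P i j * complex_of_real (\<Sum>k=1..n. m j k * E k t))
          = (\<Sum>j=1..n. \<Sum>k=1..n. P i j * complex_of_real (m j k) * complex_of_real (E k t))"
        by (simp add: sum_distrib_left mult.assoc)
      also have "\<dots> = (\<Sum>k=1..n. \<Sum>j=1..n. P i j * complex_of_real (m j k) * complex_of_real (E k t))"
        by (rule sum.swap)
      also have "\<dots> = (\<Sum>k=1..n. (l i * P i k + (\<Sum>j=1..n. T i j * P j k)) * complex_of_real (E k t))"
        unfolding sum_distrib_right[symmetric] using PM[OF i] by (intro sum.cong) auto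
      also have "\<dots> = l i * y i t + (\<Sum>k=1..n. \<Sum>j=1..n. T i j * P j k * complex_of_real (E k t))"
        unfolding y_def by (simp add: distrib_right sum.distrib sum_distrib_left sum_distrib_right mult.assoc)
      also have "(\<Sum>k=1..n. \<Sum>j=1..n. T i j * P j k * complex_of_real (E k t)) = (\<Sum>j=1..n. T i j * y j t)"
        unfolding y_def by (subst sum.swap) (simp add: sum_distrib_left mult.assoc)
      finally have PME: "(\<Sum>j=1..n. P i j * complex_of_real (\<Sum>k=1..n. m j k * E k t)) = l i * y i t + (\<Sum>j=1..n. T i j * y j t)" .
      have lin: "P i j * complex_of_real (\<theta> * s + b) = \<theta> * (P i j * complex_of_real s) + P i j * complex_of_real b" for j s b
        by (simp add: algebra_simps)
      have "(\<Sum>j=1..n. P i j * complex_of_real (\<theta> * (\<Sum>k=1..n. m j k * E k t) + g j t))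
          = \<theta> * (\<Sum>j=1..n. P i j * complex_of_real (\<Sum>k=1..n. m j k * E k t)) + (\<Sum>j=1..n. P i j * complex_of_real (g j t))"
        by (simp only: lin sum.distrib sum_distrib_left[symmetric])
      then have "(\<Sum>j=1..n. P i j * complex_of_real (\<theta> * (\<Sum>k=1..n. m j k * E k t) + g j t)) - \<theta> * l i * y i t
          = \<theta> * (\<Sum>j=1..n. T i j * y j t) + (\<Sum>j=1..n. P i j * complex_of_real (g j t))"
        unfolding PME by (simp add: distrib_left)
      also have "cmod \<dots> \<le> \<theta> * cmod (\<Sum>j=1..n. T i j * y j t) + cmod (\<Sum>j=1..n. P i j * complex_of_real (g j t))"
        using \<theta>(1) by (intro norm_triangle_le) (simp add: norm_mult)
      also have "\<dots> \<le> \<theta> * (\<sigma> / 4 * (S * exp (- t))) + \<pi> * ((A * S + F) * exp (- t))"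
      proof (intro add_mono mult_left_mono)
        have "cmod (\<Sum>j=1..n. T i j * y j t) \<le> (\<Sum>j=1..n. cmod (T i j) * (S * exp (- t)))"
          using y_le t'(2) by (intro sum_norm_le) (auto simp: norm_mult intro!: mult_left_mono)
        also have "\<dots> \<le> \<sigma> / 4 * (S * exp (- t))"
          unfolding sum_distrib_right[symmetric] using T[OF i] \<open>S \<ge> 0\<close> by (intro mult_right_mono) auto
        finally show "cmod (\<Sum>j=1..n. T i j * y j t) \<le> \<sigma> / 4 * (S * exp (- t))" .
        show "cmod (\<Sum>j=1..n. P i j * complex_of_real (g j t)) \<le> \<pi> * ((A * S + F) * exp (- t))"
          by (rule P_le[OF i]) (rule pert[OF \<open>S \<ge> 0\<close> E_le _ t'(1)])
      qed (use \<theta> in auto)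
      also have "\<dots> = B * exp (- t)" unfolding B_def by (simp add: algebra_simps)
      finally show "cmod ((\<Sum>j=1..n. P i j * complex_of_real (\<theta> * (\<Sum>k=1..n. m j k * E k t) + g j t))
          - \<theta> * l i * (\<Sum>j=1..n. P i j * complex_of_real (E j t))) \<le> B * exp (- t)" unfolding y_def .
    next
      fix j assume j: "j \<in> {1..n}"
      show "abs_cont_on 0 q (E j)" by (rule abs_cont_on_subset[OF ac[OF j]]) (use q0 in auto)
      show "continuous_on {0..q} (E j)" by (rule continuous_on_subset[OF cont[OF j]]) (use q0 \<open>r \<ge> 0\<close> in auto)
    next
      fix j t assume "j \<in> {1..n}" "t \<in> {0<..<q} - N"
      then show "(E j has_real_derivative \<theta> * (\<Sum>k=1..n. m j k * E k t) + g j t) (at t)"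
        using q0 by (intro deriv) auto
    qed (use q0 a \<open>B \<ge> 0\<close> \<open>negligible N\<close> in \<open>auto simp: a_def\<close>)
    then have "S \<le> exp q * (exp (- a * q) * cmod (y i 0) + B * exp (- q) / (a - 1))"
      unfolding q(2) by (intro mult_left_mono) auto
    also have "\<dots> = exp (q - a * q) * cmod (y i 0) + B / (a - 1)"
    proof -
      have "b * (c * v + B * c' / (a - 1)) = (b * c) * v + B * (b * c') / (a - 1)" for b c c' v :: real
        by (simp add: distrib_left)
      moreover have "exp q * exp (- a * q) = exp (q - a * q)" "exp q * exp (- q) = 1"
        by (simp_all flip: exp_add)
      ultimately show ?thesis by simp
    qed
    also have "\<dots> \<le> 1 * (\<pi> * E\<^sub>0) + B / (\<theta> * \<sigma> / 2)"
    proof (intro add_mono mult_mono)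
      have "q - a * q = - ((a - 1) * q)" by (simp add: algebra_simps)
      then show "exp (q - a * q) \<le> 1" using a(1) q0(1) by simp
      show "cmod (y i 0) \<le> \<pi> * E\<^sub>0" using y_init[OF i] \<open>r \<ge> 0\<close> by simp
      show "B / (a - 1) \<le> B / (\<theta> * \<sigma> / 2)"
        using a \<open>B \<ge> 0\<close> \<theta>(2) by (intro divide_left_mono) auto
    qed auto
    finally have "S \<le> \<pi> * E\<^sub>0 + B / (\<theta> * \<sigma> / 2)" by simp
    moreover have "B / (\<theta> * \<sigma> / 2) \<le> S / 2 + S / 4 + \<pi> * F"
    proof -
      have "2 * \<pi> * A * S \<le> \<theta> * \<sigma> / 4 * S" using gain \<open>S \<ge> 0\<close> by (rule mult_right_mono)
      moreover have "2 * (\<pi> * F) \<le> \<theta> * \<sigma> * (\<pi> * F)"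
        using \<theta>(2) \<pi> \<open>F \<ge> 0\<close> by (intro mult_right_mono) auto
      ultimately have "B \<le> (S / 2 + S / 4 + \<pi> * F) * (\<theta> * \<sigma> / 2)"
        unfolding B_def by (simp add: algebra_simps)
      then show ?thesis using \<theta>(2) by (simp add: pos_divide_le_eq)
    qed
    ultimately show ?thesis by (simp add: algebra_simps)
  qed
  with \<open>S \<ge> 0\<close> E_le show ?thesis using that by blast
qed

section \<open>The estimation error\<close>

lemma closed_loop_row_sum:
  assumes "j \<in> {1..n}"
  shows "(\<Sum>k=1..n. (A_mat n + outer n K c_vec) $$ (j - 1, k - 1) * v k)
    = (if j < n then v (j + 1) else 0) + K j * (v 1 :: real)"
proof -
  have "(A_mat n + outer n K c_vec) $$ (j - 1, k - 1) * v k
      = (if k = j + 1 then v (j + 1) else 0) + (if k = 1 then K j * v 1 else 0)" if "k \<in> {1..n}" for k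
    using assms that unfolding A_mat_def outer_def c_vec_def by (cases k) (auto simp: algebra_simps)
  then have "(\<Sum>k=1..n. (A_mat n + outer n K c_vec) $$ (j - 1, k - 1) * v k)
      = (\<Sum>k=1..n. (if k = j + 1 then v (j + 1) else 0) + (if k = 1 then K j * v 1 else 0))"
    by (intro sum.cong) auto
  also have "\<dots> = (if j < n then v (j + 1) else 0) + K j * v 1"
    using assms by (simp add: sum.distrib)
  finally show ?thesis .
qed

text \<open>
  The peak estimate applied to the scaled error. The first part of the gain condition stems from
  the functionals \<open>f\<^sub>j\<close>: for a triangular system, \<open>\<theta>\<^sup>k / \<theta>\<^sup>j \<le> 1\<close> for all arguments of \<open>f\<^sub>j\<close>. The second part stems
  from the predictor, whose drift between samples involves the unscaled components \<open>e\<^sub>1\<close> and \<open>e\<^sub>2\<close>.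
  The factors \<open>3\<close> bound \<open>exp \<delta> \<le> exp 1\<close>, the loss from comparing the weight at \<open>t\<close> with the weight
  at the last sampling time. The factors \<open>exp r\<close> arise in the same way from histories.
\<close>

lemma sampled_observer_error_bound:
  fixes f :: "nat \<Rightarrow> (nat \<Rightarrow> real \<Rightarrow> real) \<Rightarrow> 'u \<Rightarrow> real"
    and P R T :: "nat \<Rightarrow> nat \<Rightarrow> complex" and l :: "nat \<Rightarrow> complex" and n :: nat
  defines "\<pi> \<equiv> \<Sum>i=1..n. \<Sum>j=1..n. cmod (P i j)" and "\<rho> \<equiv> \<Sum>i=1..n. \<Sum>j=1..n. cmod (R i j)"
  assumes "r > 0" "n \<ge> 2"
    and L: "L \<ge> 0" "\<forall>i\<in>{1..n}. \<forall>\<phi>\<in>C0 r i. \<forall>\<psi>\<in>C0 r i. \<forall>u.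
           \<bar>f i \<phi> u - f i \<psi> u\<bar> \<le> L * (\<Sum>j=1..i. scalar_hist_norm r (\<phi> j - \<psi> j))"
    and l: "\<And>i. i \<in> {1..n} \<Longrightarrow> Re (l i) \<le> - \<sigma>"
    and PM: "\<And>i k. i \<in> {1..n} \<Longrightarrow> k \<in> {1..n} \<Longrightarrow>
       (\<Sum>j=1..n. P i j * complex_of_real ((A_mat n + outer n K c_vec) $$ (j - 1, k - 1)))
         = l i * P i k + (\<Sum>j=1..n. T i j * P j k)"
    and T: "\<And>i. i \<in> {1..n} \<Longrightarrow> (\<Sum>j=1..n. cmod (T i j)) \<le> \<sigma> / 4"
    and RP: "\<And>i k. i \<in> {1..n} \<Longrightarrow> k \<in> {1..n} \<Longrightarrow> (\<Sum>j=1..n. R i j * P j k) = (if i = k then 1 else 0)"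
    and \<theta>: "\<theta> \<ge> 1" "\<theta> * \<sigma> \<ge> 2" and \<delta>: "0 \<le> \<delta>" "\<delta> \<le> 1" and \<kappa>: "\<And>j. j \<in> {1..n} \<Longrightarrow> \<bar>K j\<bar> \<le> \<kappa>"
    and gain: "2 * \<pi> * (L * n * \<rho> * exp r + 3 * \<kappa> * \<delta> * (L * \<theta> * \<rho> * exp r + \<theta>\<^sup>2 * \<rho>)) \<le> \<theta> * \<sigma> / 4"
    and \<tau>: "sampling_sequence \<delta> \<tau>" and x0: "x0 \<in> C0 r n" and z0: "z0 \<in> C0 r n"
    and sol: "system_solution r n f K \<theta> \<tau> u d \<xi> x0 z0 x z w"
    and t1: "t\<^sub>1 \<ge> 0"
    and D: "D \<ge> 0" "\<And>j s. j \<in> {1..n} \<Longrightarrow> s \<in> {0..t\<^sub>1} \<Longrightarrow> \<bar>d j s\<bar> \<le> D * exp (- s)"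
    and \<Xi>: "\<Xi> \<ge> 0" "\<And>s. s \<in> {0..t\<^sub>1} \<Longrightarrow> \<bar>\<xi> s\<bar> \<le> \<Xi> * exp (- s)"
  shows "hist_norm r n (hist r n z t\<^sub>1 - hist r n x t\<^sub>1)
    \<le> 4 * \<pi> * n * \<theta> ^ n * \<rho> * exp r * exp (- t\<^sub>1)
      * (hist_norm r n x0 + hist_norm r n z0 + (D + 3 * \<kappa> * (\<Xi> + \<delta> * D)))"
proof -
  let ?\<Theta> = "L * \<theta> * \<rho> * exp r + \<theta>\<^sup>2 * \<rho>"
  let ?A = "L * n * \<rho> * exp r + 3 * \<kappa> * \<delta> * ?\<Theta>"
  let ?F = "D + 3 * \<kappa> * (\<Xi> + \<delta> * D)"
  have "n \<ge> 1" "1 \<in> {1..n}" "2 \<in> {1..n}" using \<open>n \<ge> 2\<close> by auto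
  have "\<kappa> \<ge> 0" using \<kappa>[OF \<open>1 \<in> {1..n}\<close>] by simp
  have "\<pi> \<ge> 0" "\<rho> \<ge> 0" unfolding \<pi>_def \<rho>_def by (auto intro!: sum_nonneg)
  have plant: "plant_solution r n f u d x0 x" and obs: "observer_solution r n f K \<theta> u w z0 z"
    and pred: "predictor_solution r f \<tau> u \<xi> x z w"
    using sol unfolding system_solution_def by auto
  have contx: "continuous_on {-r..} (x j)" and contz: "continuous_on {-r..} (z j)"
    and acx: "b > 0 \<Longrightarrow> abs_cont_on 0 b (x j)" and acz: "b > 0 \<Longrightarrow> abs_cont_on 0 b (z j)" if "j \<in> {1..n}" for j b
    using plant obs that unfolding plant_solution_def observer_solution_def admissible_def by auto
  have histx: "hist r n x 0 = x0" and histz: "hist r n z 0 = z0"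
    using plant obs unfolding plant_solution_def observer_solution_def admissible_def by auto
  obtain N1 where N1: "negligible N1" "\<And>t. t \<in> {0..} \<Longrightarrow> t \<notin> N1 \<Longrightarrow> \<forall>i\<in>{1..n}.
        (x i has_real_derivative
           f i (hist r i x t) (u t) + (if i < n then x (i + 1) t else 0) + d i t) (at t)"
    by (rule ae_imp_negligible[where S = "{0..}" and P = "\<lambda>t. \<forall>i\<in>{1..n}. (x i has_real_derivative
           f i (hist r i x t) (u t) + (if i < n then x (i + 1) t else 0) + d i t) (at t)"])
       (use plant in \<open>auto simp: plant_solution_def\<close>)
  obtain N2 where N2: "negligible N2" "\<And>t. t \<in> {0..} \<Longrightarrow> t \<notin> N2 \<Longrightarrow> \<forall>i\<in>{1..n}.
        (z i has_real_derivative
           f i (hist r i z t) (u t) + (if i < n then z (i + 1) t else 0)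
           + \<theta> ^ i * K i * ((\<Sum>j=1..n. c_vec j * z j t) - w t)) (at t)"
    by (rule ae_imp_negligible[where S = "{0..}" and P = "\<lambda>t. \<forall>i\<in>{1..n}. (z i has_real_derivative
           f i (hist r i z t) (u t) + (if i < n then z (i + 1) t else 0)
           + \<theta> ^ i * K i * ((\<Sum>j=1..n. c_vec j * z j t) - w t)) (at t)"])
       (use obs in \<open>auto simp: observer_solution_def\<close>)
  have "\<exists>N. negligible N \<and> (\<forall>t\<in>{\<tau> k..<\<tau> (Suc k)}. t \<notin> N \<longrightarrow>
      (w has_real_derivative f 1 (hist r 1 z t) (u t) + z 2 t) (at t))" for k
  proof -
    have "AE t in lebesgue_on {\<tau> k..<\<tau> (Suc k)}. (w has_real_derivative f 1 (hist r 1 z t) (u t) + z 2 t) (at t)"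
      using pred unfolding predictor_solution_def by blast
    then show ?thesis by (rule ae_imp_negligible) auto
  qed
  then obtain N3 where N3: "\<And>k. negligible (N3 k)"
    "\<And>k t. t \<in> {\<tau> k..<\<tau> (Suc k)} \<Longrightarrow> t \<notin> N3 k \<Longrightarrow> (w has_real_derivative f 1 (hist r 1 z t) (u t) + z 2 t) (at t)"
    by metis
  define N where "N = N1 \<union> N2 \<union> (\<Union>k. N3 k)"
  have "negligible N" unfolding N_def using N1(1) N2(1) N3(1) by (intro negligible_Un negligible_Union_nat) auto
  have dx: "(x i has_real_derivative
           f i (hist r i x t) (u t) + (if i < n then x (i + 1) t else 0) + d i t) (at t)"
    if "t \<in> {0..}" "t \<notin> N" "i \<in> {1..n}" for t i using N1(2)[of t] that unfolding N_def by auto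
  have dz: "(z i has_real_derivative
           f i (hist r i z t) (u t) + (if i < n then z (i + 1) t else 0) + \<theta> ^ i * K i * (z 1 t - w t)) (at t)"
    if "t \<in> {0..}" "t \<notin> N" "i \<in> {1..n}" for t i
    using N2(2)[of t] that output_sum[OF \<open>n \<ge> 1\<close>, of "\<lambda>j. z j t"] unfolding N_def by auto
  have dw: "(w has_real_derivative f 1 (hist r 1 z t) (u t) + z 2 t) (at t)"
    if "t \<in> {\<tau> k..<\<tau> (Suc k)}" "t \<notin> N" for t k using N3(2)[of t k] that unfolding N_def by auto
  define E where "E j q = (z j q - x j q) / \<theta> ^ j" for j q
  have e_eq: "z j q - x j q = \<theta> ^ j * E j q" for j q using \<theta>(1) unfolding E_def by simp
  define \<Delta> where "\<Delta> j t = f j (hist r j z t) (u t) - f j (hist r j x t) (u t)" for j t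
  define g where "g j t = (\<Delta> j t - d j t) / \<theta> ^ j - K j * (w t - x 1 t)" for j t
  have contE: "continuous_on {-r..t\<^sub>1} (E j)" if "j \<in> {1..n}" for j
    unfolding E_def using contx[OF that] contz[OF that] \<theta>(1)
    by (intro continuous_intros) (auto elim: continuous_on_subset)
  have acE: "abs_cont_on 0 t\<^sub>1 (E j)" if "j \<in> {1..n}" for j
  proof -
    have "abs_cont_on 0 (t\<^sub>1 + 1) (\<lambda>q. z j q - x j q)"
      using t1 by (intro abs_cont_on_diff acx acz that) auto
    then have "abs_cont_on 0 t\<^sub>1 (\<lambda>q. z j q - x j q)" by (rule abs_cont_on_subset) auto
    from this this show ?thesis
      by (rule abs_cont_on_dominated[where C = "1 / \<theta> ^ j"])
         (use \<theta>(1) in \<open>auto simp: E_def diff_divide_distrib[symmetric] abs_divide divide_right_mono\<close>)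
  qed
  have derE: "(E j has_real_derivative \<theta> * (\<Sum>k=1..n. (A_mat n + outer n K c_vec) $$ (j - 1, k - 1) * E k t) + g j t) (at t)"
    if j: "j \<in> {1..n}" and t: "t \<in> {0<..<t\<^sub>1} - N" for j t
  proof -
    let ?nx = "if j < n then E (j + 1) t else 0"
    have tt: "t \<in> {0..}" "t \<notin> N" using t by auto
    have "(E j has_real_derivative
        ((f j (hist r j z t) (u t) + (if j < n then z (j + 1) t else 0) + \<theta> ^ j * K j * (z 1 t - w t))
        - (f j (hist r j x t) (u t) + (if j < n then x (j + 1) t else 0) + d j t)) / \<theta> ^ j) (at t)"
      unfolding E_def[abs_def] by (rule DERIV_cdivide[OF DERIV_diff[OF dz[OF tt j] dx[OF tt j]]])
    moreover have "(f j (hist r j z t) (u t) + (if j < n then z (j + 1) t else 0) + \<theta> ^ j * K j * (z 1 t - w t))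
        - (f j (hist r j x t) (u t) + (if j < n then x (j + 1) t else 0) + d j t)
        = (\<Delta> j t - d j t) + \<theta> ^ j * (\<theta> * ?nx + K j * (\<theta> * E 1 t - (w t - x 1 t)))"
    proof -
      have "(if j < n then z (j + 1) t else 0) - (if j < n then x (j + 1) t else 0) = \<theta> ^ j * (\<theta> * ?nx)"
        using e_eq[of "j + 1" t] by simp
      moreover have "z 1 t - w t = \<theta> * E 1 t - (w t - x 1 t)" using e_eq[of 1 t] by simp
      ultimately show ?thesis unfolding \<Delta>_def by (simp add: algebra_simps)
    qed
    moreover have "((\<Delta> j t - d j t) + \<theta> ^ j * (\<theta> * ?nx + K j * (\<theta> * E 1 t - (w t - x 1 t)))) / \<theta> ^ j
        = \<theta> * (?nx + K j * E 1 t) + g j t"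
    proof -
      have "(a + \<theta> ^ j * b) / \<theta> ^ j = a / \<theta> ^ j + b" for a b using \<theta>(1) by (simp add: add_divide_distrib)
      moreover have "a + (\<theta> * b + c * (\<theta> * p - q)) = \<theta> * (b + c * p) + (a - c * q)" for a b c p q
        by (simp add: algebra_simps)
      ultimately show ?thesis unfolding g_def by (simp only:)
    qed
    ultimately show ?thesis unfolding closed_loop_row_sum[OF j] by (simp only:)
  qed
  have initE: "\<bar>E j q\<bar> \<le> hist_norm r n x0 + hist_norm r n z0" if j: "j \<in> {1..n}" and q: "q \<in> {-r..0}" for j q
  proof -
    have "x0 j q = x j q" "z0 j q = z j q"
      unfolding histx[symmetric] histz[symmetric] using j q by simp_all
    then have "\<bar>z j q - x j q\<bar> \<le> hist_norm r n x0 + hist_norm r n z0"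
      using C0_le_hist_norm[OF x0 j q] C0_le_hist_norm[OF z0 j q] by simp
    moreover have "\<bar>E j q\<bar> \<le> \<bar>z j q - x j q\<bar>"
      unfolding E_def using \<theta>(1) one_le_power[OF \<theta>(1), of j]
      by (simp add: abs_divide divide_le_eq mult_le_cancel_left1)
    ultimately show ?thesis by simp
  qed
  have pert: "\<bar>g j t\<bar> \<le> (?A * S + ?F) * exp (- t)"
    if "S \<ge> 0" and S: "\<And>k q. k \<in> {1..n} \<Longrightarrow> q \<in> {-r..t\<^sub>1} \<Longrightarrow> \<bar>E k q\<bar> \<le> \<rho> * S * exp (- q)"
      and j: "j \<in> {1..n}" and t: "t \<in> {0<..<t\<^sub>1} - N" for S j t
  proof -
    have eb: "\<bar>z k q - x k q\<bar> \<le> \<theta> ^ k * \<rho> * S * exp (- q)" if "k \<in> {1..n}" "q \<in> {-r..t\<^sub>1}" for k q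
      unfolding e_eq using S[OF that] \<theta>(1) by (simp add: abs_mult mult.assoc)
    have \<Delta>b: "\<bar>\<Delta> i s\<bar> \<le> L * (\<Sum>k=1..i. \<theta> ^ k * \<rho> * S * (exp r * exp (- s)))"
      if i: "i \<in> {1..n}" and s: "s \<in> {0..t\<^sub>1}" for i s
      unfolding \<Delta>_def
    proof (rule functional_diff_le[OF _ L(1)])
      fix k q assume kq: "k \<in> {1..i}" "q \<in> {s - r..s}"
      then have "\<bar>z k q - x k q\<bar> \<le> \<theta> ^ k * \<rho> * S * exp (- q)" using i s by (intro eb) auto
      also have "\<dots> \<le> \<theta> ^ k * \<rho> * S * exp (r + - s)"
        using kq \<theta>(1) \<open>\<rho> \<ge> 0\<close> \<open>S \<ge> 0\<close> by (intro mult_left_mono) auto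
      finally show "\<bar>z k q - x k q\<bar> \<le> \<theta> ^ k * \<rho> * S * (exp r * exp (- s))" by (simp only: exp_add)
    qed (use L(2) i s \<open>r > 0\<close> contx contz in auto)
    have g1: "\<bar>\<Delta> j t / \<theta> ^ j\<bar> \<le> L * n * \<rho> * exp r * S * exp (- t)"
    proof -
      have "\<bar>\<Delta> j t\<bar> \<le> L * (\<Sum>k=1..j. \<theta> ^ k * \<rho> * S * (exp r * exp (- t)))" using t by (intro \<Delta>b j) auto
      also have "\<dots> \<le> L * (\<Sum>k=1..j. \<theta> ^ j * \<rho> * S * (exp r * exp (- t)))"
        using \<theta>(1) \<open>\<rho> \<ge> 0\<close> \<open>S \<ge> 0\<close> L(1)
        by (intro mult_left_mono sum_mono mult_right_mono power_increasing) auto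
      also have "\<dots> = L * (j * (\<theta> ^ j * \<rho> * S * (exp r * exp (- t))))" by simp
      also have "\<dots> \<le> L * (n * (\<theta> ^ j * \<rho> * S * (exp r * exp (- t))))"
        using j \<theta>(1) \<open>\<rho> \<ge> 0\<close> \<open>S \<ge> 0\<close> L(1) by (intro mult_left_mono mult_right_mono) auto
      also have "\<dots> = (L * n * \<rho> * exp r * S * exp (- t)) * \<theta> ^ j" by (simp add: mult_ac)
      finally show ?thesis using \<theta>(1) by (simp add: abs_divide pos_divide_le_eq)
    qed
    have g2: "\<bar>d j t / \<theta> ^ j\<bar> \<le> D * exp (- t)"
    proof -
      have "\<bar>d j t / \<theta> ^ j\<bar> \<le> \<bar>d j t\<bar>"
        using \<theta>(1) one_le_power[OF \<theta>(1), of j] by (simp add: abs_divide divide_le_eq mult_le_cancel_left1)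
      also have "\<dots> \<le> D * exp (- t)" using t by (intro D j) auto
      finally show ?thesis .
    qed
    \<comment> \<open>The predictor error is the measurement error at the last sample plus the drift since then.\<close>
    have g3: "\<bar>w t - x 1 t\<bar> \<le> 3 * (\<Xi> + \<delta> * (?\<Theta> * S + D)) * exp (- t)"
    proof -
      define k where "k = sample_index \<tau> t"
      have k: "0 \<le> \<tau> k" "\<tau> k \<le> t" "t < \<tau> (Suc k)" "t - \<tau> k \<le> \<delta>"
      proof -
        show "0 \<le> \<tau> k" by (rule sampling_nonneg[OF \<tau>])
        show "\<tau> k \<le> t" "t < \<tau> (Suc k)" unfolding k_def using t by (auto intro: sample_index_le[OF \<tau>] sample_index_less[OF \<tau>])
        moreover have "\<tau> (Suc k) - \<tau> k \<le> \<delta>" using \<tau> unfolding sampling_sequence_def by blast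
        ultimately show "t - \<tau> k \<le> \<delta>" by linarith
      qed
      have "abs_cont_on (\<tau> k) t w" using pred k unfolding predictor_solution_def by auto
      moreover have "abs_cont_on (\<tau> k) t (x 1)"
        by (rule abs_cont_on_subset[OF acx[OF \<open>1 \<in> {1..n}\<close>, of t]]) (use t k in auto)
      ultimately have "abs_cont_on (\<tau> k) t (\<lambda>s. w s - x 1 s)" by (rule abs_cont_on_diff)
      then have "\<bar>(w t - x 1 t) - (w (\<tau> k) - x 1 (\<tau> k))\<bar> \<le> ((?\<Theta> * S + D) * exp (- \<tau> k)) * (t - \<tau> k)"
      proof (rule abs_cont_on_increment_bound[OF _ k(2) \<open>negligible N\<close>])
        fix s assume s: "s \<in> {\<tau> k<..<t} - N"
        then have s': "s \<in> {0..t\<^sub>1}" "s \<in> {0..}" "s \<notin> N" "s \<in> {\<tau> k..<\<tau> (Suc k)}" "s \<in> {-r..t\<^sub>1}"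
          using k t \<open>r > 0\<close> by auto
        have "((\<lambda>s. w s - x 1 s) has_real_derivative
            (f 1 (hist r 1 z s) (u s) + z 2 s) - (f 1 (hist r 1 x s) (u s) + (if 1 < n then x (1 + 1) s else 0) + d 1 s)) (at s)"
          by (rule DERIV_diff[OF dw[OF s'(4,3)] dx[OF s'(2,3) \<open>1 \<in> {1..n}\<close>]])
        moreover have "(f 1 (hist r 1 z s) (u s) + z 2 s) - (f 1 (hist r 1 x s) (u s) + (if 1 < n then x (1 + 1) s else 0) + d 1 s)
            = \<Delta> 1 s + (z 2 s - x 2 s) - d 1 s" unfolding \<Delta>_def using \<open>n \<ge> 2\<close> by (simp add: numeral_2_eq_2)
        moreover have "\<bar>\<Delta> 1 s + (z 2 s - x 2 s) - d 1 s\<bar> \<le> (?\<Theta> * S + D) * exp (- \<tau> k)"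
        proof -
          have "\<bar>\<Delta> 1 s\<bar> \<le> L * \<theta> * \<rho> * exp r * S * exp (- s)"
            using \<Delta>b[OF \<open>1 \<in> {1..n}\<close> s'(1)] by (simp add: mult_ac)
          moreover have "\<bar>z 2 s - x 2 s\<bar> \<le> \<theta>\<^sup>2 * \<rho> * S * exp (- s)" using eb[OF \<open>2 \<in> {1..n}\<close> s'(5)] .
          moreover have "\<bar>d 1 s\<bar> \<le> D * exp (- s)" using D(2)[OF \<open>1 \<in> {1..n}\<close> s'(1)] .
          ultimately have "\<bar>\<Delta> 1 s + (z 2 s - x 2 s) - d 1 s\<bar>
              \<le> L * \<theta> * \<rho> * exp r * S * exp (- s) + \<theta>\<^sup>2 * \<rho> * S * exp (- s) + D * exp (- s)" by linarith
          also have "\<dots> = (?\<Theta> * S + D) * exp (- s)" by (simp add: algebra_simps)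
          also have "\<dots> \<le> (?\<Theta> * S + D) * exp (- \<tau> k)"
            using s L(1) \<theta>(1) \<open>\<rho> \<ge> 0\<close> \<open>S \<ge> 0\<close> D(1) by (intro mult_left_mono add_nonneg_nonneg mult_nonneg_nonneg) auto
          finally show ?thesis .
        qed
        ultimately show "\<exists>B. \<bar>B\<bar> \<le> (?\<Theta> * S + D) * exp (- \<tau> k) \<and> ((\<lambda>s. w s - x 1 s) has_real_derivative B) (at s)"
          by metis
      qed
      also have "\<dots> \<le> ((?\<Theta> * S + D) * exp (- \<tau> k)) * \<delta>"
        using k(4) L(1) \<theta>(1) \<open>\<rho> \<ge> 0\<close> \<open>S \<ge> 0\<close> D(1) by (intro mult_left_mono mult_nonneg_nonneg add_nonneg_nonneg) auto
      finally have inc: "\<bar>(w t - x 1 t) - (w (\<tau> k) - x 1 (\<tau> k))\<bar> \<le> \<delta> * (?\<Theta> * S + D) * exp (- \<tau> k)"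
        by (simp add: mult_ac)
      have "w (\<tau> k) - x 1 (\<tau> k) = \<xi> (\<tau> k)" using pred unfolding predictor_solution_def by simp
      then have "\<bar>w (\<tau> k) - x 1 (\<tau> k)\<bar> \<le> \<Xi> * exp (- \<tau> k)" using \<Xi>(2)[of "\<tau> k"] k t by simp
      with inc have "\<bar>w t - x 1 t\<bar> \<le> (\<Xi> + \<delta> * (?\<Theta> * S + D)) * exp (- \<tau> k)"
        by (simp add: distrib_right)
      also have "\<dots> \<le> (\<Xi> + \<delta> * (?\<Theta> * S + D)) * (3 * exp (- t))"
      proof (rule mult_left_mono)
        have "exp (- \<tau> k) = exp (t - \<tau> k) * exp (- t)" by (simp flip: exp_add)
        also have "\<dots> \<le> 3 * exp (- t)"
        proof (rule mult_right_mono)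
          have "exp (t - \<tau> k) \<le> exp 1" using k(4) \<delta>(2) by simp
          then show "exp (t - \<tau> k) \<le> 3" using exp_le by linarith
        qed simp
        finally show "exp (- \<tau> k) \<le> 3 * exp (- t)" .
        show "0 \<le> \<Xi> + \<delta> * (?\<Theta> * S + D)"
          using L(1) \<theta>(1) \<open>\<rho> \<ge> 0\<close> \<open>S \<ge> 0\<close> D(1) \<Xi>(1) \<delta>(1) by (intro add_nonneg_nonneg mult_nonneg_nonneg) auto
      qed
      finally show ?thesis by (simp only: mult_ac)
    qed
    have "\<bar>K j * (w t - x 1 t)\<bar> \<le> \<kappa> * (3 * (\<Xi> + \<delta> * (?\<Theta> * S + D)) * exp (- t))"
      unfolding abs_mult using \<kappa>[OF j] g3 \<open>\<kappa> \<ge> 0\<close> by (intro mult_mono) auto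
    then have "\<bar>g j t\<bar> \<le> L * n * \<rho> * exp r * S * exp (- t) + D * exp (- t) + \<kappa> * (3 * (\<Xi> + \<delta> * (?\<Theta> * S + D)) * exp (- t))"
      using g1 g2 unfolding g_def diff_divide_distrib by linarith
    also have "\<dots> = (?A * S + ?F) * exp (- t)" by (simp add: algebra_simps)
    finally show ?thesis .
  qed
  have "?A \<ge> 0" "?F \<ge> 0"
    using L(1) \<theta>(1) \<open>\<rho> \<ge> 0\<close> \<open>\<kappa> \<ge> 0\<close> \<delta>(1) D(1) \<Xi>(1) by (auto intro!: add_nonneg_nonneg mult_nonneg_nonneg)
  obtain S where "0 \<le> S" and S: "S \<le> 4 * \<pi> * ((hist_norm r n x0 + hist_norm r n z0) + ?F)"
    and Eb: "\<And>j q. j \<in> {1..n} \<Longrightarrow> q \<in> {-r..t\<^sub>1} \<Longrightarrow> \<bar>E j q\<bar> \<le> \<rho> * S * exp (- q)"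
    unfolding \<pi>_def \<rho>_def
  proof (rule stable_system_peak_bound[of n l \<sigma> P "\<lambda>j k. (A_mat n + outer n K c_vec) $$ (j - 1, k - 1)" T R \<theta> r t\<^sub>1 E N g
      "hist_norm r n x0 + hist_norm r n z0" ?A ?F])
    show "\<theta> > 0" "r \<ge> 0" using \<theta>(1) \<open>r > 0\<close> by auto
  qed (use \<open>n \<ge> 1\<close> l PM T RP \<theta>(2) t1 contE acE \<open>negligible N\<close> derE initE pert \<open>?A \<ge> 0\<close> \<open>?F \<ge> 0\<close> gain
       in \<open>simp_all only: \<pi>_def \<rho>_def\<close>)
  have "hist_norm r n (hist r n z t\<^sub>1 - hist r n x t\<^sub>1) \<le> n * (\<theta> ^ n * \<rho> * S * (exp r * exp (- t\<^sub>1)))"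
  proof (rule hist_norm_le)
    fix j p assume j: "j \<in> {1..n}" and p: "p \<in> {-r..0}"
    have "\<bar>(hist r n z t\<^sub>1 - hist r n x t\<^sub>1) j p\<bar> = \<theta> ^ j * \<bar>E j (t\<^sub>1 + p)\<bar>"
      using e_eq[of j "t\<^sub>1 + p"] j p \<theta>(1) by (simp add: abs_mult)
    also have "\<dots> \<le> \<theta> ^ n * (\<rho> * S * exp (- (t\<^sub>1 + p)))"
      using j p t1 \<theta>(1) by (intro mult_mono power_increasing Eb) auto
    also have "\<dots> \<le> \<theta> ^ n * (\<rho> * S * exp (r + - t\<^sub>1))"
      using p \<theta>(1) \<open>\<rho> \<ge> 0\<close> \<open>0 \<le> S\<close> by (intro mult_left_mono) auto
    finally show "\<bar>(hist r n z t\<^sub>1 - hist r n x t\<^sub>1) j p\<bar> \<le> \<theta> ^ n * \<rho> * S * (exp r * exp (- t\<^sub>1))"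
      by (simp only: exp_add mult.assoc)
  qed (use \<open>r > 0\<close> in simp)
  also have "\<dots> = (n * \<theta> ^ n * \<rho> * exp r * exp (- t\<^sub>1)) * S" by (simp add: mult_ac)
  also have "\<dots> \<le> (n * \<theta> ^ n * \<rho> * exp r * exp (- t\<^sub>1)) * (4 * \<pi> * ((hist_norm r n x0 + hist_norm r n z0) + ?F))"
    using S \<theta>(1) \<open>\<rho> \<ge> 0\<close> by (intro mult_left_mono) auto
  finally show ?thesis by (simp add: mult_ac)
qed

theorem theorem4p1:
  fixes r :: real and n :: nat
    and f :: "nat \<Rightarrow> (nat \<Rightarrow> real \<Rightarrow> real) \<Rightarrow> real ^ 'm \<Rightarrow> real"
    and K :: "nat \<Rightarrow> real"
  assumes "r > 0" and "n \<ge> 2"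
    and "\<And>i. i \<in> {1..n} \<Longrightarrow> globally_lipschitz r i (f i)"
    and "\<And>i. i \<in> {1..n} \<Longrightarrow> f i (zero_hist r i) 0 = 0"
    and "\<exists>L\<ge>0. \<forall>i\<in>{1..n}. \<forall>\<phi>\<in>C0 r i. \<forall>\<psi>\<in>C0 r i. \<forall>u.
           \<bar>f i \<phi> u - f i \<psi> u\<bar> \<le> L * (\<Sum>j=1..i. scalar_hist_norm r (\<phi> j - \<psi> j))"
    and "hurwitz (A_mat n + outer n K c_vec)"
  shows "\<exists>\<delta> \<omega> \<theta> Q1 Q2 Q3. \<delta> > 0 \<and> \<omega> > 0 \<and> \<theta> \<ge> 1 \<and> Q1 \<ge> 1 \<and> Q2 \<ge> 1 \<and> Q3 \<ge> 1 \<and>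
    (\<forall>\<tau> x0 z0 (u :: real \<Rightarrow> real ^ 'm) d \<xi>.
       sampling_sequence \<delta> \<tau> \<longrightarrow> x0 \<in> C0 r n \<longrightarrow> z0 \<in> C0 r n \<longrightarrow>
       Linf_loc u \<longrightarrow> (\<forall>i\<in>{1..n}. Linf_loc (d i)) \<longrightarrow> Linf_loc \<xi> \<longrightarrow>
       (\<exists>x z w. system_solution r n f K \<theta> \<tau> u d \<xi> x0 z0 x z w) \<and>
       (\<forall>x z w. system_solution r n f K \<theta> \<tau> u d \<xi> x0 z0 x z w \<longrightarrow>
          (\<forall>t\<ge>0. hist_norm r n (hist r n z t - hist r n x t)
             \<le> exp (- \<omega> * t) * Q1 * (hist_norm r n x0 + hist_norm r n z0)
               + Q2 * (SUP s\<in>{0..t}. \<bar>\<xi> s\<bar> * exp (- \<omega> * (t - s)))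
               + Q3 * (SUP s\<in>{0..t}. eucl_norm n (\<lambda>i. d i s)))))"
proof -
  obtain L where L: "L \<ge> 0" "\<forall>i\<in>{1..n}. \<forall>\<phi>\<in>C0 r i. \<forall>\<psi>\<in>C0 r i. \<forall>u.
           \<bar>f i \<phi> u - f i \<psi> u\<bar> \<le> L * (\<Sum>j=1..i. scalar_hist_norm r (\<phi> j - \<psi> j))"
    using assms(5) by blast
  have carrier: "A_mat n + outer n K c_vec \<in> carrier_mat n n" unfolding A_mat_def outer_def by simp
  obtain \<sigma> l P R T where "\<sigma> > 0" and l: "\<And>i. i \<in> {1..n} \<Longrightarrow> Re (l i) \<le> - \<sigma>"
    and PM: "\<And>i k. i \<in> {1..n} \<Longrightarrow> k \<in> {1..n} \<Longrightarrow>
       (\<Sum>j=1..n. P i j * complex_of_real ((A_mat n + outer n K c_vec) $$ (j - 1, k - 1)))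
         = l i * P i k + (\<Sum>j=1..n. T i j * P j k)"
    and T: "\<And>i. i \<in> {1..n} \<Longrightarrow> (\<Sum>j=1..n. cmod (T i j)) \<le> \<sigma> / 4"
    and RP: "\<And>i k. i \<in> {1..n} \<Longrightarrow> k \<in> {1..n} \<Longrightarrow> (\<Sum>j=1..n. R i j * P j k) = (if i = k then 1 else 0)"
    by (rule hurwitz_triangular_coordinates[OF assms(6) carrier], rule that)
  define \<pi> where "\<pi> = (\<Sum>i=1..n. \<Sum>j=1..n. cmod (P i j))"
  define \<rho> where "\<rho> = (\<Sum>i=1..n. \<Sum>j=1..n. cmod (R i j))"
  define \<kappa> where "\<kappa> = (\<Sum>j=1..n. \<bar>K j\<bar>)"
  have nn: "\<pi> \<ge> 0" "\<rho> \<ge> 0" "\<kappa> \<ge> 0" unfolding \<pi>_def \<rho>_def \<kappa>_def by (auto intro!: sum_nonneg)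
  have \<kappa>: "\<bar>K j\<bar> \<le> \<kappa>" if "j \<in> {1..n}" for j
    unfolding \<kappa>_def using that by (intro member_le_sum[of j "{1..n}" "\<lambda>j. \<bar>K j\<bar>"]) auto
  \<comment> \<open>The term \<open>2 / \<sigma>\<close> makes the decay rate \<open>\<theta> \<sigma>\<close> at least \<open>2\<close>; the last one lets the functionals \<open>f\<^sub>j\<close> use half of the admissible gain \<open>\<theta> \<sigma> / 4\<close>.\<close>
  define \<theta> where "\<theta> = 1 + 2 / \<sigma> + 16 * \<pi> * (L * n * \<rho> * exp r) / \<sigma>"
  define \<Theta> where "\<Theta> = L * \<theta> * \<rho> * exp r + \<theta>\<^sup>2 * \<rho>"
  \<comment> \<open>The predictor gets the other half, which is at least \<open>1 / 4\<close>.\<close>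
  define \<delta> where "\<delta> = 1 / (1 + 24 * \<pi> * \<kappa> * \<Theta>)"
  have nn': "0 \<le> 16 * \<pi> * (L * n * \<rho> * exp r)" using nn L(1) by simp
  have \<theta>: "\<theta> \<ge> 1" unfolding \<theta>_def using nn' \<open>\<sigma> > 0\<close> by simp
  have "\<theta> * \<sigma> = \<sigma> + 2 + 16 * \<pi> * (L * n * \<rho> * exp r)"
    unfolding \<theta>_def using \<open>\<sigma> > 0\<close> by (simp add: field_simps)
  then have \<theta>\<sigma>: "\<theta> * \<sigma> \<ge> 2" "16 * \<pi> * (L * n * \<rho> * exp r) \<le> \<theta> * \<sigma>" using nn' \<open>\<sigma> > 0\<close> by linarith+
  have "\<Theta> \<ge> 0" unfolding \<Theta>_def using nn L(1) \<theta> by simp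
  then have prod: "0 \<le> 24 * \<pi> * \<kappa> * \<Theta>" using nn by simp
  have \<delta>: "0 < \<delta>" "\<delta> \<le> 1" "24 * \<pi> * \<kappa> * \<Theta> * \<delta> \<le> 1"
    unfolding \<delta>_def using prod by (auto simp: divide_le_eq add_pos_nonneg)
  have gain: "2 * \<pi> * (L * n * \<rho> * exp r + 3 * \<kappa> * \<delta> * (L * \<theta> * \<rho> * exp r + \<theta>\<^sup>2 * \<rho>)) \<le> \<theta> * \<sigma> / 4"
  proof -
    have "2 * \<pi> * (L * n * \<rho> * exp r + 3 * \<kappa> * \<delta> * \<Theta>)
        = (16 * \<pi> * (L * n * \<rho> * exp r)) / 8 + (24 * \<pi> * \<kappa> * \<Theta> * \<delta>) / 4" by (simp add: algebra_simps)
    also have "\<dots> \<le> \<theta> * \<sigma> / 4" using \<theta>\<sigma> \<delta>(3) by linarith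
    finally show ?thesis unfolding \<Theta>_def .
  qed
  define Q where "Q = 4 * \<pi> * n * \<theta> ^ n * \<rho> * exp r"
  have "Q \<ge> 0" unfolding Q_def using nn \<theta> by simp
  show ?thesis
  proof (rule exI[of _ \<delta>], rule exI[of _ "1::real"], rule exI[of _ \<theta>], rule exI[of _ "Q + 1"],
      rule exI[of _ "3 * \<kappa> * Q + 1"], rule exI[of _ "(1 + 3 * \<kappa>) * Q + 1"], intro conjI allI impI)
    fix \<tau> x0 z0 and u :: "real \<Rightarrow> real ^ 'm"
      and d :: "nat \<Rightarrow> real \<Rightarrow> real" and \<xi> :: "real \<Rightarrow> real"
    assume \<tau>: "sampling_sequence \<delta> \<tau>" and x0: "x0 \<in> C0 r n" and z0: "z0 \<in> C0 r n"
      and u: "Linf_loc u" and d: "\<forall>i\<in>{1..n}. Linf_loc (d i)" and \<xi>: "Linf_loc \<xi>"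
    show "\<exists>x z w. system_solution r n f K \<theta> \<tau> u d \<xi> x0 z0 x z w"
      by (rule system_solution_exists[OF assms(1,2,3) L \<tau> x0 z0 u d \<xi>])
    fix x z w and t :: real
    assume sol: "system_solution r n f K \<theta> \<tau> u d \<xi> x0 z0 x z w" and t: "t \<ge> 0"
    let ?\<Xi> = "SUP s\<in>{0..t}. \<bar>\<xi> s\<bar> * exp (- 1 * (t - s))"
    let ?D = "SUP s\<in>{0..t}. eucl_norm n (\<lambda>i. d i s)"
    let ?E = "hist_norm r n x0 + hist_norm r n z0"
    have \<Xi>: "\<bar>\<xi> s\<bar> * exp (- 1 * (t - s)) \<le> ?\<Xi>" if s: "s \<in> {0..t}" for s
    proof (rule cSUP_upper[OF s])
      obtain C where C: "\<And>s. s \<in> {0..t} \<Longrightarrow> \<bar>\<xi> s\<bar> \<le> C"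
        using \<xi> unfolding Linf_loc_def bounded_iff by (metis imageI real_norm_def)
      show "bdd_above ((\<lambda>s. \<bar>\<xi> s\<bar> * exp (- 1 * (t - s))) ` {0..t})"
      proof (rule bdd_aboveI2[of _ _ C])
        fix s assume s: "s \<in> {0..t}"
        have "\<bar>\<xi> s\<bar> * exp (- 1 * (t - s)) \<le> \<bar>\<xi> s\<bar> * 1" using s by (intro mult_left_mono) auto
        then show "\<bar>\<xi> s\<bar> * exp (- 1 * (t - s)) \<le> C" using C[OF s] by simp
      qed
    qed
    have D: "eucl_norm n (\<lambda>i. d i s) \<le> ?D" if s: "s \<in> {0..t}" for s
    proof (rule cSUP_upper[OF s])
      have "\<exists>C. \<forall>s\<in>{0..t}. \<bar>d i s\<bar> \<le> C" if "i \<in> {1..n}" for i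
        using d that unfolding Linf_loc_def bounded_iff by (metis imageI real_norm_def)
      then obtain C where C: "\<And>i s. i \<in> {1..n} \<Longrightarrow> s \<in> {0..t} \<Longrightarrow> \<bar>d i s\<bar> \<le> C i" by metis
      show "bdd_above ((\<lambda>s. eucl_norm n (\<lambda>i. d i s)) ` {0..t})"
      proof (rule bdd_aboveI2[of _ _ "\<Sum>i=1..n. C i"])
        fix s assume s: "s \<in> {0..t}"
        have "eucl_norm n (\<lambda>i. d i s) \<le> (\<Sum>i=1..n. \<bar>d i s\<bar>)" unfolding eucl_norm_def by (rule L2_set_le_sum_abs)
        also have "\<dots> \<le> (\<Sum>i=1..n. C i)" using C s by (intro sum_mono) auto
        finally show "eucl_norm n (\<lambda>i. d i s) \<le> (\<Sum>i=1..n. C i)" .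
      qed
    qed
    have "0 \<in> {0..t}" using t by simp
    have "?\<Xi> \<ge> 0" using \<Xi>[OF \<open>0 \<in> {0..t}\<close>] by (rule order_trans[rotated]) simp
    have "?D \<ge> 0" using D[OF \<open>0 \<in> {0..t}\<close>] by (rule order_trans[OF eucl_norm_nonneg])
    have "?E \<ge> 0"
      using C0_le_hist_norm[OF x0, of 1 0] C0_le_hist_norm[OF z0, of 1 0] assms(1,2) by force
    \<comment> \<open>The suprema are rewritten with the weight \<open>exp (- s)\<close>. For \<open>d\<close> this gives away the factor \<open>exp (t - s)\<close>, for \<open>\<xi>\<close> nothing.\<close>
    have db: "\<bar>d j s\<bar> \<le> (?D * exp t) * exp (- s)" if "j \<in> {1..n}" "s \<in> {0..t}" for j s
    proof -
      have "\<bar>d j s\<bar> \<le> ?D * 1" using abs_le_eucl_norm[OF that(1), of "\<lambda>i. d i s"] D[OF that(2)] by simp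
      also have "\<dots> \<le> ?D * exp (t + - s)" using that(2) \<open>?D \<ge> 0\<close> by (intro mult_left_mono) auto
      finally show ?thesis by (simp only: exp_add mult.assoc)
    qed
    have \<xi>b: "\<bar>\<xi> s\<bar> \<le> (?\<Xi> * exp t) * exp (- s)" if "s \<in> {0..t}" for s
    proof -
      have "\<bar>\<xi> s\<bar> = (\<bar>\<xi> s\<bar> * exp (- 1 * (t - s))) * exp (t + - s)"
        by (simp add: mult.assoc flip: exp_add)
      also have "\<dots> \<le> ?\<Xi> * exp (t + - s)" using \<Xi>[OF that] by (intro mult_right_mono) auto
      finally show ?thesis by (simp only: exp_add mult.assoc)
    qed
    have "hist_norm r n (hist r n z t - hist r n x t)
        \<le> Q * exp (- t) * (?E + (?D * exp t + 3 * \<kappa> * (?\<Xi> * exp t + \<delta> * (?D * exp t))))"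
      unfolding Q_def \<pi>_def \<rho>_def
      by (rule sampled_observer_error_bound[OF assms(1,2) L l PM T RP \<theta> \<theta>\<sigma>(1) less_imp_le[OF \<delta>(1)] \<delta>(2) \<kappa>
            gain[unfolded \<pi>_def \<rho>_def] \<tau> x0 z0 sol t _ db _ \<xi>b])
         (use \<open>?D \<ge> 0\<close> \<open>?\<Xi> \<ge> 0\<close> in auto)
    also have "\<dots> = Q * exp (- t) * ?E + (exp (- t) * exp t) * (Q * (1 + 3 * \<kappa> * \<delta>) * ?D + 3 * \<kappa> * Q * ?\<Xi>)"
      by (simp add: algebra_simps)
    also have "exp (- t) * exp t = 1" by (simp flip: exp_add)
    also have "Q * exp (- t) * ?E + 1 * (Q * (1 + 3 * \<kappa> * \<delta>) * ?D + 3 * \<kappa> * Q * ?\<Xi>)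
        \<le> exp (- 1 * t) * (Q + 1) * ?E + (3 * \<kappa> * Q + 1) * ?\<Xi> + ((1 + 3 * \<kappa>) * Q + 1) * ?D"
    proof -
      have "Q * (1 + 3 * \<kappa> * \<delta>) * ?D \<le> Q * (1 + 3 * \<kappa> * 1) * ?D"
        using \<delta>(2) nn \<open>Q \<ge> 0\<close> \<open>?D \<ge> 0\<close> by (intro mult_left_mono mult_right_mono add_left_mono) auto
      moreover have "0 \<le> exp (- t) * ?E" using \<open>?E \<ge> 0\<close> by simp
      ultimately show ?thesis using \<open>?D \<ge> 0\<close> \<open>?\<Xi> \<ge> 0\<close> by (simp add: algebra_simps)
    qed
    finally show "hist_norm r n (hist r n z t - hist r n x t)
        \<le> exp (- 1 * t) * (Q + 1) * ?E + (3 * \<kappa> * Q + 1) * ?\<Xi> + ((1 + 3 * \<kappa>) * Q + 1) * ?D" .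
  qed (use \<delta>(1) \<theta> \<open>Q \<ge> 0\<close> nn in auto)
qed

end
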